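(* Notation: for complex-valued smooth functions $W,X,Y,Z$ of $(u,v)$ put $\Delta=WX-YZ$ and, where $\Delta\neq0$, $$A=\frac{\sqrt{-1}}{\Delta}\Big[X\big(Y_v+\sqrt{-1}X_u\big)-Z\big(W_v+\sqrt{-1}Z_u\big)\Big],\qquad B=\frac{1}{\Delta}\Big[Y\big(Y_v+\sqrt{-1}X_u\big)-W\big(W_v+\sqrt{-1}Z_u\big)\Big].$$ (1) Let $N$ be an oriented $4$-dimensional Lorentzian space form of constant sectional curvature $L_0\neq0$, $M$ a Riemann surface, and $F:M\to N$ a space-like conformal immersion whose complex twistor lifts $\Theta_1,\overline{\Theta_1}$ are nondegenerate. Then for any local data $(u,v),\lambda,N_1,N_2$ as in the context (with $(T_1,T_2,N_1,N_2)$ positively oriented), the associated functions satisfy $\Delta\neq0$, $(A,B)=(\phi,\psi)$, and, with $f=L_0e^{2\lambda}$, $f_u=f(A+\overline{A})$, $f_v=f(B+\overline{B})$. (2) Conversely, let $L_0\neq0$ be a real number, $D\subset\mathbb{R}^2$ a simply connected domain with coordinates $(u,v)$, and $W,X,Y,Z$ complex-valued smooth functions on $D$ with $W+\overline{W}=X+\overline{X}$, $Y+\overline{Y}=Z+\overline{Z}$, $\Delta\neq0$ everywhere, and $\Delta-\overline{\Delta}=(A-\overline{A})_u+(B-\overline{B})_v$. Suppose that $f:=\Delta-A_u-B_v$ $(=\overline{\Delta}-\overline{A}_u-\overline{B}_v$, so $f$ is real$)$ is nowhere zero, $f/L_0>0$, and $f_u=f(A+\overline{A})$, $f_v=f(B+\overline{B})$.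 Then these give a space-like conformal immersion $F$ of $D$ into the $4$-dimensional Lorentzian space form $N$ of constant sectional curvature $L_0$: $F$ has induced metric $e^{2\lambda}(du^2+dv^2)$ with $\lambda=\frac12\log(f/L_0)$, and for suitable normal fields $N_1,N_2$ as in the context and an orientation of $N$ making $(T_1,T_2,N_1,N_2)$ positively oriented, its associated functions $W,X,Y,Z$ are the given ones. The complex twistor lifts of $F$ are nondegenerate, and $F$ is unique up to an isometry of $N$.
   Context: $N$ is realized as $\{x\in E^5_1:\langle x,x\rangle=1/L_0\}$ if $L_0>0$ and as $\{x\in E^5_2:\langle x,x\rangle=1/L_0\}$ if $L_0<0$; $h$ its metric, $\nabla$ its Levi-Civita connection. For a space-like conformal immersion $F$ of a Riemann surface into $N$: take local isothermal coordinates $(u,v)$, induced metric $e^{2\lambda}(du^2+dv^2)$, $T_1=dF(\partial_u)$, $T_2=dF(\partial_v)$, and normal fields $N_1,N_2$ with $h(N_1,N_1)=e^{2\lambda}$, $h(N_2,N_2)=-e^{2\lambda}$, $h(N_1,N_2)=0$. Define real functions $\alpha_k,\beta_k,\mu_l$ by $\sigma(T_1,T_1)=\alpha_1N_1+\beta_1N_2$, $\sigma(T_1,T_2)=\alpha_2N_1+\beta_2N_2$, $\sigma(T_2,T_2)=\alpha_3N_1+\beta_3N_2$ ($\sigma$ the second fundamental form), $\nabla^\perp_{\partial_u}N_1=\lambda_uN_1+\mu_1N_2$, $\nabla^\perp_{\partial_v}N_1=\lambda_vN_1+\mu_2N_2$. Associated functions: $W=\alpha_2-\sqrt{-1}\beta_1$,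 $X=\alpha_2+\sqrt{-1}\beta_3$, $Y=\beta_2-\sqrt{-1}\alpha_1$, $Z=\beta_2+\sqrt{-1}\alpha_3$, $\phi=\lambda_u-\sqrt{-1}\mu_2$, $\psi=\lambda_v+\sqrt{-1}\mu_1$. With $e_1,\dots,e_4=e^{-\lambda}(T_1,T_2,N_1,N_2)$ and $(T_1,T_2,N_1,N_2)$ positively oriented, the complex twistor lifts are $\Theta_1=\frac1{\sqrt2}(e_1\wedge e_2+\sqrt{-1}e_3\wedge e_4)$ and $\overline{\Theta_1}$. Let $\hat\nabla$ be the connection on $\bigwedge^2F^*TN\otimes\mathbb{C}$ induced by $\nabla$. The complex twistor lifts are nondegenerate if $\hat\nabla_{T_1}\Theta_1$ and $\hat\nabla_{T_2}\Theta_1$ are linearly independent over $\mathbb{C}$ at each point. *)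

theory Defs
  imports "HOL-Analysis.Analysis"
begin

definition pu :: "(real \<times> real \<Rightarrow> 'a::real_normed_vector) \<Rightarrow> real \<times> real \<Rightarrow> 'a" where
  "pu f p = vector_derivative (\<lambda>t. f (t, snd p)) (at (fst p))"

definition pv :: "(real \<times> real \<Rightarrow> 'a::real_normed_vector) \<Rightarrow> real \<times> real \<Rightarrow> 'a" where
  "pv f p = vector_derivative (\<lambda>t. f (fst p, t)) (at (snd p))"

fun iter_pd :: "bool list \<Rightarrow> (real \<times> real \<Rightarrow> 'a::real_normed_vector) \<Rightarrow> real \<times> real \<Rightarrow> 'a" where
  "iter_pd [] f = f"
| "iter_pd (d # ds) f = (if d then pu (iter_pd ds f) else pv (iter_pd ds f))"

definition smooth_on :: "(real \<times> real) set \<Rightarrow> (real \<times> real \<Rightarrow> 'a::real_normed_vector) \<Rightarrow> bool" where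
  "smooth_on U f \<longleftrightarrow> (\<forall>ds. iter_pd ds f differentiable_on U)"

definition gsign :: "real \<Rightarrow> 5 \<Rightarrow> real" where
  "gsign L0 j = (if j = 0 \<or> (L0 < 0 \<and> j = 1) then -1 else 1)"

definition lor :: "real \<Rightarrow> real^5 \<Rightarrow> real^5 \<Rightarrow> real" where
  "lor L0 x y = (\<Sum>j\<in>UNIV. gsign L0 j * x$j * y$j)"

text \<open>N = {p. lor L0 p p = 1/L0}. An isometry of N: restriction of a linear map preserving lor.\<close>

definition metric :: "real \<Rightarrow> (real \<times> real \<Rightarrow> real^5) \<Rightarrow> real \<times> real \<Rightarrow> real" where
  "metric L0 F x = lor L0 (pu F x) (pu F x)"

definition lam :: "real \<Rightarrow> (real \<times> real \<Rightarrow> real^5) \<Rightarrow> real \<times> real \<Rightarrow> real" where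
  "lam L0 F x = ln (metric L0 F x) / 2"

definition conf_imm :: "real \<Rightarrow> (real \<times> real) set \<Rightarrow> (real \<times> real \<Rightarrow> real^5) \<Rightarrow> bool" where
  "conf_imm L0 U F \<longleftrightarrow> smooth_on U F \<and>
     (\<forall>x\<in>U. lor L0 (F x) (F x) = 1 / L0 \<and>
        metric L0 F x > 0 \<and>
        lor L0 (pv F x) (pv F x) = metric L0 F x \<and>
        lor L0 (pu F x) (pv F x) = 0)"

definition frame_mat :: "(real \<times> real \<Rightarrow> real^5) \<Rightarrow> (real \<times> real \<Rightarrow> real^5) \<Rightarrow> (real \<times> real \<Rightarrow> real^5)
    \<Rightarrow> real \<times> real \<Rightarrow> real^5^5" where
  "frame_mat F N1 N2 x = (\<chi> i. if i = 0 then F x else if i = 1 then pu F x else if i = 2 then pv F x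
                                 else if i = 3 then N1 x else N2 x)"

text \<open>Normal fields N1, N2 (tangent to N, orthogonal to T1, T2) with the prescribed lengths;
  ori in {1,-1} is the orientation of N (ori * det(F,e1..e4) > 0 means positively oriented).\<close>
definition adapted_frame :: "real \<Rightarrow> (real \<times> real) set \<Rightarrow> (real \<times> real \<Rightarrow> real^5)
    \<Rightarrow> (real \<times> real \<Rightarrow> real^5) \<Rightarrow> (real \<times> real \<Rightarrow> real^5) \<Rightarrow> real \<Rightarrow> bool" where
  "adapted_frame L0 U F N1 N2 ori \<longleftrightarrow> smooth_on U N1 \<and> smooth_on U N2 \<and> (ori = 1 \<or> ori = -1) \<and>
     (\<forall>x\<in>U. lor L0 (N1 x) (F x) = 0 \<and> lor L0 (N2 x) (F x) = 0 \<and>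
        lor L0 (N1 x) (pu F x) = 0 \<and> lor L0 (N1 x) (pv F x) = 0 \<and>
        lor L0 (N2 x) (pu F x) = 0 \<and> lor L0 (N2 x) (pv F x) = 0 \<and>
        lor L0 (N1 x) (N1 x) = metric L0 F x \<and> lor L0 (N2 x) (N2 x) = - metric L0 F x \<and>
        lor L0 (N1 x) (N2 x) = 0 \<and>
        ori * det (frame_mat F N1 N2 x) > 0)"

definition sff_N1 :: "real \<Rightarrow> (real \<times> real \<Rightarrow> real^5) \<Rightarrow> (real \<times> real \<Rightarrow> real^5)
    \<Rightarrow> (real \<times> real \<Rightarrow> real^5) \<Rightarrow> real \<times> real \<Rightarrow> real" where
  "sff_N1 L0 F N1 G x = lor L0 (G x) (N1 x) / metric L0 F x"

definition sff_N2 :: "real \<Rightarrow> (real \<times> real \<Rightarrow> real^5) \<Rightarrow> (real \<times> real \<Rightarrow> real^5)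
    \<Rightarrow> (real \<times> real \<Rightarrow> real^5) \<Rightarrow> real \<times> real \<Rightarrow> real" where
  "sff_N2 L0 F N2 G x = - lor L0 (G x) (N2 x) / metric L0 F x"

definition alpha1 where "alpha1 L0 F N1 = sff_N1 L0 F N1 (pu (pu F))"
definition alpha2 where "alpha2 L0 F N1 = sff_N1 L0 F N1 (pv (pu F))"
definition alpha3 where "alpha3 L0 F N1 = sff_N1 L0 F N1 (pv (pv F))"
definition beta1 where "beta1 L0 F N2 = sff_N2 L0 F N2 (pu (pu F))"
definition beta2 where "beta2 L0 F N2 = sff_N2 L0 F N2 (pv (pu F))"
definition beta3 where "beta3 L0 F N2 = sff_N2 L0 F N2 (pv (pv F))"
definition mu1 where "mu1 L0 F N1 N2 = sff_N2 L0 F N2 (pu N1)"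
definition mu2 where "mu2 L0 F N1 N2 = sff_N2 L0 F N2 (pv N1)"

definition assocW where
  "assocW L0 F N1 N2 x = complex_of_real (alpha2 L0 F N1 x) - \<i> * complex_of_real (beta1 L0 F N2 x)"
definition assocX where
  "assocX L0 F N1 N2 x = complex_of_real (alpha2 L0 F N1 x) + \<i> * complex_of_real (beta3 L0 F N2 x)"
definition assocY where
  "assocY L0 F N1 N2 x = complex_of_real (beta2 L0 F N2 x) - \<i> * complex_of_real (alpha1 L0 F N1 x)"
definition assocZ where
  "assocZ L0 F N1 N2 x = complex_of_real (beta2 L0 F N2 x) + \<i> * complex_of_real (alpha3 L0 F N1 x)"
definition assocPhi where
  "assocPhi L0 F N1 N2 x = complex_of_real (pu (lam L0 F) x) - \<i> * complex_of_real (mu2 L0 F N1 N2 x)"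
definition assocPsi where
  "assocPsi L0 F N1 N2 x = complex_of_real (pv (lam L0 F) x) + \<i> * complex_of_real (mu1 L0 F N1 N2 x)"

definition DeltaF :: "(real \<times> real \<Rightarrow> complex) \<Rightarrow> (real \<times> real \<Rightarrow> complex) \<Rightarrow> (real \<times> real \<Rightarrow> complex)
    \<Rightarrow> (real \<times> real \<Rightarrow> complex) \<Rightarrow> real \<times> real \<Rightarrow> complex" where
  "DeltaF W X Y Z x = W x * X x - Y x * Z x"

definition AF :: "(real \<times> real \<Rightarrow> complex) \<Rightarrow> (real \<times> real \<Rightarrow> complex) \<Rightarrow> (real \<times> real \<Rightarrow> complex)
    \<Rightarrow> (real \<times> real \<Rightarrow> complex) \<Rightarrow> real \<times> real \<Rightarrow> complex" where
  "AF W X Y Z x = \<i> / DeltaF W X Y Z x *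
     (X x * (pv Y x + \<i> * pu X x) - Z x * (pv W x + \<i> * pu Z x))"

definition BF :: "(real \<times> real \<Rightarrow> complex) \<Rightarrow> (real \<times> real \<Rightarrow> complex) \<Rightarrow> (real \<times> real \<Rightarrow> complex)
    \<Rightarrow> (real \<times> real \<Rightarrow> complex) \<Rightarrow> real \<times> real \<Rightarrow> complex" where
  "BF W X Y Z x = 1 / DeltaF W X Y Z x *
     (Y x * (pv Y x + \<i> * pu X x) - W x * (pv W x + \<i> * pu Z x))"

text \<open>Complexified bivectors in E^5 as antisymmetric matrices: a wedge b = a b^T - b a^T.\<close>
definition wedge :: "real^5 \<Rightarrow> real^5 \<Rightarrow> complex^5^5" where
  "wedge a b = (\<chi> i j. complex_of_real (a$i * b$j - a$j * b$i))"

definition twistor1 :: "real \<Rightarrow> (real \<times> real \<Rightarrow> real^5) \<Rightarrow> (real \<times> real \<Rightarrow> real^5)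
    \<Rightarrow> (real \<times> real \<Rightarrow> real^5) \<Rightarrow> real \<times> real \<Rightarrow> complex^5^5" where
  "twistor1 L0 F N1 N2 x =
     (let s = exp (- lam L0 F x);
          e1 = s *\<^sub>R pu F x; e2 = s *\<^sub>R pv F x; e3 = s *\<^sub>R N1 x; e4 = s *\<^sub>R N2 x
      in (\<chi> i j. complex_of_real (1 / sqrt 2) * ((wedge e1 e2)$i$j + \<i> * (wedge e3 e4)$i$j)))"

text \<open>Orthogonal projection of E^5 onto T_p N: v \<mapsto> v - L0 lor(v,p) p, as a complex matrix.\<close>
definition cproj :: "real \<Rightarrow> real^5 \<Rightarrow> complex^5^5" where
  "cproj L0 p = (\<chi> i j. complex_of_real ((if i = j then 1 else 0) - L0 * p$i * gsign L0 j * p$j))"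

text \<open>Induced connection on bivectors along F: nabla-hat_{T1} M = P (d/du M) P^T (and similarly for T2).\<close>
definition covT1 :: "real \<Rightarrow> (real \<times> real \<Rightarrow> real^5) \<Rightarrow> (real \<times> real \<Rightarrow> complex^5^5) \<Rightarrow> real \<times> real \<Rightarrow> complex^5^5" where
  "covT1 L0 F M x = cproj L0 (F x) ** pu M x ** transpose (cproj L0 (F x))"

definition covT2 :: "real \<Rightarrow> (real \<times> real \<Rightarrow> real^5) \<Rightarrow> (real \<times> real \<Rightarrow> complex^5^5) \<Rightarrow> real \<times> real \<Rightarrow> complex^5^5" where
  "covT2 L0 F M x = cproj L0 (F x) ** pv M x ** transpose (cproj L0 (F x))"

definition lin_indep2 :: "complex^5^5 \<Rightarrow> complex^5^5 \<Rightarrow> bool" where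
  "lin_indep2 M1 M2 \<longleftrightarrow> (\<forall>a b::complex. (\<forall>i j. a * M1$i$j + b * M2$i$j = 0) \<longrightarrow> a = 0 \<and> b = 0)"

definition twistor_nondeg :: "real \<Rightarrow> (real \<times> real) set \<Rightarrow> (real \<times> real \<Rightarrow> real^5)
    \<Rightarrow> (real \<times> real \<Rightarrow> real^5) \<Rightarrow> (real \<times> real \<Rightarrow> real^5) \<Rightarrow> bool" where
  "twistor_nondeg L0 U F N1 N2 \<longleftrightarrow>
     (\<forall>x\<in>U. lin_indep2 (covT1 L0 F (twistor1 L0 F N1 N2) x) (covT2 L0 F (twistor1 L0 F N1 N2) x))"

end

theory Submission
  imports Defs "HOL-Complex_Analysis.Riemann_Mapping"
begin

text \<open>
  The position vector, the coordinate fields and the normal fields form a matrix \<open>\<Phi>\<close> whose rows satisfy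
  a linear system \<open>\<Phi>\<^sub>u = P \<Phi>\<close>, \<open>\<Phi>\<^sub>v = Q \<Phi>\<close> (Gauss and Weingarten equations). Its integrability condition
  \<open>P\<^sub>v + P Q = Q\<^sub>u + Q P\<close> consists of the Gauss, Codazzi and Ricci equations. In terms of the associated functions the
  four Codazzi equations are the complex linear system
  \<open>Y\<^sub>v + i X\<^sub>u = - i W \<phi> - Z \<psi>\<close>, \<open>W\<^sub>v + i Z\<^sub>u = - i Y \<phi> - X \<psi>\<close> with determinant \<open>\<Delta>\<close> up to a unit, whose
  solution is \<open>(\<phi>, \<psi>) = (A, B)\<close>; and \<open>\<Delta> \<noteq> 0\<close> is nondegeneracy of the twistor lift. Conversely, the remaining
  hypotheses on \<open>f\<close> and \<open>\<Delta>\<close> are the Gauss and Ricci equations, so the system can be integrated.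
  On a simply connected domain this is reduced by the Riemann mapping theorem to a disc or the plane, where
  one integrates along rays; the Gram matrix of \<open>\<Phi>\<close> has the prescribed value by uniqueness.
\<close>

section \<open>Partial derivatives and smoothness\<close>

text \<open>The functions \<open>W\<close>, \<open>X\<close>, \<open>Y\<close>, \<open>Z\<close>
  record only the second fundamental form. What makes them sufficient is that, for \<Delta> nonzero,
  the Codazzi equations can be solved for the derivatives of \<lambda> and for the normal
  connection; the formulas for \<open>A\<close> and \<open>B\<close> are Cramer's rule. The same
  recovery yields uniqueness: equal \<lambda> and equal associated functions force equal coefficient
  matrices. In the converse the Gauss and Ricci equations are the real and imaginary parts of the
  single relation \<open>f = \<Delta> - A_u - B_v\<close>, while the symmetry
  \<open>\<lambda>_uv = \<lambda>_vu\<close> holds because \<open>Re A\<close> and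
  \<open>Re B\<close> are the partial derivatives of \<open>ln (f / L0) / 2\<close>. The obstacle is
  global integration. Rays need a domain that is star-shaped about the base point, so the
  coordinates are changed by a biholomorphic map \<open>g\<close>; flatness survives because the
  curvature of the pulled-back system is the old one multiplied by \<open>|g'|^2\<close>. Smoothness
  is phrased through iterated partial derivatives, so symmetry of second derivatives is a lemma
  rather than part of the notion.\<close>

lemma has_derivative_pu:
  assumes "(f has_derivative f') (at p)"
  shows "((\<lambda>t. f (t, snd p)) has_vector_derivative f' (1, 0)) (at (fst p))"
proof -
  have "((\<lambda>t. (t, snd p)) has_derivative (\<lambda>h. (h, 0))) (at (fst p))"
    by (auto intro!: derivative_eq_intros)
  then have "((\<lambda>t. f (t, snd p)) has_derivative (\<lambda>h. f' (h, 0))) (at (fst p))"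
    by (rule has_derivative_compose) (simp add: assms)
  moreover have "(\<lambda>h. f' (h, 0)) = (\<lambda>h. h *\<^sub>R f' (1, 0))"
  proof
    fix h show "f' (h, 0) = h *\<^sub>R f' (1, 0)"
      using linear_scale[OF has_derivative_linear[OF assms], of h "(1, 0)"] by simp
  qed
  ultimately show ?thesis by (simp only: has_vector_derivative_def)
qed

lemma has_derivative_pv:
  assumes "(f has_derivative f') (at p)"
  shows "((\<lambda>t. f (fst p, t)) has_vector_derivative f' (0, 1)) (at (snd p))"
proof -
  have "((\<lambda>t. (fst p, t)) has_derivative (\<lambda>h. (0, h))) (at (snd p))"
    by (auto intro!: derivative_eq_intros)
  then have "((\<lambda>t. f (fst p, t)) has_derivative (\<lambda>h. f' (0, h))) (at (snd p))"
    by (rule has_derivative_compose) (simp add: assms)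
  moreover have "(\<lambda>h. f' (0, h)) = (\<lambda>h. h *\<^sub>R f' (0, 1))"
  proof
    fix h show "f' (0, h) = h *\<^sub>R f' (0, 1)"
      using linear_scale[OF has_derivative_linear[OF assms], of h "(0, 1)"] by simp
  qed
  ultimately show ?thesis by (simp only: has_vector_derivative_def)
qed

text \<open>This is total differentiability with the derivative written in coordinates. Keeping both
  partial derivatives in one predicate makes the calculus rules compose, and \<open>pu\<close> and
  \<open>pv\<close> can then be read off at the end.\<close>

definition has_partials ::
  "(real \<times> real \<Rightarrow> 'a::real_normed_vector) \<Rightarrow> 'a \<Rightarrow> 'a \<Rightarrow> real \<times> real \<Rightarrow> bool" where
  "has_partials f a b p \<longleftrightarrow> (f has_derivative (\<lambda>h. fst h *\<^sub>R a + snd h *\<^sub>R b)) (at p)"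

lemma has_partials_pu: "has_partials f a b p \<Longrightarrow> pu f p = a"
  and has_partials_pv: "has_partials f a b p \<Longrightarrow> pv f p = b"
  unfolding has_partials_def pu_def pv_def
   apply (rule vector_derivative_at, drule has_derivative_pu, simp)
  apply (rule vector_derivative_at, drule has_derivative_pv, simp)
  done

lemma has_derivative_imp_has_partials:
  assumes "(f has_derivative f') (at p)"
  shows "has_partials f (f' (1, 0)) (f' (0, 1)) p"
proof -
  have "f' h = fst h *\<^sub>R f' (1, 0) + snd h *\<^sub>R f' (0, 1)" for h
  proof -
    interpret linear f' using assms by (rule has_derivative_linear)
    have "f' h = f' (fst h *\<^sub>R (1, 0) + snd h *\<^sub>R (0, 1))" by simp
    then show ?thesis by (simp only: add scale)
  qed
  then have "f' = (\<lambda>h. fst h *\<^sub>R f' (1, 0) + snd h *\<^sub>R f' (0, 1))" by blast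
  with assms show ?thesis unfolding has_partials_def by simp
qed

lemma has_partials_differentiable: "has_partials f a b p \<Longrightarrow> f differentiable at p"
  unfolding has_partials_def differentiable_def by blast

lemma differentiable_has_partials:
  assumes "f differentiable at p"
  shows "has_partials f (pu f p) (pv f p) p"
proof -
  obtain f' where "(f has_derivative f') (at p)" using assms unfolding differentiable_def by blast
  note * = has_derivative_imp_has_partials[OF this]
  show ?thesis using * unfolding has_partials_pu[OF *] has_partials_pv[OF *] .
qed

lemma has_partials_const: "has_partials (\<lambda>_. c) 0 0 p"
  by (simp add: has_partials_def)

lemma has_partials_add:
  "has_partials f a b p \<Longrightarrow> has_partials g c d p \<Longrightarrow> has_partials (\<lambda>x. f x + g x) (a + c) (b + d) p"
  unfolding has_partials_def by (auto intro!: derivative_eq_intros simp: algebra_simps)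

lemma has_partials_linear:
  assumes "bounded_linear T" "has_partials f a b p"
  shows "has_partials (\<lambda>x. T (f x)) (T a) (T b) p"
proof -
  interpret bounded_linear T by fact
  show ?thesis
    using has_derivative[OF assms(2)[unfolded has_partials_def]]
    by (simp add: has_partials_def add scaleR)
qed

lemma has_partials_bilinear:
  assumes "bounded_bilinear mul" "has_partials f a b p" "has_partials g c d p"
  shows "has_partials (\<lambda>x. mul (f x) (g x)) (mul a (g p) + mul (f p) c) (mul b (g p) + mul (f p) d) p"
proof -
  interpret bounded_bilinear mul by fact
  show ?thesis
    using FDERIV[OF assms(2,3)[unfolded has_partials_def]]
    by (simp add: has_partials_def add_left add_right scaleR_left scaleR_right algebra_simps)
qed

lemma has_partials_cong:
  assumes "has_partials f a b p" "open U" "p \<in> U" "\<And>x. x \<in> U \<Longrightarrow> f x = g x"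
  shows "has_partials g a b p"
  using assms unfolding has_partials_def
  by (auto intro: has_derivative_transform_within_open)

lemma has_partials_field:
  fixes f :: "real \<times> real \<Rightarrow> 'a::real_normed_field"
  assumes "has_partials f a b p" "(g has_field_derivative g') (at (f p))"
  shows "has_partials (\<lambda>x. g (f x)) (g' * a) (g' * b) p"
  using has_derivative_compose[OF assms(1)[unfolded has_partials_def]
      assms(2)[unfolded has_field_derivative_def]]
  by (simp add: has_partials_def distrib_left)

lemma vector_derivative_cong_ev:
  assumes "eventually (\<lambda>t. f t = g t) (nhds x)"
  shows "vector_derivative f (at x) = vector_derivative g (at x)"
proof -
  have "(f has_vector_derivative D) (at x) \<longleftrightarrow> (g has_vector_derivative D) (at x)" for D
  proof (rule has_vector_derivative_cong_ev)
    show "eventually (\<lambda>t. t \<in> UNIV \<longrightarrow> f t = g t) (nhds x)" using assms by simp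
    show "f x = g x" using assms by (rule eventually_nhds_x_imp_x)
  qed
  then show ?thesis unfolding vector_derivative_def by simp
qed

lemma pu_cong_open:
  assumes "open U" "p \<in> U" "\<And>x. x \<in> U \<Longrightarrow> f x = g x"
  shows "pu f p = pu g p"
proof -
  have "open ((\<lambda>t. (t, snd p)) -` U)"
    using assms(1) by (intro open_vimage) (auto intro!: continuous_intros)
  moreover have "fst p \<in> (\<lambda>t. (t, snd p)) -` U" using assms by simp
  ultimately have "eventually (\<lambda>t. f (t, snd p) = g (t, snd p)) (nhds (fst p))"
    by (rule eventually_mono[OF eventually_nhds_in_open]) (simp add: assms)
  then show ?thesis unfolding pu_def by (rule vector_derivative_cong_ev)
qed

lemma pv_cong_open:
  assumes "open U" "p \<in> U" "\<And>x. x \<in> U \<Longrightarrow> f x = g x"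
  shows "pv f p = pv g p"
proof -
  have "open ((\<lambda>t. (fst p, t)) -` U)"
    using assms(1) by (intro open_vimage) (auto intro!: continuous_intros)
  moreover have "snd p \<in> (\<lambda>t. (fst p, t)) -` U" using assms by simp
  ultimately have "eventually (\<lambda>t. f (fst p, t) = g (fst p, t)) (nhds (snd p))"
    by (rule eventually_mono[OF eventually_nhds_in_open]) (simp add: assms)
  then show ?thesis unfolding pv_def by (rule vector_derivative_cong_ev)
qed

lemma differentiable_on_transform:
  assumes "f differentiable_on U" "\<And>x. x \<in> U \<Longrightarrow> f x = g x"
  shows "g differentiable_on U"
  unfolding differentiable_on_def
proof
  fix x assume "x \<in> U"
  show "g differentiable at x within U"
  proof (rule differentiable_transform_within[of f x U, OF _ zero_less_one \<open>x \<in> U\<close>])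
    show "f differentiable at x within U" using assms(1) \<open>x \<in> U\<close> by (simp add: differentiable_on_def)
  qed (rule assms(2))
qed

section \<open>Smoothness of finite order and its closure properties\<close>

text \<open>A graded form of \<open>smooth_on\<close>, made for induction on the order. Order
  \<open>0\<close> already means differentiable once.\<close>

definition smooth_upto :: "nat \<Rightarrow> (real \<times> real) set \<Rightarrow> (real \<times> real \<Rightarrow> 'a::real_normed_vector) \<Rightarrow> bool" where
  "smooth_upto n U f \<longleftrightarrow> (\<forall>ds. length ds \<le> n \<longrightarrow> iter_pd ds f differentiable_on U)"

lemma smooth_on_iff_smooth_upto: "smooth_on U f \<longleftrightarrow> (\<forall>n. smooth_upto n U f)"
  unfolding smooth_on_def smooth_upto_def by auto

lemma iter_pd_append: "iter_pd (ds @ es) f = iter_pd ds (iter_pd es f)"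
  by (induction ds) auto

lemma smooth_upto_0: "smooth_upto 0 U f \<longleftrightarrow> f differentiable_on U"
  by (simp add: smooth_upto_def)

text \<open>\<open>iter_pd\<close> applies the last list entry first, so the innermost derivative is
  split off at the right end of the list.\<close>

lemma smooth_upto_Suc:
  "smooth_upto (Suc n) U f \<longleftrightarrow> f differentiable_on U \<and> smooth_upto n U (pu f) \<and> smooth_upto n U (pv f)"
proof safe
  assume a: "smooth_upto (Suc n) U f"
  show "f differentiable_on U" using a[unfolded smooth_upto_def, rule_format, of "[]"] by simp
  have "iter_pd ds (pu f) differentiable_on U" if "length ds \<le> n" for ds
    using a[unfolded smooth_upto_def, rule_format, of "ds @ [True]"] that by (simp add: iter_pd_append)
  then show "smooth_upto n U (pu f)" by (simp add: smooth_upto_def)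
  have "iter_pd ds (pv f) differentiable_on U" if "length ds \<le> n" for ds
    using a[unfolded smooth_upto_def, rule_format, of "ds @ [False]"] that by (simp add: iter_pd_append)
  then show "smooth_upto n U (pv f)" by (simp add: smooth_upto_def)
next
  assume a: "f differentiable_on U" "smooth_upto n U (pu f)" "smooth_upto n U (pv f)"
  show "smooth_upto (Suc n) U f"
    unfolding smooth_upto_def
  proof (intro allI impI)
    fix ds :: "bool list" assume "length ds \<le> Suc n"
    then show "iter_pd ds f differentiable_on U"
    proof (cases ds rule: rev_cases)
      case Nil then show ?thesis using a by simp
    next
      case (snoc es d)
      then show ?thesis
        using a(2,3)[unfolded smooth_upto_def, rule_format, of es] \<open>length ds \<le> Suc n\<close>
        by (cases d) (auto simp: iter_pd_append)
    qed
  qed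
qed

lemma smooth_upto_differentiable_on: "smooth_upto n U f \<Longrightarrow> f differentiable_on U"
  by (cases n) (auto simp: smooth_upto_0 smooth_upto_Suc)

lemma smooth_upto_partials:
  assumes "smooth_upto n U f" "open U" "x \<in> U"
  shows "has_partials f (pu f x) (pv f x) x"
  using smooth_upto_differentiable_on[OF assms(1)] assms
  by (intro differentiable_has_partials) (auto simp: differentiable_on_eq_differentiable_at)

lemma smooth_upto_less: "smooth_upto (Suc n) U f \<Longrightarrow> smooth_upto n U f"
  by (auto simp: smooth_upto_def)

lemma smooth_upto_cong:
  assumes "open U"
  shows "smooth_upto n U f \<Longrightarrow> (\<And>x. x \<in> U \<Longrightarrow> f x = g x) \<Longrightarrow> smooth_upto n U g"
proof (induction n arbitrary: f g)
  case 0
  then show ?case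
    unfolding smooth_upto_0 by (rule differentiable_on_transform)
next
  case (Suc n)
  have "g differentiable_on U"
    by (rule differentiable_on_transform[OF smooth_upto_differentiable_on[OF Suc.prems(1)] Suc.prems(2)])
  moreover have "smooth_upto n U (pu g)"
    by (rule Suc.IH[of "pu f"]) (use Suc.prems in \<open>auto simp: smooth_upto_Suc intro!: pu_cong_open[OF assms]\<close>)
  moreover have "smooth_upto n U (pv g)"
    by (rule Suc.IH[of "pv f"]) (use Suc.prems in \<open>auto simp: smooth_upto_Suc intro!: pv_cong_open[OF assms]\<close>)
  ultimately show ?case by (simp add: smooth_upto_Suc)
qed

text \<open>The formulas \<open>a\<close> and \<open>b\<close> agree with the partial derivatives
  only on \<open>U\<close>; since \<open>U\<close> is open, this is enough to transfer their
  smoothness.\<close>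

lemma smooth_upto_SucI:
  assumes "open U" "\<And>x. x \<in> U \<Longrightarrow> has_partials f (a x) (b x) x" "smooth_upto n U a" "smooth_upto n U b"
  shows "smooth_upto (Suc n) U f"
  unfolding smooth_upto_Suc
proof (intro conjI)
  show "f differentiable_on U"
    using assms(1,2) by (auto simp: differentiable_on_eq_differentiable_at intro: has_partials_differentiable)
  show "smooth_upto n U (pu f)"
    by (rule smooth_upto_cong[OF assms(1,3)]) (rule has_partials_pu[OF assms(2), symmetric])
  show "smooth_upto n U (pv f)"
    by (rule smooth_upto_cong[OF assms(1,4)]) (rule has_partials_pv[OF assms(2), symmetric])
qed

lemma smooth_upto_0I:
  assumes "open U" "\<And>x. x \<in> U \<Longrightarrow> has_partials f (a x) (b x) x"
  shows "smooth_upto 0 U f"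
  using assms by (auto simp: smooth_upto_0 differentiable_on_eq_differentiable_at intro: has_partials_differentiable)

lemma smooth_upto_const: "open U \<Longrightarrow> smooth_upto n U (\<lambda>_. c)"
proof (induction n arbitrary: c)
  case (Suc n) then show ?case
    by (intro smooth_upto_SucI[of _ _ "\<lambda>_. 0" "\<lambda>_. 0"]) (auto intro: has_partials_const)
qed (simp add: smooth_upto_0)

lemma smooth_upto_add:
  assumes "open U"
  shows "smooth_upto n U f \<Longrightarrow> smooth_upto n U g \<Longrightarrow> smooth_upto n U (\<lambda>x. f x + g x)"
proof (induction n arbitrary: f g)
  case 0 then show ?case by (auto simp: smooth_upto_0 intro: differentiable_on_add)
next
  case (Suc n)
  show ?case
    by (rule smooth_upto_SucI[OF assms
          has_partials_add[OF smooth_upto_partials[OF Suc.prems(1) assms] smooth_upto_partials[OF Suc.prems(2) assms]]])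
      (use Suc in \<open>auto simp: smooth_upto_Suc\<close>)
qed

lemma smooth_upto_linear:
  assumes "open U" "bounded_linear T"
  shows "smooth_upto n U f \<Longrightarrow> smooth_upto n U (\<lambda>x. T (f x))"
proof (induction n arbitrary: f)
  case 0 show ?case
    by (rule smooth_upto_0I[OF assms(1) has_partials_linear[OF assms(2) smooth_upto_partials[OF 0 assms(1)]]])
next
  case (Suc n)
  show ?case
    by (rule smooth_upto_SucI[OF assms(1) has_partials_linear[OF assms(2) smooth_upto_partials[OF Suc.prems(1) assms(1)]]])
      (use Suc in \<open>auto simp: smooth_upto_Suc\<close>)
qed

lemma smooth_upto_bilinear:
  assumes "open U" "bounded_bilinear mul"
  shows "smooth_upto n U f \<Longrightarrow> smooth_upto n U g \<Longrightarrow> smooth_upto n U (\<lambda>x. mul (f x) (g x))"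
proof (induction n arbitrary: f g)
  case 0 show ?case
    by (rule smooth_upto_0I[OF assms(1) has_partials_bilinear[OF assms(2)
          smooth_upto_partials[OF 0(1) assms(1)] smooth_upto_partials[OF 0(2) assms(1)]]])
next
  case (Suc n)
  note sm = Suc.prems[THEN smooth_upto_less] Suc.prems[unfolded smooth_upto_Suc]
  show ?case
    by (rule smooth_upto_SucI[OF assms(1) has_partials_bilinear[OF assms(2)
          smooth_upto_partials[OF Suc.prems(1) assms(1)] smooth_upto_partials[OF Suc.prems(2) assms(1)]]])
      (use sm in \<open>auto intro!: smooth_upto_add[OF assms(1)] Suc.IH\<close>)
qed

text \<open>Intended for functions whose partial derivatives are expressions in the function itself,
  such as reciprocals and solutions of linear systems: each order of smoothness of \<open>f\<close>
  passes to its derivatives and thereby gives the next order.\<close>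

lemma smooth_onI_bootstrap:
  assumes "open U" "\<And>x. x \<in> U \<Longrightarrow> has_partials f (a x) (b x) x"
    and "\<And>n. smooth_upto n U f \<Longrightarrow> smooth_upto n U a \<and> smooth_upto n U b"
  shows "smooth_on U f"
proof -
  have "smooth_upto n U f" for n
  proof (induction n)
    case 0 show ?case by (rule smooth_upto_0I[OF assms(1,2)])
  next
    case (Suc n) then show ?case
      by (intro smooth_upto_SucI[OF assms(1,2)]) (auto dest: assms(3))
  qed
  then show ?thesis by (simp add: smooth_on_iff_smooth_upto)
qed

context
  fixes U :: "(real \<times> real) set"
  assumes U: "open U"
begin

lemma smooth_on_partials: "smooth_on U f \<Longrightarrow> x \<in> U \<Longrightarrow> has_partials f (pu f x) (pv f x) x"
  unfolding smooth_on_iff_smooth_upto by (rule smooth_upto_partials[OF _ U]) auto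

lemma smooth_on_pu: "smooth_on U f \<Longrightarrow> smooth_on U (pu f)"
  and smooth_on_pv: "smooth_on U f \<Longrightarrow> smooth_on U (pv f)"
  by (simp_all add: smooth_on_iff_smooth_upto) (use smooth_upto_Suc in blast)+

lemma smooth_on_const: "smooth_on U (\<lambda>_. c)"
  by (simp add: smooth_on_iff_smooth_upto smooth_upto_const[OF U])

lemma smooth_on_linear: "bounded_linear T \<Longrightarrow> smooth_on U f \<Longrightarrow> smooth_on U (\<lambda>x. T (f x))"
  by (simp add: smooth_on_iff_smooth_upto smooth_upto_linear[OF U])

lemma smooth_on_bilinear:
  "bounded_bilinear mul \<Longrightarrow> smooth_on U f \<Longrightarrow> smooth_on U g \<Longrightarrow> smooth_on U (\<lambda>x. mul (f x) (g x))"
  by (simp add: smooth_on_iff_smooth_upto smooth_upto_bilinear[OF U])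

lemma smooth_on_add: "smooth_on U f \<Longrightarrow> smooth_on U g \<Longrightarrow> smooth_on U (\<lambda>x. f x + g x)"
  by (simp add: smooth_on_iff_smooth_upto smooth_upto_add[OF U])

lemma smooth_on_minus: "smooth_on U f \<Longrightarrow> smooth_on U (\<lambda>x. - f x)"
  by (rule smooth_on_linear[OF bounded_linear_minus[OF bounded_linear_ident]])

lemma smooth_on_diff: "smooth_on U f \<Longrightarrow> smooth_on U g \<Longrightarrow> smooth_on U (\<lambda>x. f x - g x)"
  using smooth_on_add[OF _ smooth_on_minus, of f g] by simp

lemma smooth_on_mult:
  fixes f :: "real \<times> real \<Rightarrow> 'a::real_normed_algebra"
  shows "smooth_on U f \<Longrightarrow> smooth_on U g \<Longrightarrow> smooth_on U (\<lambda>x. f x * g x)"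
  by (rule smooth_on_bilinear[OF bounded_bilinear_mult])

lemma smooth_on_inverse:
  fixes f :: "real \<times> real \<Rightarrow> 'a::real_normed_field"
  assumes f: "smooth_on U f" and "\<And>x. x \<in> U \<Longrightarrow> f x \<noteq> 0"
  shows "smooth_on U (\<lambda>x. inverse (f x))"
proof (rule smooth_onI_bootstrap[OF U])
  let ?g = "\<lambda>x. inverse (f x)"
  show "has_partials ?g ((- (?g x * ?g x)) * pu f x) ((- (?g x * ?g x)) * pv f x) x" if "x \<in> U" for x
    using assms(2)[OF that]
    by (intro has_partials_field[OF smooth_on_partials[OF f that]])
      (auto intro!: derivative_eq_intros simp: power2_eq_square)
  have fu: "smooth_upto n U (pu f)" "smooth_upto n U (pv f)" for n
    using smooth_on_pu[OF f] smooth_on_pv[OF f] by (simp_all add: smooth_on_iff_smooth_upto)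
  show "smooth_upto n U (\<lambda>x. (- (?g x * ?g x)) * pu f x) \<and> smooth_upto n U (\<lambda>x. (- (?g x * ?g x)) * pv f x)"
    if "smooth_upto n U ?g" for n
    by (intro conjI smooth_upto_bilinear[OF U bounded_bilinear_mult] fu that
        smooth_upto_linear[OF U bounded_linear_minus[OF bounded_linear_ident]])
qed

lemma smooth_on_divide:
  fixes f :: "real \<times> real \<Rightarrow> 'a::real_normed_field"
  assumes "smooth_on U f" "smooth_on U g" "\<And>x. x \<in> U \<Longrightarrow> g x \<noteq> 0"
  shows "smooth_on U (\<lambda>x. f x / g x)"
  unfolding divide_inverse by (intro smooth_on_mult smooth_on_inverse assms)

lemma smooth_on_continuous_on: "smooth_on U f \<Longrightarrow> continuous_on U f"
  unfolding smooth_on_iff_smooth_upto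
  using smooth_upto_differentiable_on differentiable_imp_continuous_on by blast

end

lemma smooth_on_ln:
  fixes f :: "real \<times> real \<Rightarrow> real"
  assumes U: "open U" and f: "smooth_on U f" and pos: "\<And>x. x \<in> U \<Longrightarrow> f x > 0"
  shows "smooth_on U (\<lambda>x. ln (f x))"
proof (rule smooth_onI_bootstrap[OF U])
  show "has_partials (\<lambda>x. ln (f x)) (inverse (f x) * pu f x) (inverse (f x) * pv f x) x" if "x \<in> U" for x
    using pos[OF that] by (intro has_partials_field[OF smooth_on_partials[OF U f that]])
      (auto intro!: derivative_eq_intros simp: field_simps)
  have "smooth_on U (\<lambda>x. inverse (f x) * pu f x)" "smooth_on U (\<lambda>x. inverse (f x) * pv f x)"
    by (intro smooth_on_mult[OF U] smooth_on_inverse[OF U] smooth_on_pu[OF U] smooth_on_pv[OF U] f,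
        use pos in force)+
  then show "smooth_upto n U (\<lambda>x. inverse (f x) * pu f x) \<and> smooth_upto n U (\<lambda>x. inverse (f x) * pv f x)" for n
    by (simp add: smooth_on_iff_smooth_upto)
qed

section \<open>Symmetry of second derivatives\<close>

text \<open>The second difference of \<open>g\<close> over a small square is evaluated by the mean
  value theorem in both orders. This makes the two mixed derivatives equal at two points of the
  square, and continuity carries the equality to the corner \<open>p\<close>.\<close>

lemma mixed_partials_eq_real:
  fixes g :: "real \<times> real \<Rightarrow> real"
  assumes U: "open U" and g: "smooth_on U g" and p: "p \<in> U"
  shows "pv (pu g) p = pu (pv g) p"
proof (rule ccontr)
  assume neq: "\<not> ?thesis"
  \<comment> \<open>With half the supposed gap as tolerance, two values within \<epsilon> of the two
    mixed derivatives at \<open>p\<close> cannot coincide.\<close>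
  define \<epsilon> where "\<epsilon> = dist (pv (pu g) p) (pu (pv g) p) / 2"
  have "\<epsilon> > 0" using neq by (simp add: \<epsilon>_def)
  note sm = smooth_on_pu[OF U g] smooth_on_pv[OF U g]
  have "continuous_on U (pv (pu g))" "continuous_on U (pu (pv g))"
    by (intro smooth_on_continuous_on[OF U] smooth_on_pu[OF U] smooth_on_pv[OF U] g)+
  then obtain r1 r2 where r: "r1 > 0" "r2 > 0"
    "\<And>q. q \<in> U \<Longrightarrow> dist q p < r1 \<Longrightarrow> dist (pv (pu g) q) (pv (pu g) p) < \<epsilon>"
    "\<And>q. q \<in> U \<Longrightarrow> dist q p < r2 \<Longrightarrow> dist (pu (pv g) q) (pu (pv g) p) < \<epsilon>"
    using \<open>\<epsilon> > 0\<close> p unfolding continuous_on_iff by metis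
  obtain r0 where r0: "r0 > 0" "ball p r0 \<subseteq> U" using U p openE by blast
  \<comment> \<open>Points of the square of side \<open>h\<close> have distance at most
    \<open>2 * h\<close> from \<open>p\<close>; dividing by \<open>3\<close> keeps them strictly
    inside all three radii.\<close>
  define h where "h = min r0 (min r1 r2) / 3"
  have h: "h > 0" "3 * h \<le> r0" "3 * h \<le> r1" "3 * h \<le> r2" using r r0 by (auto simp: h_def)
  obtain a b where ab: "p = (a, b)" by (cases p)
  have near: "(s, t) \<in> U" "dist (s, t) p < r1" "dist (s, t) p < r2"
    if "a \<le> s" "s \<le> a + h" "b \<le> t" "t \<le> b + h" for s t
  proof -
    have "dist (s, t) p \<le> \<bar>s - a\<bar> + \<bar>t - b\<bar>"
      unfolding ab dist_Pair_Pair using sqrt_sum_squares_le_sum_abs by (simp add: dist_real_def)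
    also have "\<dots> < 3 * h" using that h by auto
    finally show "(s, t) \<in> U" "dist (s, t) p < r1" "dist (s, t) p < r2"
      using h r0 by (auto simp: dist_commute mem_ball subset_iff)
  qed
  have Du: "((\<lambda>s. k (s, t)) has_real_derivative pu k (s, t)) (at s)" if "smooth_on U k" "(s, t) \<in> U" for k s t
    using has_derivative_pu[OF smooth_on_partials[OF U that, unfolded has_partials_def]]
    by (simp add: has_real_derivative_iff_has_vector_derivative)
  have Dv: "((\<lambda>t. k (s, t)) has_real_derivative pv k (s, t)) (at t)" if "smooth_on U k" "(s, t) \<in> U" for k s t
    using has_derivative_pv[OF smooth_on_partials[OF U that, unfolded has_partials_def]]
    by (simp add: has_real_derivative_iff_has_vector_derivative)
  \<comment> \<open>The mean value theorem is applied to the difference of \<open>g\<close> along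
    the upper and the lower edge of the square.\<close>
  have "\<exists>z>a. z < a + h \<and> (g (a + h, b + h) - g (a + h, b)) - (g (a, b + h) - g (a, b))
      = (a + h - a) * (pu g (z, b + h) - pu g (z, b))"
    by (rule MVT2) (use h near in \<open>auto intro!: DERIV_diff Du[OF g]\<close>)
  then obtain s where s: "a < s" "s < a + h"
    "(g (a + h, b + h) - g (a + h, b)) - (g (a, b + h) - g (a, b)) = h * (pu g (s, b + h) - pu g (s, b))" by auto
  have "\<exists>z>b. z < b + h \<and> pu g (s, b + h) - pu g (s, b) = (b + h - b) * pv (pu g) (s, z)"
    by (rule MVT2) (use h near s in \<open>auto intro!: Dv[OF sm(1)]\<close>)
  then obtain t where t: "b < t" "t < b + h" "pu g (s, b + h) - pu g (s, b) = h * pv (pu g) (s, t)" by auto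
  \<comment> \<open>The same second difference, now grouped by the right and the left edge.\<close>
  have "\<exists>z>b. z < b + h \<and> (g (a + h, b + h) - g (a, b + h)) - (g (a + h, b) - g (a, b))
      = (b + h - b) * (pv g (a + h, z) - pv g (a, z))"
    by (rule MVT2) (use h near in \<open>auto intro!: DERIV_diff Dv[OF g]\<close>)
  then obtain t' where t': "b < t'" "t' < b + h"
    "(g (a + h, b + h) - g (a, b + h)) - (g (a + h, b) - g (a, b)) = h * (pv g (a + h, t') - pv g (a, t'))" by auto
  have "\<exists>z>a. z < a + h \<and> pv g (a + h, t') - pv g (a, t') = (a + h - a) * pu (pv g) (z, t')"
    by (rule MVT2) (use h near t' in \<open>auto intro!: Du[OF sm(2)]\<close>)
  then obtain s' where s': "a < s'" "s' < a + h" "pv g (a + h, t') - pv g (a, t') = h * pu (pv g) (s', t')" by auto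
  have "h * (h * pv (pu g) (s, t)) = h * (h * pu (pv g) (s', t'))"
    using s t s' t' by (simp add: algebra_simps)
  then have eq: "pv (pu g) (s, t) = pu (pv g) (s', t')" using h by simp
  have "dist (pv (pu g) (s, t)) (pv (pu g) p) < \<epsilon>" "dist (pu (pv g) (s', t')) (pu (pv g) p) < \<epsilon>"
    using r near s t s' t' by auto
  then show False unfolding eq using \<epsilon>_def
    by (smt (verit) dist_commute dist_triangle field_sum_of_halves)
qed

lemma pu_linear: "open U \<Longrightarrow> smooth_on U f \<Longrightarrow> x \<in> U \<Longrightarrow> bounded_linear T \<Longrightarrow> pu (\<lambda>x. T (f x)) x = T (pu f x)"
  and pv_linear: "open U \<Longrightarrow> smooth_on U f \<Longrightarrow> x \<in> U \<Longrightarrow> bounded_linear T \<Longrightarrow> pv (\<lambda>x. T (f x)) x = T (pv f x)"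
  by (rule has_partials_pu has_partials_pv, rule has_partials_linear, assumption, rule smooth_on_partials, assumption+)+

lemma mixed_partials_eq:
  fixes g :: "real \<times> real \<Rightarrow> 'a::euclidean_space"
  assumes U: "open U" and g: "smooth_on U g" and p: "p \<in> U"
  shows "pv (pu g) p = pu (pv g) p"
proof (rule euclidean_eqI)
  fix e :: 'a
  let ?T = "\<lambda>y. y \<bullet> e"
  note T = bounded_linear_inner_left[of e]
  have "pv (pu g) p \<bullet> e = pv (\<lambda>x. pu g x \<bullet> e) p"
    by (simp add: pv_linear[OF U smooth_on_pu[OF U g] p T])
  also have "\<dots> = pv (pu (\<lambda>x. g x \<bullet> e)) p"
    by (rule pv_cong_open[OF U p]) (simp add: pu_linear[OF U g _ T])
  also have "\<dots> = pu (pv (\<lambda>x. g x \<bullet> e)) p"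
    by (rule mixed_partials_eq_real[OF U smooth_on_linear[OF U T g] p])
  also have "\<dots> = pu (\<lambda>x. pv g x \<bullet> e) p"
    by (rule pu_cong_open[OF U p]) (simp add: pv_linear[OF U g _ T])
  also have "\<dots> = pu (pv g) p \<bullet> e"
    by (simp add: pu_linear[OF U smooth_on_pv[OF U g] p T])
  finally show "pv (pu g) p \<bullet> e = pu (pv g) p \<bullet> e" .
qed

section \<open>Flat linear systems\<close>

text \<open>The squared norm is used because it stays differentiable where \<open>e\<close>
  vanishes. Weighted by \<open>exp (- k * t)\<close> and lowered by
  \<open>\<epsilon>\<^sup>2 * t\<close> it has nonpositive derivative, so the mean value theorem
  compares its values at \<open>1\<close> and \<open>0\<close>.\<close>

lemma gronwall_unit_interval:
  fixes e :: "real \<Rightarrow> 'v::real_inner"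
  assumes der: "\<And>t. t \<in> {0..1} \<Longrightarrow> (e has_vector_derivative e' t) (at t within {0..1})"
    and bound: "\<And>t. t \<in> {0..1} \<Longrightarrow> norm (e' t) \<le> C * norm (e t) + \<epsilon>"
    and "e 0 = 0" "C \<ge> 0" "\<epsilon> \<ge> 0"
  shows "norm (e 1) \<le> \<epsilon> * exp (C + 1)"
proof -
  \<comment> \<open>\<open>2 * C\<close> comes from the Cauchy-Schwarz bound on
    \<open>2 * (e t \<bullet> e' t)\<close>, the extra \<open>1\<close> from splitting
    \<open>2 * norm (e t) * \<epsilon>\<close> into two squares.\<close>
  define k where "k = 2 * C + 1"
  define g where "g = (\<lambda>t. (e t \<bullet> e t) * exp (- k * t) - \<epsilon>\<^sup>2 * t)"
  define g' where "g' = (\<lambda>t. (2 * (e t \<bullet> e' t) - k * (e t \<bullet> e t)) * exp (- k * t) - \<epsilon>\<^sup>2)"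
  have g: "(g has_derivative (\<lambda>h. h * g' t)) (at t within {0..1})" if "0 \<le> t" "t \<le> 1" for t
  proof -
    have "(e has_derivative (\<lambda>h. h *\<^sub>R e' t)) (at t within {0..1})"
      using der[of t] that by (simp add: has_vector_derivative_def)
    then show ?thesis
      unfolding g_def g'_def
      by (auto intro!: derivative_eq_intros simp: algebra_simps inner_commute)
  qed
  obtain t where t: "t \<in> {0<..<1}" "g 1 - g 0 = (1 - 0) * g' t"
    using mvt_simple[of 0 1 g "\<lambda>t h. h * g' t"] g by auto
  have "e t \<bullet> e' t \<le> norm (e t) * norm (e' t)" by (rule norm_cauchy_schwarz)
  also have "\<dots> \<le> norm (e t) * (C * norm (e t) + \<epsilon>)"
    using bound[of t] t by (intro mult_left_mono) auto
  finally have "2 * (e t \<bullet> e' t) \<le> 2 * C * (norm (e t))\<^sup>2 + 2 * norm (e t) * \<epsilon>"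
    by (simp add: algebra_simps power2_eq_square)
  also have "2 * norm (e t) * \<epsilon> \<le> (norm (e t))\<^sup>2 + \<epsilon>\<^sup>2"
    using sum_squares_bound[of "norm (e t)" \<epsilon>] by simp
  finally have "2 * (e t \<bullet> e' t) - k * (e t \<bullet> e t) \<le> \<epsilon>\<^sup>2"
    by (simp add: k_def power2_norm_eq_inner algebra_simps)
  moreover have "k * t \<ge> 0" using t \<open>C \<ge> 0\<close> by (simp add: k_def)
  then have "exp (- k * t) \<le> 1" by simp
  ultimately have "(2 * (e t \<bullet> e' t) - k * (e t \<bullet> e t)) * exp (- k * t) \<le> \<epsilon>\<^sup>2"
    by (smt (verit) exp_gt_zero mult_left_le mult_nonneg_nonneg mult_right_mono not_exp_less_zero zero_le_power2)
  then have "g 1 \<le> g 0" using t by (simp add: g'_def)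
  then have "(norm (e 1))\<^sup>2 * exp (- k) \<le> \<epsilon>\<^sup>2"
    using \<open>e 0 = 0\<close> by (simp add: g_def power2_norm_eq_inner)
  then have "(norm (e 1))\<^sup>2 \<le> \<epsilon>\<^sup>2 * exp k"
    by (simp add: exp_minus field_simps)
  also have "\<dots> \<le> \<epsilon>\<^sup>2 * (exp (C + 1))\<^sup>2"
    by (intro mult_left_mono) (auto simp: k_def power2_eq_square simp flip: exp_add)
  finally have "(norm (e 1))\<^sup>2 \<le> (\<epsilon> * exp (C + 1))\<^sup>2" by (simp add: power_mult_distrib)
  then show ?thesis using \<open>\<epsilon> \<ge> 0\<close> by (intro power2_le_imp_le[of "norm (e 1)"]) auto
qed

text \<open>The zero set is closed in \<open>U\<close> by continuity. It is also open: on a small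
  ball \<open>C\<close> is bounded, and Gronwall's inequality with error \<open>0\<close> along the
  segments from a zero forces \<open>K\<close> to vanish there. Connectedness concludes.\<close>

lemma linear_total_ode_unique:
  fixes K :: "'a::real_normed_vector \<Rightarrow> 'v::real_inner"
  assumes U: "open U" "connected U"
    and der: "\<And>x. x \<in> U \<Longrightarrow> (K has_derivative K' x) (at x)"
    and C: "continuous_on U C"
    and bound: "\<And>x h. x \<in> U \<Longrightarrow> norm (K' x h) \<le> C x * norm h * norm (K x)"
    and x0: "x0 \<in> U" "K x0 = 0" and x: "x \<in> U"
  shows "K x = 0"
proof -
  define S where "S = {x \<in> U. K x = 0}"
  have contK: "continuous_on U K"
    using der U by (meson continuous_at_imp_continuous_on has_derivative_continuous)
  have "closedin (top_of_set U) S"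
    unfolding S_def by (rule continuous_closedin_preimage_constant[OF contK])
  moreover have "open S"
    unfolding open_contains_ball
  proof
    fix y assume y: "y \<in> S"
    then have "y \<in> U" by (simp add: S_def)
    obtain r1 where r1: "r1 > 0" "ball y r1 \<subseteq> U" using U \<open>y \<in> U\<close> openE by blast
    obtain r2 where r2: "r2 > 0" "\<And>q. q \<in> U \<Longrightarrow> dist q y < r2 \<Longrightarrow> dist (C q) (C y) < 1"
      using C \<open>y \<in> U\<close> unfolding continuous_on_iff by (meson zero_less_one)
    define r where "r = min r1 r2"
    have "K q = 0" if q: "q \<in> ball y r" for q
    proof -
      define \<gamma> where "\<gamma> = (\<lambda>t. y + t *\<^sub>R (q - y))"
      have \<gamma>: "\<gamma> t \<in> U" "dist (\<gamma> t) y < r2" if "t \<in> {0..1}" for t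
      proof -
        have "\<bar>t\<bar> * norm (q - y) \<le> 1 * norm (q - y)" using that by (intro mult_right_mono) auto
        also have "\<dots> < r" using q by (simp add: dist_norm norm_minus_commute)
        finally have "dist (\<gamma> t) y < r" by (simp add: \<gamma>_def dist_norm)
        then show "\<gamma> t \<in> U" "dist (\<gamma> t) y < r2" using r1 by (auto simp: r_def dist_commute)
      qed
      have Cb: "C (\<gamma> t) \<le> C y + 1" if "t \<in> {0..1}" for t
        using r2(2)[OF \<gamma>[OF that]] by (simp add: dist_real_def)
      have "norm (K (\<gamma> 1)) \<le> 0 * exp (\<bar>C y + 1\<bar> * norm (q - y) + 1)"
      proof (rule gronwall_unit_interval)
        fix t :: real assume t: "t \<in> {0..1}"
        have "(\<gamma> has_derivative (\<lambda>h. h *\<^sub>R (q - y))) (at t within {0..1})"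
          unfolding \<gamma>_def by (auto intro!: derivative_eq_intros)
        from has_derivative_compose[OF this der[OF \<gamma>(1)[OF t]]]
        show "((\<lambda>t. K (\<gamma> t)) has_vector_derivative K' (\<gamma> t) (q - y)) (at t within {0..1})"
          using linear_scale[OF has_derivative_linear[OF der[OF \<gamma>(1)[OF t]]]]
          by (simp add: has_vector_derivative_def)
        have "norm (K' (\<gamma> t) (q - y)) \<le> C (\<gamma> t) * norm (q - y) * norm (K (\<gamma> t))"
          by (rule bound[OF \<gamma>(1)[OF t]])
        also have "\<dots> \<le> \<bar>C y + 1\<bar> * norm (q - y) * norm (K (\<gamma> t))"
          using Cb[OF t] by (intro mult_right_mono) auto
        finally show "norm (K' (\<gamma> t) (q - y)) \<le> \<bar>C y + 1\<bar> * norm (q - y) * norm (K (\<gamma> t)) + 0" by simp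
      qed (use y in \<open>auto simp: \<gamma>_def S_def\<close>)
      then show "K q = 0" by (simp add: \<gamma>_def)
    qed
    then have "ball y r \<subseteq> S" using r1 by (auto simp: S_def r_def)
    moreover have "r > 0" using r1 r2 by (simp add: r_def)
    ultimately show "\<exists>e>0. ball y e \<subseteq> S" by blast
  qed
  then have "openin (top_of_set U) S" by (rule open_subset[rotated]) (auto simp: S_def)
  ultimately have "S = {} \<or> S = U" using U(2) by (simp add: connected_clopen)
  then show ?thesis using x0 x by (auto simp: S_def)
qed

section \<open>Linear ordinary differential equations\<close>

text \<open>Coefficients enter only through their action on vectors, so products of coefficients are
  always written as iterated actions. It is later instantiated by multiplication of real 5 by 5
  matrices, with the whole frame as the vector.\<close>

locale matrix_action = bounded_bilinear act
  for act :: "'m::real_normed_vector \<Rightarrow> 'v::euclidean_space \<Rightarrow> 'v"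
begin

text \<open>The solution is the Picard series of iterated integrals. Its terms are bounded by
  \<open>norm c * C ^ n * (t ^ n / fact n)\<close>, so it converges uniformly like an exponential
  series and may be differentiated term by term.\<close>

lemma linear_ode_exists:
  assumes M: "continuous_on {0..1::real} M"
  shows "\<exists>y. y 0 = c \<and> (\<forall>t\<in>{0..1}. (y has_vector_derivative act (M t) (y t)) (at t within {0..1}))"
proof -
  obtain k where k: "k > 0" "\<And>m v. norm (act m v) \<le> norm m * norm v * k" using pos_bounded by blast
  have "bounded (M ` {0..1})" using M by (intro compact_imp_bounded compact_continuous_image) auto
  then obtain B where B: "B > 0" "\<And>t. t \<in> {0..1} \<Longrightarrow> norm (M t) \<le> B"
    unfolding bounded_pos by auto
  define C where "C = B * k"
  have C: "C > 0" "norm (act (M t) v) \<le> C * norm v" if "t \<in> {0..1}" for t v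
  proof -
    show "C > 0" using B k by (simp add: C_def)
    have "norm (act (M t) v) \<le> norm (M t) * norm v * k" by (rule k)
    also have "\<dots> \<le> B * norm v * k" using B(2)[OF that] k by (intro mult_right_mono) auto
    finally show "norm (act (M t) v) \<le> C * norm v" by (simp add: C_def mult_ac)
  qed
  have "C > 0" using B k by (simp add: C_def)
  define d where "d = rec_nat (\<lambda>t::real. c) (\<lambda>n dn t. integral {0..t} (\<lambda>s. act (M s) (dn s)))"
  have d_0: "d 0 = (\<lambda>t. c)" and d_Suc: "d (Suc n) = (\<lambda>t. integral {0..t} (\<lambda>s. act (M s) (d n s)))" for n
    by (simp_all add: d_def)
  have d_der: "(d (Suc n) has_vector_derivative act (M t) (d n t)) (at t within {0..1})"
    if "continuous_on {0..1} (d n)" "t \<in> {0..1}" for n t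
    unfolding d_Suc using that M
    by (intro integral_has_vector_derivative[of 0 1 "\<lambda>s. act (M s) (d n s)"] continuous_on) auto
  have d_cont: "continuous_on {0..1} (d n)" for n
  proof (induction n)
    case (Suc n)
    show ?case unfolding continuous_on_eq_continuous_within
      using d_der[OF Suc] has_vector_derivative_continuous by blast
  qed (simp add: d_0)
  have d_bound: "norm (d n t) \<le> norm c * C ^ n * (t ^ n / fact n)" if "t \<in> {0..1}" for n t
    using that
  proof (induction n arbitrary: t)
    case (Suc n)
    have "((\<lambda>s. norm c * C ^ Suc n * (s ^ n / fact n)) has_integral
        norm c * C ^ Suc n * (t ^ Suc n / fact (Suc n)) - norm c * C ^ Suc n * (0 ^ Suc n / fact (Suc n))) {0..t}"
      using Suc.prems
      by (intro fundamental_theorem_of_calculus)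
        (auto intro!: derivative_eq_intros simp: has_real_derivative_iff_has_vector_derivative[symmetric] field_simps simp del: power_Suc of_nat_Suc)
    then have int: "((\<lambda>s. norm c * C ^ Suc n * (s ^ n / fact n)) has_integral
        norm c * C ^ Suc n * (t ^ Suc n / fact (Suc n))) {0..t}" by simp
    have "norm (d (Suc n) t) \<le> integral {0..t} (\<lambda>s. norm c * C ^ Suc n * (s ^ n / fact n))"
      unfolding d_Suc
    proof (rule integral_norm_bound_integral)
      have "continuous_on {0..t} (\<lambda>s. act (M s) (d n s))"
        by (rule continuous_on_subset[OF continuous_on[OF M d_cont]]) (use Suc.prems in auto)
      then show "(\<lambda>s. act (M s) (d n s)) integrable_on {0..t}" by (rule integrable_continuous_real)
      show "(\<lambda>s. norm c * C ^ Suc n * (s ^ n / fact n)) integrable_on {0..t}" using int by blast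
      fix s assume "s \<in> {0..t}"
      then have s: "s \<in> {0..1}" using Suc.prems by auto
      have "norm (act (M s) (d n s)) \<le> C * norm (d n s)" by (rule C[OF s])
      also have "\<dots> \<le> C * (norm c * C ^ n * (s ^ n / fact n))"
        using Suc.IH[OF s] \<open>C > 0\<close> by (intro mult_left_mono) auto
      finally show "norm (act (M s) (d n s)) \<le> norm c * C ^ Suc n * (s ^ n / fact n)" by (simp add: mult_ac)
    qed
    also have "\<dots> = norm c * C ^ Suc n * (t ^ Suc n / fact (Suc n))" using int by (rule integral_unique)
    finally show ?case .
  qed (simp add: d_0)
  have d_bound': "norm (d n t) \<le> norm c * (inverse (fact n) * C ^ n)" if "t \<in> {0..1}" for n t
  proof -
    have "norm c * C ^ n * (t ^ n / fact n) \<le> norm c * C ^ n * (1 / fact n)"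
      using that \<open>C > 0\<close> by (intro mult_left_mono divide_right_mono power_le_one) auto
    then show ?thesis using d_bound[OF that, of n] by (simp add: field_simps)
  qed
  have "summable (\<lambda>n. norm c * (inverse (fact n) * C ^ n))"
    by (intro summable_mult summable_exp)
  note smb = this
  have unif: "uniform_limit {0..1} (\<lambda>n t. \<Sum>i<n. d i t) (\<lambda>t. \<Sum>i. d i t) sequentially"
    by (rule Weierstrass_m_test[OF d_bound' smb])
  have sums: "summable (\<lambda>i. d i t)" if "t \<in> {0..1}" for t
    by (rule summable_comparison_test'[OF smb d_bound'[OF that]])
  define y where "y = (\<lambda>t. \<Sum>i. d i t)"
  \<comment> \<open>The derivative of term \<open>Suc n\<close> is the action on term
    \<open>n\<close>, and the constant term contributes \<open>0\<close>. Hence the sum of the first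
    \<open>Suc n\<close> derivatives is the action on the sum of the first \<open>n\<close> terms,
    which explains the index shift below.\<close>
  define d' where "d' = (\<lambda>n t. case n of 0 \<Rightarrow> 0 | Suc n \<Rightarrow> act (M t) (d n t))"
  have sum_d': "(\<Sum>i<Suc n. d' i t) = act (M t) (\<Sum>i<n. d i t)" for n t
    by (induction n) (auto simp: d'_def zero_right add_right)
  have "\<exists>g. \<forall>t\<in>{0..1}. (\<lambda>n. d n t) sums g t \<and>
      (g has_derivative (\<lambda>h. h *\<^sub>R act (M t) (y t))) (at t within {0..1})"
  proof (rule has_derivative_series)
    fix n and t :: real assume t: "t \<in> {0..1}"
    show "(d n has_derivative (\<lambda>h. h *\<^sub>R d' n t)) (at t within {0..1})"
    proof (cases n)
      case 0 then show ?thesis by (simp add: d_0 d'_def)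
    next
      case (Suc m) then show ?thesis
        using d_der[OF d_cont t, of m] by (simp add: d'_def has_vector_derivative_def)
    qed
  next
    fix e :: real assume "e > 0"
    then have "eventually (\<lambda>n. \<forall>t\<in>{0..1}. dist (\<Sum>i<n. d i t) (y t) < e / C) sequentially"
      using unif \<open>C > 0\<close> by (simp add: uniform_limit_iff y_def)
    then have "eventually (\<lambda>n. \<forall>t\<in>{0..1}. \<forall>h. norm ((\<Sum>i<Suc n. h *\<^sub>R d' i t) - h *\<^sub>R act (M t) (y t)) \<le> e * norm h) sequentially"
    proof (rule eventually_mono, intro ballI allI)
      fix n and t h :: real
      assume n: "\<forall>t\<in>{0..1}. dist (\<Sum>i<n. d i t) (y t) < e / C" and t: "t \<in> {0..1}"
      have "norm (act (M t) ((\<Sum>i<n. d i t) - y t)) \<le> C * norm ((\<Sum>i<n. d i t) - y t)" by (rule C[OF t])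
      also have "\<dots> \<le> e" using n t \<open>C > 0\<close> by (auto simp: dist_norm field_simps less_imp_le)
      finally have "norm (act (M t) ((\<Sum>i<n. d i t) - y t)) \<le> e" .
      moreover have "(\<Sum>i<Suc n. h *\<^sub>R d' i t) - h *\<^sub>R act (M t) (y t) = h *\<^sub>R act (M t) ((\<Sum>i<n. d i t) - y t)"
        unfolding scaleR_sum_right[symmetric] sum_d' by (simp add: diff_right scaleR_diff_right)
      ultimately show "norm ((\<Sum>i<Suc n. h *\<^sub>R d' i t) - h *\<^sub>R act (M t) (y t)) \<le> e * norm h"
        by (simp only: norm_scaleR real_norm_def) (simp add: mult.commute[of e] mult_left_mono)
    qed
    then show "eventually (\<lambda>n. \<forall>t\<in>{0..1}. \<forall>h. norm ((\<Sum>i<n. h *\<^sub>R d' i t) - h *\<^sub>R act (M t) (y t)) \<le> e * norm h) sequentially"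
      by (rule eventually_sequentially_Suc[THEN iffD1])
  next
    show "(0::real) \<in> {0..1}" by simp
    show "(\<lambda>n. d n 0) sums (\<Sum>i. d i 0)" using sums[of 0] by (simp add: summable_sums)
  qed simp
  then obtain g where g: "\<And>t. t \<in> {0..1} \<Longrightarrow> (\<lambda>n. d n t) sums g t"
    "\<And>t. t \<in> {0..1} \<Longrightarrow> (g has_derivative (\<lambda>h. h *\<^sub>R act (M t) (y t))) (at t within {0..1})" by blast
  have gy: "g t = y t" if "t \<in> {0..1}" for t using sums_unique[OF g(1)[OF that]] by (simp add: y_def)
  have "d n 0 = (if n = 0 then c else 0)" for n by (cases n) (simp_all add: d_0 d_Suc)
  then have "(\<lambda>n. d n 0) = (\<lambda>n. if n = 0 then c else 0)" by blast
  then have "g 0 = c" using g(1)[of 0] sums_single[of 0 "\<lambda>_. c"] by (simp add: sums_unique2)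
  moreover have "(g has_vector_derivative act (M t) (g t)) (at t within {0..1})" if "t \<in> {0..1}" for t
    using g(2)[OF that] by (simp add: gy[OF that] has_vector_derivative_def)
  ultimately show ?thesis by blast
qed

end

section \<open>Flat systems on a convex domain\<close>

lemma norm_Re_Im_scaleR_le:
  fixes a b :: "'a::real_normed_vector"
  assumes "norm a \<le> \<beta>" "norm b \<le> \<beta>"
  shows "norm (Re h *\<^sub>R a + Im h *\<^sub>R b) \<le> 2 * \<beta> * norm h"
proof -
  have "norm (Re h *\<^sub>R a + Im h *\<^sub>R b) \<le> \<bar>Re h\<bar> * norm a + \<bar>Im h\<bar> * norm b"
    by (rule norm_triangle_le) simp
  also have "\<dots> \<le> norm h * \<beta> + norm h * \<beta>"
    by (intro add_mono mult_mono abs_Re_le_cmod abs_Im_le_cmod assms) auto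
  finally show ?thesis by simp
qed

context matrix_action
begin

text \<open>Integrating along the rays through \<open>0\<close> gives a candidate \<open>\<Phi>\<close>. For its derivative, the solution
  along the ray through \<open>z + w\<close> is compared with the first-order guess
  \<open>y t + t \<omega>(w) (y t)\<close> built from the solution \<open>y\<close> along the ray through \<open>z\<close>; by flatness the guess solves the
  equation up to an error \<open>o(w)\<close>, and Gronwall's inequality finishes the argument.\<close>

lemma flat_system_solvable_convex:
  fixes P Q :: "complex \<Rightarrow> 'm"
  assumes S: "open S" "convex S" "0 \<in> S"
    and P: "\<And>z. z \<in> S \<Longrightarrow> (P has_derivative (\<lambda>h. Re h *\<^sub>R Px z + Im h *\<^sub>R Py z)) (at z)"
    and Q: "\<And>z. z \<in> S \<Longrightarrow> (Q has_derivative (\<lambda>h. Re h *\<^sub>R Qx z + Im h *\<^sub>R Qy z)) (at z)"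
    and cont: "continuous_on S Px" "continuous_on S Py" "continuous_on S Qx" "continuous_on S Qy"
    and flat: "\<And>z v. z \<in> S \<Longrightarrow>
      act (Py z) v + act (P z) (act (Q z) v) = act (Qx z) v + act (Q z) (act (P z) v)"
  shows "\<exists>\<Phi>. \<Phi> 0 = c \<and>
    (\<forall>z\<in>S. (\<Phi> has_derivative (\<lambda>h. Re h *\<^sub>R act (P z) (\<Phi> z) + Im h *\<^sub>R act (Q z) (\<Phi> z))) (at z))"
proof -
  \<comment> \<open>\<open>om z h\<close> is the connection form at \<open>z\<close> evaluated on
    \<open>h\<close>; \<open>D z k h\<close> is its derivative in the direction \<open>k\<close>
    with \<open>h\<close> held fixed.\<close>
  define om where "om = (\<lambda>z h. Re h *\<^sub>R P z + Im h *\<^sub>R Q z)"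
  define D where "D = (\<lambda>z k h. Re h *\<^sub>R (Re k *\<^sub>R Px z + Im k *\<^sub>R Py z) + Im h *\<^sub>R (Re k *\<^sub>R Qx z + Im k *\<^sub>R Qy z))"
  have om_add: "om z (h + h') = om z h + om z h'" and om_scale: "om z (t *\<^sub>R h) = t *\<^sub>R om z h" for z h h' t
    by (simp_all add: om_def algebra_simps)
  have D_add: "D z k (h + h') = D z k h + D z k h'" and D_scale: "D z (t *\<^sub>R k) h = t *\<^sub>R D z k h" for z h h' k t
    by (simp_all add: D_def algebra_simps)
  \<comment> \<open>This is vanishing of the curvature on a pair of directions: the difference of
    the two sides is antisymmetric in \<open>h\<close> and \<open>k\<close>, hence a multiple of the
    flatness condition by the area form.\<close>
  have flat': "act (D z k h) v + act (om z h) (act (om z k) v) = act (D z h k) v + act (om z k) (act (om z h) v)"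
    if "z \<in> S" for z h k v
  proof -
    have "act (D z k h) v + act (om z h) (act (om z k) v) - (act (D z h k) v + act (om z k) (act (om z h) v))
      = (Im h * Re k - Im k * Re h) *\<^sub>R
        ((act (Qx z) v + act (Q z) (act (P z) v)) - (act (Py z) v + act (P z) (act (Q z) v)))"
      by (simp add: D_def om_def add_left add_right scaleR_left scaleR_right algebra_simps)
    then show ?thesis using flat[OF that] by simp
  qed
  have ray: "t *\<^sub>R z \<in> S" if "z \<in> S" "t \<in> {0..1}" for z t
    using convexD_alt[OF S(2,3) that(1), of t] that by simp
  have contPQ: "continuous_on S P" "continuous_on S Q"
    by (intro continuous_at_imp_continuous_on ballI has_derivative_continuous[OF P] has_derivative_continuous[OF Q],
        assumption)+
  \<comment> \<open>\<open>Y z\<close> solves the system along \<open>t \<mapsto> t z\<close>, so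
    the candidate for the solution at \<open>z\<close> is \<open>Y z 1\<close>.\<close>
  define Y where "Y = (\<lambda>z. SOME y. y 0 = c \<and>
    (\<forall>t\<in>{0..1}. (y has_vector_derivative act (om (t *\<^sub>R z) z) (y t)) (at t within {0..1})))"
  have ex: "\<exists>y. y 0 = c \<and> (\<forall>t\<in>{0..1}. (y has_vector_derivative act (om (t *\<^sub>R z) z) (y t)) (at t within {0..1}))"
    if "z \<in> S" for z
  proof (rule linear_ode_exists)
    show "continuous_on {0..1} (\<lambda>t. om (t *\<^sub>R z) z)"
      unfolding om_def
      by (intro continuous_intros continuous_on_compose2[OF contPQ(1)] continuous_on_compose2[OF contPQ(2)])
        (use ray[OF that] in auto)
  qed
  have "Y z 0 = c \<and> (\<forall>t\<in>{0..1}. (Y z has_vector_derivative act (om (t *\<^sub>R z) z) (Y z t)) (at t within {0..1}))"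
    if "z \<in> S" for z
    unfolding Y_def by (rule someI_ex[OF ex[OF that]])
  then have Y0: "\<And>z. z \<in> S \<Longrightarrow> Y z 0 = c"
    and Yder: "\<And>z t. z \<in> S \<Longrightarrow> t \<in> {0..1} \<Longrightarrow>
      (Y z has_vector_derivative act (om (t *\<^sub>R z) z) (Y z t)) (at t within {0..1})"
    by simp_all
  have der: "((\<lambda>z. Y z 1) has_derivative (\<lambda>h. Re h *\<^sub>R act (P z) (Y z 1) + Im h *\<^sub>R act (Q z) (Y z 1))) (at z)"
    if z: "z \<in> S" for z
  proof -
    obtain r where r: "r > 0" "cball z r \<subseteq> S" using S(1) z open_contains_cball by blast
    \<comment> \<open>The union of all segments from \<open>0\<close> to a closed disc about
      \<open>z\<close>. It is compact and contains every ray compared below, which provides uniform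
      bounds and uniform continuity.\<close>
    define K where "K = (\<lambda>(t::real, x). t *\<^sub>R x) ` ({0..1} \<times> cball z r)"
    have "compact K" unfolding K_def
      by (intro compact_continuous_image compact_Times) (auto intro!: continuous_intros simp: case_prod_beta)
    have KS: "K \<subseteq> S" unfolding K_def using r ray by auto
    have Kray: "t *\<^sub>R (z + w) \<in> K" if "t \<in> {0..1}" "norm w \<le> r" for t w
      unfolding K_def using that by (intro image_eqI[of _ _ "(t, z + w)"]) (auto simp: dist_norm)
    have bdd: "\<exists>b. \<forall>x\<in>K. norm (f x) \<le> b" if "continuous_on S f" for f :: "complex \<Rightarrow> 'm"
      using compact_imp_bounded[OF compact_continuous_image[OF continuous_on_subset[OF that KS] \<open>compact K\<close>]]
      unfolding bounded_iff by auto
    obtain b1 where b1: "\<forall>x\<in>K. norm (P x) \<le> b1" using bdd[OF contPQ(1)] by (elim exE)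
    obtain b2 where b2: "\<forall>x\<in>K. norm (Q x) \<le> b2" using bdd[OF contPQ(2)] by (elim exE)
    obtain b3 where b3: "\<forall>x\<in>K. norm (Px x) \<le> b3" using bdd[OF cont(1)] by (elim exE)
    obtain b4 where b4: "\<forall>x\<in>K. norm (Py x) \<le> b4" using bdd[OF cont(2)] by (elim exE)
    obtain b5 where b5: "\<forall>x\<in>K. norm (Qx x) \<le> b5" using bdd[OF cont(3)] by (elim exE)
    obtain b6 where b6: "\<forall>x\<in>K. norm (Qy x) \<le> b6" using bdd[OF cont(4)] by (elim exE)
    note b = b1 b2 b3 b4 b5 b6
    define \<beta> where "\<beta> = \<bar>b1\<bar> + \<bar>b2\<bar> + \<bar>b3\<bar> + \<bar>b4\<bar> + \<bar>b5\<bar> + \<bar>b6\<bar>"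
    have "\<beta> \<ge> 0" by (simp add: \<beta>_def)
    have \<beta>: "norm (P x) \<le> \<beta>" "norm (Q x) \<le> \<beta>" "norm (Px x) \<le> \<beta>" "norm (Py x) \<le> \<beta>" "norm (Qx x) \<le> \<beta>" "norm (Qy x) \<le> \<beta>"
      if "x \<in> K" for x
      using b[THEN bspec, OF that] unfolding \<beta>_def by linarith+
    have om_le: "norm (om x h) \<le> 2 * \<beta> * norm h" if "x \<in> K" for x h
      unfolding om_def by (intro norm_Re_Im_scaleR_le \<beta>[OF that])
    have D_le: "norm (D x k h) \<le> 2 * (2 * \<beta> * norm k) * norm h" if "x \<in> K" for x h k
      unfolding D_def by (intro norm_Re_Im_scaleR_le \<beta>[OF that])
    obtain k where k: "k > 0" "\<And>m v. norm (act m v) \<le> norm m * norm v * k" using pos_bounded by blast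
    have act_le: "norm (act m v) \<le> k * (a * b)" if "norm m \<le> a" "norm v \<le> b" for m v a b
    proof -
      have "norm m * norm v \<le> a * b" using that by (intro mult_mono) (auto intro: order_trans[OF norm_ge_zero])
      then have "norm m * norm v * k \<le> a * b * k" using k(1) by (intro mult_right_mono) auto
      then show ?thesis using k(2)[of m v] by (simp only: mult.commute[of k])
    qed
    have "continuous_on {0..1} (Y z)"
      unfolding continuous_on_eq_continuous_within
      by (intro ballI has_vector_derivative_continuous[OF Yder[OF z]])
    then have "bounded (Y z ` {0..1})" by (intro compact_imp_bounded compact_continuous_image) auto
    then obtain y0 where y0: "y0 > 0" "\<And>t. t \<in> {0..1} \<Longrightarrow> norm (Y z t) \<le> y0"
      unfolding bounded_pos by auto
    define R where "R = norm z + r"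
    have "R > 0" using r by (simp add: R_def add_nonneg_pos)
    define E where "E = exp (k * (2 * \<beta> * R) + 1)"
    \<comment> \<open>Both constants are gathered from the bound on \<open>e'\<close> below:
      \<open>c1\<close> from the contributions quadratic in \<open>w\<close>, \<open>c2\<close> from
      those containing the oscillation \<epsilon> of the coefficient derivatives.\<close>
    define c1 where "c1 = k * (4 * \<beta> * y0) + k * (2 * \<beta> * (k * (2 * \<beta> * y0))) + k * (4 * \<beta> * R * (k * (2 * \<beta> * y0)))"
    define c2 where "c2 = k * (4 * R * y0) + k * (4 * R * (k * (2 * \<beta> * R * y0)))"
    have "c1 \<ge> 0" "c2 \<ge> 0" "E > 0"
      using \<open>\<beta> \<ge> 0\<close> k(1) y0(1) \<open>R > 0\<close> by (simp_all add: c1_def c2_def E_def)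
    have main: "norm (Y (z + w) 1 - Y z 1 - act (om z w) (Y z 1)) \<le> (c1 * norm w + c2 * \<epsilon>) * norm w * E"
      if "\<epsilon> \<ge> 0" "norm w \<le> r"
        and unif: "\<And>x x'. x \<in> K \<Longrightarrow> x' \<in> K \<Longrightarrow> dist x' x \<le> norm w \<Longrightarrow>
          dist (Px x') (Px x) \<le> \<epsilon> \<and> dist (Py x') (Py x) \<le> \<epsilon> \<and> dist (Qx x') (Qx x) \<le> \<epsilon> \<and> dist (Qy x') (Qy x) \<le> \<epsilon>"
      for w \<epsilon>
    proof -
      have zw: "z + w \<in> S" using r that(2) by (auto simp: dist_norm subset_iff)
      have nzw: "norm (z + w) \<le> R" using that(2) norm_triangle_ineq[of z w] by (simp add: R_def)
      have nw: "norm w \<le> R" using that(2) by (simp add: R_def add_increasing)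
      \<comment> \<open>The deviation of the solution on the ray through \<open>z + w\<close> from
        the first-order guess. At time \<open>1\<close> it is exactly the remainder in the
        definition of the derivative.\<close>
      define e where "e = (\<lambda>t. Y (z + w) t - Y z t - t *\<^sub>R act (om (t *\<^sub>R z) w) (Y z t))"
      define e' where "e' = (\<lambda>t. act (om (t *\<^sub>R (z + w)) (z + w)) (Y (z + w) t) - act (om (t *\<^sub>R z) z) (Y z t)
         - (act (om (t *\<^sub>R z) w) (Y z t) + t *\<^sub>R (act (D (t *\<^sub>R z) z w) (Y z t)
           + act (om (t *\<^sub>R z) w) (act (om (t *\<^sub>R z) z) (Y z t)))))"
      have "norm (e 1) \<le> (c1 * norm w + c2 * \<epsilon>) * norm w * exp (k * (2 * \<beta> * R) + 1)"
      proof (rule gronwall_unit_interval)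
        fix t :: real assume t: "t \<in> {0..1}"
        let ?I = "at t within {0..1}"
        have "((\<lambda>t. t *\<^sub>R z) has_derivative (\<lambda>h. h *\<^sub>R z)) ?I" by (auto intro!: derivative_eq_intros)
        from has_derivative_compose[OF this P[OF ray[OF z t]]] has_derivative_compose[OF this Q[OF ray[OF z t]]]
        have "((\<lambda>t. om (t *\<^sub>R z) w) has_vector_derivative D (t *\<^sub>R z) z w) ?I"
          unfolding om_def D_def has_vector_derivative_def
          by (auto intro!: derivative_eq_intros simp: algebra_simps)
        from bounded_bilinear.has_vector_derivative[OF bounded_bilinear_axioms this Yder[OF z t]]
        have "((\<lambda>t. act (om (t *\<^sub>R z) w) (Y z t)) has_vector_derivative
            act (om (t *\<^sub>R z) w) (act (om (t *\<^sub>R z) z) (Y z t)) + act (D (t *\<^sub>R z) z w) (Y z t)) ?I" .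
        from has_vector_derivative_scaleR[OF DERIV_ident this]
        show "(e has_vector_derivative e' t) ?I"
          unfolding e_def
          by (rule has_vector_derivative_eq_rhs[OF has_vector_derivative_diff[OF
                has_vector_derivative_diff[OF Yder[OF zw t] Yder[OF z t]]]])
            (simp add: e'_def algebra_simps)
        define a where "a = om (t *\<^sub>R z) z"
        define b where "b = om (t *\<^sub>R z) w"
        define d where "d = D (t *\<^sub>R z) w"
        define y where "y = Y z t"
        define M where "M = om (t *\<^sub>R (z + w)) (z + w)"
        \<comment> \<open>First-order Taylor remainder of the connection form between
          \<open>t z\<close> and \<open>t (z + w)\<close>, evaluated on
          \<open>z + w\<close>.\<close>
        define \<rho> where "\<rho> = M - om (t *\<^sub>R z) (z + w) - t *\<^sub>R d (z + w)"
        have M: "M = a + b + t *\<^sub>R (d z + d w) + \<rho>"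
          by (simp add: \<rho>_def a_def b_def d_def om_add D_add)
        have tz: "t *\<^sub>R z \<in> K" using Kray[OF t, of 0] r by simp
        have tzw: "t *\<^sub>R (z + w) \<in> K" by (rule Kray[OF t that(2)])
        \<comment> \<open>Flatness enters here: it exchanges the derivative of the form along
          \<open>z\<close> for one along \<open>w\<close>, so that the terms of first order in
          \<open>w\<close> cancel in \<open>e'\<close>.\<close>
        have fl: "act (D (t *\<^sub>R z) z w) y + act b (act a y) = act (d z) y + act a (act b y)"
          unfolding a_def b_def d_def by (rule flat'[OF ray[OF z t]])
        have "Y (z + w) t = e t + y + t *\<^sub>R act b y" by (simp add: e_def y_def b_def)
        then have e': "e' t = act M (e t) + (t *\<^sub>R act (d w) y + act \<rho> y + t *\<^sub>R act b (act b y)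
            + (t * t) *\<^sub>R act (d (z + w)) (act b y) + t *\<^sub>R act \<rho> (act b y))"
          unfolding e'_def M_def[symmetric] a_def[symmetric] b_def[symmetric] y_def[symmetric] fl
          by (simp add: M d_def D_add add_left add_right scaleR_left scaleR_right algebra_simps)
        \<comment> \<open>A mean value estimate on the segment from \<open>t z\<close> to
          \<open>t (z + w)\<close>: the derivative differs from its value at the starting point by
          at most \<open>2 * \<epsilon>\<close> in operator norm.\<close>
        have lin: "norm (f (t *\<^sub>R (z + w)) - f (t *\<^sub>R z) - (Re (t *\<^sub>R w) *\<^sub>R fx (t *\<^sub>R z) + Im (t *\<^sub>R w) *\<^sub>R fy (t *\<^sub>R z)))
            \<le> norm w * (2 * \<epsilon>)"
          if f: "\<And>x. x \<in> S \<Longrightarrow> (f has_derivative (\<lambda>h. Re h *\<^sub>R fx x + Im h *\<^sub>R fy x)) (at x)"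
            and fxy: "\<And>x x'. x \<in> K \<Longrightarrow> x' \<in> K \<Longrightarrow> dist x' x \<le> norm w \<Longrightarrow> dist (fx x') (fx x) \<le> \<epsilon> \<and> dist (fy x') (fy x) \<le> \<epsilon>"
          for f fx fy :: "complex \<Rightarrow> 'm"
        proof -
          let ?G = "closed_segment (t *\<^sub>R z) (t *\<^sub>R (z + w))"
          have G: "x \<in> K \<and> dist x (t *\<^sub>R z) \<le> norm w" if "x \<in> ?G" for x
          proof -
            obtain u where u: "0 \<le> u" "u \<le> 1" "x = (1 - u) *\<^sub>R (t *\<^sub>R z) + u *\<^sub>R (t *\<^sub>R (z + w))"
              using \<open>x \<in> ?G\<close> unfolding closed_segment_def by auto
            have x: "x = t *\<^sub>R (z + u *\<^sub>R w)" unfolding u(3) by (simp add: algebra_simps)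
            have "norm (u *\<^sub>R w) \<le> norm w" using u by (simp add: mult_left_le_one_le)
            moreover have "norm (t *\<^sub>R (u *\<^sub>R w)) \<le> norm w"
              using u t mult_le_one[of t u] mult_left_le_one_le[of "norm w" "t * u"] by (simp add: mult.assoc)
            ultimately show ?thesis
              using Kray[OF t, of "u *\<^sub>R w"] \<open>norm w \<le> r\<close> unfolding x by (simp add: dist_norm algebra_simps)
          qed
          have "norm (f (t *\<^sub>R (z + w)) - f (t *\<^sub>R z) - (\<lambda>h. Re h *\<^sub>R fx (t *\<^sub>R z) + Im h *\<^sub>R fy (t *\<^sub>R z)) (t *\<^sub>R (z + w) - t *\<^sub>R z))
            \<le> norm (t *\<^sub>R (z + w) - t *\<^sub>R z) * (2 * \<epsilon>)"
          proof (rule differentiable_bound_linearization)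
            show "t *\<^sub>R z + s *\<^sub>R (t *\<^sub>R (z + w) - t *\<^sub>R z) \<in> ?G" if "s \<in> {0..1}" for s
              using that unfolding closed_segment_def by (auto intro!: exI[of _ s] simp: algebra_simps)
            show "t *\<^sub>R z \<in> ?G" by simp
            fix x assume x: "x \<in> ?G"
            show "(f has_derivative (\<lambda>h. Re h *\<^sub>R fx x + Im h *\<^sub>R fy x)) (at x within ?G)"
            proof (rule has_derivative_at_withinI, rule f)
              show "x \<in> S" using G[OF x] KS by blast
            qed
            have close: "norm (fx x - fx (t *\<^sub>R z)) \<le> \<epsilon>" "norm (fy x - fy (t *\<^sub>R z)) \<le> \<epsilon>"
              using fxy[OF tz, of x] G[OF x] by (auto simp: dist_norm)
            have "((\<lambda>h. Re h *\<^sub>R fx x + Im h *\<^sub>R fy x) - (\<lambda>h. Re h *\<^sub>R fx (t *\<^sub>R z) + Im h *\<^sub>R fy (t *\<^sub>R z))) h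
              = Re h *\<^sub>R (fx x - fx (t *\<^sub>R z)) + Im h *\<^sub>R (fy x - fy (t *\<^sub>R z))" for h
              by (simp add: algebra_simps)
            then show "onorm ((\<lambda>h. Re h *\<^sub>R fx x + Im h *\<^sub>R fy x) - (\<lambda>h. Re h *\<^sub>R fx (t *\<^sub>R z) + Im h *\<^sub>R fy (t *\<^sub>R z))) \<le> 2 * \<epsilon>"
              by (intro onorm_le) (simp only: norm_Re_Im_scaleR_le[OF close])
          qed
          also have "norm (t *\<^sub>R (z + w) - t *\<^sub>R z) = \<bar>t\<bar> * norm w" by (simp add: algebra_simps)
          also have "\<bar>t\<bar> * norm w * (2 * \<epsilon>) \<le> norm w * (2 * \<epsilon>)"
            using t \<open>\<epsilon> \<ge> 0\<close> by (intro mult_right_mono mult_left_le_one_le) auto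
          finally show ?thesis by (simp add: algebra_simps)
        qed
        have \<rho>_eq: "\<rho> = Re (z + w) *\<^sub>R (P (t *\<^sub>R (z + w)) - P (t *\<^sub>R z) - (Re (t *\<^sub>R w) *\<^sub>R Px (t *\<^sub>R z) + Im (t *\<^sub>R w) *\<^sub>R Py (t *\<^sub>R z)))
           + Im (z + w) *\<^sub>R (Q (t *\<^sub>R (z + w)) - Q (t *\<^sub>R z) - (Re (t *\<^sub>R w) *\<^sub>R Qx (t *\<^sub>R z) + Im (t *\<^sub>R w) *\<^sub>R Qy (t *\<^sub>R z)))"
          unfolding \<rho>_def M_def d_def D_def om_def by (simp add: algebra_simps)
        have "norm \<rho> \<le> 2 * (norm w * (2 * \<epsilon>)) * norm (z + w)"
          unfolding \<rho>_eq by (intro norm_Re_Im_scaleR_le lin[OF P] lin[OF Q]) (use unif in simp_all)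
        also have "\<dots> \<le> 2 * (norm w * (2 * \<epsilon>)) * R" using nzw \<open>\<epsilon> \<ge> 0\<close> by (intro mult_left_mono) auto
        finally have \<rho>: "norm \<rho> \<le> 4 * \<epsilon> * R * norm w" by (simp add: mult_ac)
        have "norm M \<le> 2 * \<beta> * norm (z + w)" unfolding M_def by (rule om_le[OF tzw])
        also have "\<dots> \<le> 2 * \<beta> * R" using nzw \<open>\<beta> \<ge> 0\<close> by (intro mult_left_mono) auto
        finally have M_le: "norm M \<le> 2 * \<beta> * R" .
        have b_le: "norm b \<le> 2 * \<beta> * norm w" unfolding b_def by (rule om_le[OF tz])
        have y_le: "norm y \<le> y0" unfolding y_def by (rule y0(2)[OF t])
        have dw: "norm (d w) \<le> 4 * \<beta> * norm w * norm w" using D_le[OF tz, of w w] by (simp add: d_def)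
        have "norm (d (z + w)) \<le> 4 * \<beta> * norm w * norm (z + w)" using D_le[OF tz, of w "z + w"] by (simp add: d_def)
        also have "\<dots> \<le> 4 * \<beta> * norm w * R" using nzw \<open>\<beta> \<ge> 0\<close> by (intro mult_left_mono) auto
        finally have dzw: "norm (d (z + w)) \<le> 4 * \<beta> * norm w * R" .
        note by_le = act_le[OF b_le y_le]
        have scale: "norm (s *\<^sub>R v) \<le> x" if "norm v \<le> x" "s \<in> {0..1}" for s x and v :: 'v
        proof -
          have "\<bar>s\<bar> * norm v \<le> norm v" using that by (intro mult_left_le_one_le) auto
          then show ?thesis using that by simp
        qed
        have tt: "t * t \<in> {0..1}" using t by (auto simp: mult_le_one)
        have "norm (e' t) \<le> k * ((2 * \<beta> * R) * norm (e t)) + (k * (4 * \<beta> * norm w * norm w * y0) + k * (4 * \<epsilon> * R * norm w * y0)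
            + k * (2 * \<beta> * norm w * (k * (2 * \<beta> * norm w * y0))) + k * (4 * \<beta> * norm w * R * (k * (2 * \<beta> * norm w * y0)))
            + k * (4 * \<epsilon> * R * norm w * (k * (2 * \<beta> * norm w * y0))))"
          unfolding e' by (intro norm_triangle_mono scale act_le[OF M_le order_refl] act_le[OF dw y_le] act_le[OF \<rho> y_le]
              act_le[OF b_le by_le] act_le[OF dzw by_le] act_le[OF \<rho> by_le] t tt)
        \<comment> \<open>One factor \<open>norm w\<close> is traded for \<open>R\<close>, so that
          the term fits into \<open>c2 * \<epsilon> * norm w\<close>.\<close>
        also have "k * (4 * \<epsilon> * R * norm w * (k * (2 * \<beta> * norm w * y0))) \<le> k * (4 * \<epsilon> * R * norm w * (k * (2 * \<beta> * R * y0)))"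
          using nw \<open>\<beta> \<ge> 0\<close> k(1) y0(1) \<open>R > 0\<close> \<open>\<epsilon> \<ge> 0\<close> by (intro mult_left_mono mult_right_mono) auto
        finally show "norm (e' t) \<le> k * (2 * \<beta> * R) * norm (e t) + (c1 * norm w + c2 * \<epsilon>) * norm w"
          by (simp add: c1_def c2_def algebra_simps)
      next
        show "e 0 = 0" by (simp add: e_def Y0[OF z] Y0[OF zw])
        show "0 \<le> k * (2 * \<beta> * R)" using \<open>\<beta> \<ge> 0\<close> k(1) \<open>R > 0\<close> by simp
        show "0 \<le> (c1 * norm w + c2 * \<epsilon>) * norm w" using \<open>c1 \<ge> 0\<close> \<open>c2 \<ge> 0\<close> \<open>\<epsilon> \<ge> 0\<close> by simp
      qed
      then show ?thesis by (simp add: e_def E_def)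
    qed
    have "((\<lambda>z. Y z 1) has_derivative (\<lambda>w. act (om z w) (Y z 1))) (at z)"
      unfolding has_derivative_at_alt
    proof (intro conjI allI impI)
      have "bounded_linear (om z)" unfolding om_def
        by (rule bounded_linear_add[OF bounded_linear_compose[OF bounded_linear_scaleR_left bounded_linear_Re]
              bounded_linear_compose[OF bounded_linear_scaleR_left bounded_linear_Im]])
      then show "bounded_linear (\<lambda>w. act (om z w) (Y z 1))"
        by (rule bounded_linear_compose[OF bounded_linear_left])
      fix \<eta> :: real assume "\<eta> > 0"
      \<comment> \<open>Half of the allowed error \<eta> is reserved for the oscillation term and
        half for the quadratic term; \<open>c2 + 1\<close> keeps the quotient meaningful when
        \<open>c2 = 0\<close>.\<close>
      define \<epsilon> where "\<epsilon> = \<eta> / (2 * (c2 + 1) * E)"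
      have "\<epsilon> > 0" using \<open>\<eta> > 0\<close> \<open>c2 \<ge> 0\<close> \<open>E > 0\<close> by (simp add: \<epsilon>_def)
      have uc: "\<exists>\<delta>>0. \<forall>x\<in>K. \<forall>x'\<in>K. dist x' x < \<delta> \<longrightarrow> dist (f x') (f x) < \<epsilon>" if "continuous_on S f" for f :: "complex \<Rightarrow> 'm"
        using compact_uniformly_continuous[OF continuous_on_subset[OF that KS] \<open>compact K\<close>] \<open>\<epsilon> > 0\<close>
        unfolding uniformly_continuous_on_def by blast
      obtain d1 where d1: "d1 > 0" "\<forall>x\<in>K. \<forall>x'\<in>K. dist x' x < d1 \<longrightarrow> dist (Px x') (Px x) < \<epsilon>"
        using uc[OF cont(1)] by (elim exE conjE)
      obtain d2 where d2: "d2 > 0" "\<forall>x\<in>K. \<forall>x'\<in>K. dist x' x < d2 \<longrightarrow> dist (Py x') (Py x) < \<epsilon>"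
        using uc[OF cont(2)] by (elim exE conjE)
      obtain d3 where d3: "d3 > 0" "\<forall>x\<in>K. \<forall>x'\<in>K. dist x' x < d3 \<longrightarrow> dist (Qx x') (Qx x) < \<epsilon>"
        using uc[OF cont(3)] by (elim exE conjE)
      obtain d4 where d4: "d4 > 0" "\<forall>x\<in>K. \<forall>x'\<in>K. dist x' x < d4 \<longrightarrow> dist (Qy x') (Qy x) < \<epsilon>"
        using uc[OF cont(4)] by (elim exE conjE)
      note d = d1(1) d2(1) d3(1) d4(1) d1(2) d2(2) d3(2) d4(2)
      define \<delta> where "\<delta> = Min {d1, d2, d3, d4, r, \<eta> / (2 * (c1 + 1) * E)}"
      have "\<delta> > 0" using d(1-4) r(1) \<open>\<eta> > 0\<close> \<open>c1 \<ge> 0\<close> \<open>E > 0\<close> by (simp add: \<delta>_def)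
      moreover have "norm (Y x 1 - Y z 1 - act (om z (x - z)) (Y z 1)) \<le> \<eta> * norm (x - z)" if x: "norm (x - z) < \<delta>" for x
      proof -
        define w where "w = x - z"
        have w: "norm w < d1" "norm w < d2" "norm w < d3" "norm w < d4" "norm w < r" "norm w < \<eta> / (2 * (c1 + 1) * E)"
          using x by (simp_all add: \<delta>_def w_def)
        have "norm (Y (z + w) 1 - Y z 1 - act (om z w) (Y z 1)) \<le> (c1 * norm w + c2 * \<epsilon>) * norm w * E"
        proof (rule main)
          fix p p' assume "p \<in> K" "p' \<in> K" "dist p' p \<le> norm w"
          then show "dist (Px p') (Px p) \<le> \<epsilon> \<and> dist (Py p') (Py p) \<le> \<epsilon> \<and> dist (Qx p') (Qx p) \<le> \<epsilon> \<and> dist (Qy p') (Qy p) \<le> \<epsilon>"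
            using w(1-4) d(5)[rule_format, of p p'] d(6)[rule_format, of p p']
              d(7)[rule_format, of p p'] d(8)[rule_format, of p p'] by simp
        qed (use \<open>\<epsilon> > 0\<close> w in auto)
        also have "\<dots> = (c1 * norm w * E + c2 * \<epsilon> * E) * norm w" by (simp add: algebra_simps)
        also have "\<dots> \<le> (\<eta> / 2 + \<eta> / 2) * norm w"
        proof (intro mult_right_mono add_mono)
          have "c1 * norm w * E \<le> (c1 + 1) * norm w * E" using \<open>E > 0\<close> by (intro mult_right_mono) auto
          also have "\<dots> \<le> \<eta> / 2"
          proof -
            have "0 < 2 * (c1 + 1) * E" using \<open>c1 \<ge> 0\<close> \<open>E > 0\<close> by simp
            then have "norm w * (2 * (c1 + 1) * E) < \<eta>" using w(6) by (simp only: pos_less_divide_eq)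
            then show ?thesis by (simp add: algebra_simps)
          qed
          finally show "c1 * norm w * E \<le> \<eta> / 2" .
          have "c2 * \<epsilon> * E \<le> (c2 + 1) * \<epsilon> * E" using \<open>E > 0\<close> \<open>\<epsilon> > 0\<close> by (intro mult_right_mono) auto
          also have "\<dots> = \<eta> / 2"
          proof -
            have gen: "q * (\<eta> / (2 * q * E)) * E = \<eta> / 2" if "q \<noteq> 0" "E \<noteq> 0" for q
              using that by simp
            show ?thesis unfolding \<epsilon>_def by (rule gen) (use \<open>c2 \<ge> 0\<close> \<open>E > 0\<close> in simp_all)
          qed
          finally show "c2 * \<epsilon> * E \<le> \<eta> / 2" .
        qed simp
        finally show ?thesis by (simp add: w_def)
      qed
      ultimately show "\<exists>d>0. \<forall>x. norm (x - z) < d \<longrightarrow> norm (Y x 1 - Y z 1 - act (om z (x - z)) (Y z 1)) \<le> \<eta> * norm (x - z)"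
        by blast
    qed
    then show ?thesis by (simp add: om_def add_left scaleR_left)
  qed
  \<comment> \<open>The ray through the origin is a constant path, so the solution along it does not
    move.\<close>
  have "Y 0 1 = Y 0 0"
  proof -
    have "norm (Y 0 1 - Y 0 0) \<le> norm (1 - 0::real) * 0"
    proof (rule vector_differentiable_bound_linearization[of "{0..1}" _ "\<lambda>_. 0" 0 1 0, simplified])
      show "(Y 0 has_vector_derivative 0) (at t within {0..1})" if "0 \<le> t \<and> t \<le> 1" for t
        using Yder[OF S(3), of t] that by (simp add: om_def zero_left)
    qed (auto simp: closed_segment_eq_real_ivl)
    then show ?thesis by simp
  qed
  then have "Y 0 1 = c" using Y0[OF S(3)] by simp
  then show ?thesis by (intro exI[of _ "\<lambda>z. Y z 1"] conjI ballI der)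
qed

end

section \<open>From convex to simply connected domains\<close>

text \<open>The plane is handled by the identity, every other domain by the Riemann map. A
  translation of the image then sends the base point to \<open>0\<close> without disturbing
  convexity, which is the form that integration along rays requires.\<close>

lemma simply_connected_uniformization:
  fixes S :: "complex set"
  assumes S: "open S" "simply_connected S" "z0 \<in> S"
  obtains T f g where "open T" "convex T" "0 \<in> T" "f holomorphic_on S" "g holomorphic_on T" "f z0 = 0"
    "\<And>z. z \<in> S \<Longrightarrow> f z \<in> T \<and> g (f z) = z" "\<And>w. w \<in> T \<Longrightarrow> g w \<in> S \<and> f (g w) = w"
proof -
  have "\<exists>T f g. open T \<and> convex T \<and> f holomorphic_on S \<and> g holomorphic_on T \<and>
      (\<forall>z\<in>S. f z \<in> T \<and> g (f z) = z) \<and> (\<forall>w\<in>T. g w \<in> S \<and> f (g w) = w)"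
  proof (cases "S = UNIV")
    case True
    then show ?thesis
      by (intro exI[of _ UNIV] exI[of _ id]) (auto simp: id_def)
  next
    case False
    then obtain f g where "f holomorphic_on S" "g holomorphic_on ball 0 1"
      "\<forall>z\<in>S. f z \<in> ball 0 1 \<and> g (f z) = z" "\<forall>w\<in>ball 0 1. g w \<in> S \<and> f (g w) = w"
      using Riemann_mapping_theorem[of S] S by blast
    then show ?thesis
      by (intro exI[of _ "ball 0 1"] exI[of _ f] exI[of _ g]) auto
  qed
  then obtain T f g where *: "open T" "convex T" "f holomorphic_on S" "g holomorphic_on T"
      "\<And>z. z \<in> S \<Longrightarrow> f z \<in> T \<and> g (f z) = z" "\<And>w. w \<in> T \<Longrightarrow> g w \<in> S \<and> f (g w) = w"
    by blast
  let ?T = "(\<lambda>w. w + f z0) -` T"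
  have T: "?T = (\<lambda>w. w - f z0) ` T"
    by (auto intro!: image_eqI[of _ _ "_ + f z0"])
  show ?thesis
  proof (rule that[of ?T "\<lambda>z. f z - f z0" "\<lambda>w. g (w + f z0)"])
    show "open ?T" using * by (intro open_vimage) (auto intro!: continuous_intros)
    show "convex ?T" unfolding T using * convex_translation_subtract by blast
    show "0 \<in> ?T" using * S by auto
    show "(\<lambda>z. f z - f z0) holomorphic_on S" using * by (intro holomorphic_intros)
    have "g \<circ> (\<lambda>w. w + f z0) holomorphic_on ?T"
      by (rule holomorphic_on_compose_gen[OF _ *(4)]) (auto intro!: holomorphic_intros)
    then show "(\<lambda>w. g (w + f z0)) holomorphic_on ?T" by (simp add: o_def)
  qed (use * in auto)
qed

context matrix_action
begin

text \<open>The system is pulled back along the inverse uniformizing map, solved on the convex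
  model, and transported back. The Cauchy-Riemann equations express the Jacobian through the real
  and imaginary parts of the complex derivative, which keeps the pulled-back coefficients
  explicit.\<close>

theorem flat_system_solvable:
  fixes P Q :: "real \<times> real \<Rightarrow> 'm"
  assumes D: "open D" "simply_connected D" "x0 \<in> D"
    and P: "\<And>x. x \<in> D \<Longrightarrow> has_partials P (Pu x) (Pv x) x"
    and Q: "\<And>x. x \<in> D \<Longrightarrow> has_partials Q (Qu x) (Qv x) x"
    and cont: "continuous_on D Pu" "continuous_on D Pv" "continuous_on D Qu" "continuous_on D Qv"
    and flat: "\<And>x v. x \<in> D \<Longrightarrow>
      act (Pv x) v + act (P x) (act (Q x) v) = act (Qu x) v + act (Q x) (act (P x) v)"
  shows "\<exists>\<Phi>. \<Phi> x0 = c \<and> (\<forall>x\<in>D. has_partials \<Phi> (act (P x) (\<Phi> x)) (act (Q x) (\<Phi> x)) x)"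
proof -
  define i where "i = (\<lambda>x::real \<times> real. Complex (fst x) (snd x))"
  define j where "j = (\<lambda>z. (Re z, Im z))"
  have ij: "i (j z) = z" "j (i x) = x" for z x by (simp_all add: i_def j_def)
  have cont_ij: "continuous_on X i" "continuous_on Y j" for X Y
    unfolding i_def j_def Complex_eq by (intro continuous_intros)+
  define S where "S = j -` D"
  have "open S" unfolding S_def using cont_ij(2) D(1) by (rule open_vimage[rotated])
  have "homeomorphism D S i j"
    unfolding homeomorphism_def
  proof (intro conjI ballI)
    show "i ` D = S"
    proof (intro equalityI subsetI)
      fix z assume "z \<in> S"
      then show "z \<in> i ` D" by (intro image_eqI[of _ i "j z"]) (simp_all add: S_def ij)
    qed (auto simp: S_def ij)
    show "j ` S = D"
    proof (intro equalityI subsetI)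
      fix x assume "x \<in> D"
      then show "x \<in> j ` S" by (intro image_eqI[of _ j "i x"]) (simp_all add: S_def ij)
    qed (auto simp: S_def)
  qed (simp_all add: ij cont_ij)
  then have "simply_connected S"
    using D(2) homeomorphic_simply_connected unfolding homeomorphic_def by blast
  have "i x0 \<in> S" using D(3) by (simp add: S_def ij)
  obtain T f g where T: "open T" "convex T" "0 \<in> T" and hol: "f holomorphic_on S" "g holomorphic_on T"
    and f0: "f (i x0) = 0" and fg: "\<And>z. z \<in> S \<Longrightarrow> f z \<in> T \<and> g (f z) = z" "\<And>w. w \<in> T \<Longrightarrow> g w \<in> S \<and> f (g w) = w"
    by (rule simply_connected_uniformization[OF \<open>open S\<close> \<open>simply_connected S\<close> \<open>i x0 \<in> S\<close>]) blast
  define G where "G = (\<lambda>w. j (g w))"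
  define g1 where "g1 = deriv g"
  define g2 where "g2 = deriv g1"
  have hol1: "g1 holomorphic_on T" unfolding g1_def using hol(2) T(1) by (rule holomorphic_deriv)
  have hol2: "g2 holomorphic_on T" unfolding g2_def using hol1 T(1) by (rule holomorphic_deriv)
  have g1: "(g has_derivative (\<lambda>h. g1 w * h)) (at w)" if "w \<in> T" for w
    using holomorphic_derivI[OF hol(2) T(1) that] by (simp add: g1_def has_field_derivative_def)
  have g2: "(g1 has_derivative (\<lambda>h. g2 w * h)) (at w)" if "w \<in> T" for w
    using holomorphic_derivI[OF hol1 T(1) that] by (simp add: g2_def has_field_derivative_def)
  have GD: "G w \<in> D" if "w \<in> T" for w using fg(2)[OF that] by (simp add: G_def S_def)
  have Gder: "(G has_derivative (\<lambda>h. (Re (g1 w * h), Im (g1 w * h)))) (at w)" if "w \<in> T" for w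
    unfolding G_def j_def
    by (intro has_derivative_Pair has_derivative_Re has_derivative_Im g1 that)
  have pull: "((\<lambda>w. A (G w)) has_derivative (\<lambda>h. Re (g1 w * h) *\<^sub>R Au (G w) + Im (g1 w * h) *\<^sub>R Av (G w))) (at w)"
    if "w \<in> T" "\<And>x. x \<in> D \<Longrightarrow> has_partials A (Au x) (Av x) x" for A Au Av :: "real \<times> real \<Rightarrow> 'm" and w
    using has_derivative_compose[OF Gder[OF that(1)] that(2)[OF GD[OF that(1)], unfolded has_partials_def]]
    by simp
  let ?c = "\<lambda>w. Re (g1 w)" and ?d = "\<lambda>w. Im (g1 w)" and ?e = "\<lambda>w. Re (g2 w)" and ?f = "\<lambda>w. Im (g2 w)"
  \<comment> \<open>The coefficients of the form \<open>P du + Q dv\<close> pulled back along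
    \<open>G\<close>: its coordinate derivatives are \<open>g1\<close> and \<open>\<i> * g1\<close>,
    read as real pairs. The four definitions after \<open>Q'\<close> are the product-rule
    derivatives.\<close>
  define P' where "P' = (\<lambda>w. ?c w *\<^sub>R P (G w) + ?d w *\<^sub>R Q (G w))"
  define Q' where "Q' = (\<lambda>w. (- ?d w) *\<^sub>R P (G w) + ?c w *\<^sub>R Q (G w))"
  define P'x where "P'x = (\<lambda>w. ?e w *\<^sub>R P (G w) + ?c w *\<^sub>R (?c w *\<^sub>R Pu (G w) + ?d w *\<^sub>R Pv (G w))
    + (?f w *\<^sub>R Q (G w) + ?d w *\<^sub>R (?c w *\<^sub>R Qu (G w) + ?d w *\<^sub>R Qv (G w))))"
  define P'y where "P'y = (\<lambda>w. (- ?f w) *\<^sub>R P (G w) + ?c w *\<^sub>R ((- ?d w) *\<^sub>R Pu (G w) + ?c w *\<^sub>R Pv (G w))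
    + (?e w *\<^sub>R Q (G w) + ?d w *\<^sub>R ((- ?d w) *\<^sub>R Qu (G w) + ?c w *\<^sub>R Qv (G w))))"
  define Q'x where "Q'x = (\<lambda>w. (- ?f w) *\<^sub>R P (G w) - ?d w *\<^sub>R (?c w *\<^sub>R Pu (G w) + ?d w *\<^sub>R Pv (G w))
    + (?e w *\<^sub>R Q (G w) + ?c w *\<^sub>R (?c w *\<^sub>R Qu (G w) + ?d w *\<^sub>R Qv (G w))))"
  define Q'y where "Q'y = (\<lambda>w. (- ?e w) *\<^sub>R P (G w) - ?d w *\<^sub>R ((- ?d w) *\<^sub>R Pu (G w) + ?c w *\<^sub>R Pv (G w))
    + ((- ?f w) *\<^sub>R Q (G w) + ?c w *\<^sub>R ((- ?d w) *\<^sub>R Qu (G w) + ?c w *\<^sub>R Qv (G w))))"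
  have "\<exists>\<Psi>. \<Psi> 0 = c \<and> (\<forall>w\<in>T. (\<Psi> has_derivative (\<lambda>h. Re h *\<^sub>R act (P' w) (\<Psi> w) + Im h *\<^sub>R act (Q' w) (\<Psi> w))) (at w))"
  proof (rule flat_system_solvable_convex[OF T, of P' P'x P'y Q' Q'x Q'y])
    fix w assume w: "w \<in> T"
    note ders = pull[OF w P] pull[OF w Q] has_derivative_Re[OF g2[OF w]] has_derivative_Im[OF g2[OF w]]
    show "(P' has_derivative (\<lambda>h. Re h *\<^sub>R P'x w + Im h *\<^sub>R P'y w)) (at w)"
      unfolding P'_def
      by (rule has_derivative_eq_rhs[OF has_derivative_add[OF has_derivative_scaleR[OF ders(3,1)] has_derivative_scaleR[OF ders(4,2)]]])
        (assumption+, rule ext, simp add: P'x_def P'y_def algebra_simps)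
    show "(Q' has_derivative (\<lambda>h. Re h *\<^sub>R Q'x w + Im h *\<^sub>R Q'y w)) (at w)"
      unfolding Q'_def
      by (rule has_derivative_eq_rhs[OF has_derivative_add[OF has_derivative_scaleR[OF has_derivative_minus[OF ders(4)] ders(1)] has_derivative_scaleR[OF ders(3,2)]]])
        (assumption+, rule ext, simp add: Q'x_def Q'y_def algebra_simps)
    fix v
    \<comment> \<open>The terms with the second derivative \<open>g2\<close> agree on both sides,
      and what remains is the old curvature times the Jacobian determinant
      \<open>|g1|^2\<close>.\<close>
    have "act (P'y w) v + act (P' w) (act (Q' w) v) - (act (Q'x w) v + act (Q' w) (act (P' w) v)) =
      (?c w * ?c w + ?d w * ?d w) *\<^sub>R ((act (Pv (G w)) v + act (P (G w)) (act (Q (G w)) v))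
        - (act (Qu (G w)) v + act (Q (G w)) (act (P (G w)) v)))"
      unfolding P'y_def Q'x_def P'_def Q'_def
      by (simp add: add_left add_right diff_left diff_right minus_left minus_right scaleR_left scaleR_right algebra_simps)
    then show "act (P'y w) v + act (P' w) (act (Q' w) v) = act (Q'x w) v + act (Q' w) (act (P' w) v)"
      using flat[OF GD[OF w]] by simp
  next
    have cg: "continuous_on T g1" "continuous_on T g2" "continuous_on T g"
      using hol1 hol2 hol by (auto intro: holomorphic_on_imp_continuous_on)
    have cG: "continuous_on T G" unfolding G_def by (rule continuous_on_compose2[OF cont_ij(2)[of UNIV] cg(3)]) simp
    have cPQ: "continuous_on D P" "continuous_on D Q"
      by (intro continuous_at_imp_continuous_on ballI has_derivative_continuous[OF P[unfolded has_partials_def]]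
          has_derivative_continuous[OF Q[unfolded has_partials_def]], assumption)+
    note cA = continuous_on_compose2[OF _ cG, of D]
    have sub: "G ` T \<subseteq> D" using GD by auto
    note c = cA[OF cPQ(1) sub] cA[OF cPQ(2) sub] cA[OF cont(1) sub] cA[OF cont(2) sub] cA[OF cont(3) sub] cA[OF cont(4) sub]
    show "continuous_on T P'x" "continuous_on T P'y" "continuous_on T Q'x" "continuous_on T Q'y"
      unfolding P'x_def P'y_def Q'x_def Q'y_def by (intro continuous_intros c cg)+
  qed
  then obtain \<Psi> where \<Psi>0: "\<Psi> 0 = c" and \<Psi>: "\<And>w. w \<in> T \<Longrightarrow>
    (\<Psi> has_derivative (\<lambda>h. Re h *\<^sub>R act (P' w) (\<Psi> w) + Im h *\<^sub>R act (Q' w) (\<Psi> w))) (at w)" by blast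
  have "has_partials (\<lambda>x. \<Psi> (f (i x))) (act (P x) (\<Psi> (f (i x)))) (act (Q x) (\<Psi> (f (i x)))) x" if x: "x \<in> D" for x
  proof -
    have iS: "i x \<in> S" using x by (simp add: S_def ij)
    have fT: "f (i x) \<in> T" "g (f (i x)) = i x" using fg(1)[OF iS] by auto
    let ?w = "f (i x)"
    let ?f1 = "deriv f (i x)"
    have fder: "(f has_derivative (\<lambda>h. ?f1 * h)) (at (i x))"
      using holomorphic_derivI[OF hol(1) \<open>open S\<close> iS] by (simp add: has_field_derivative_def)
    have ider: "(i has_derivative i) (at x)"
      unfolding i_def Complex_eq by (auto intro!: derivative_eq_intros simp: fun_eq_iff)
    have comp: "((\<lambda>x. \<Psi> (f (i x))) has_derivative
      (\<lambda>h. Re (?f1 * i h) *\<^sub>R act (P' ?w) (\<Psi> ?w) + Im (?f1 * i h) *\<^sub>R act (Q' ?w) (\<Psi> ?w))) (at x)"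
      using has_derivative_compose[OF has_derivative_compose[OF ider fder] \<Psi>[OF fT(1)]] .
    \<comment> \<open>Differentiating \<open>g (f z) = z\<close> shows the two complex derivatives
      to be reciprocal, so pulling back by \<open>f\<close> restores \<open>P\<close> and
      \<open>Q\<close>.\<close>
    have "((\<lambda>z. g (f z)) has_derivative (\<lambda>h. g1 ?w * (?f1 * h))) (at (i x))"
      by (rule has_derivative_compose[OF fder g1[OF fT(1)]])
    moreover have "((\<lambda>z. g (f z)) has_derivative (\<lambda>h. h)) (at (i x))"
      by (rule has_derivative_transform_within_open[OF has_derivative_ident \<open>open S\<close> iS]) (simp add: fg)
    ultimately have "(\<lambda>h. g1 ?w * (?f1 * h)) = (\<lambda>h. h)" by (rule has_derivative_unique)
    from fun_cong[OF this, of 1] have one: "g1 ?w * ?f1 = 1" by simp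
    have Gw: "G ?w = x" by (simp add: G_def fT ij)
    have lin: "Re k *\<^sub>R act (P' ?w) v + Im k *\<^sub>R act (Q' ?w) v
      = Re (g1 ?w * k) *\<^sub>R act (P x) v + Im (g1 ?w * k) *\<^sub>R act (Q x) v" for k v
      unfolding P'_def Q'_def Gw by (simp add: add_left diff_left scaleR_left minus_left algebra_simps)
    have one': "g1 ?w * (?f1 * h) = h" for h by (simp add: one flip: mult.assoc)
    show ?thesis using comp unfolding lin one' by (simp add: has_partials_def i_def)
  qed
  then show ?thesis using \<Psi>0 f0 by (intro exI[of _ "\<lambda>x. \<Psi> (f (i x))"]) auto
qed

end

section \<open>Frames in five dimensions\<close>

lemma exhaust_5: "x = 0 \<or> x = 1 \<or> x = 2 \<or> x = 3 \<or> x = 4" for x :: 5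
proof (induct x)
  case (of_int z)
  then have "0 \<le> z" and "z < 5" by simp_all
  then have "z = 0 \<or> z = 1 \<or> z = 2 \<or> z = 3 \<or> z = 4" by arith
  then show ?case by auto
qed

lemma forall_5: "(\<forall>i::5. P i) \<longleftrightarrow> P 0 \<and> P 1 \<and> P 2 \<and> P 3 \<and> P 4"
  by (metis exhaust_5)

lemma UNIV_5: "UNIV = {0, 1, 2, 3, 4::5}"
  using exhaust_5 by auto

lemma sum_5: "sum f (UNIV::5 set) = f 0 + f 1 + f 2 + f 3 + f 4"
  unfolding UNIV_5 by (simp add: add.assoc)

definition vec5 :: "'a \<Rightarrow> 'a \<Rightarrow> 'a \<Rightarrow> 'a \<Rightarrow> 'a \<Rightarrow> 'a^5" where
  "vec5 a b c d e = (\<chi> i. if i = 0 then a else if i = 1 then b else if i = 2 then c else if i = 3 then d else e)"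

lemma vec5_nth [simp]:
  "vec5 a b c d e $ 0 = a" "vec5 a b c d e $ 1 = b" "vec5 a b c d e $ 2 = c" "vec5 a b c d e $ 3 = d" "vec5 a b c d e $ 4 = e"
  by (simp_all add: vec5_def)

lemma vec5_eq_iff: "v = w \<longleftrightarrow> v $ 0 = w $ 0 \<and> v $ 1 = w $ 1 \<and> v $ 2 = w $ 2 \<and> v $ 3 = w $ 3 \<and> v $ 4 = w $ (4::5)"
  by (simp add: vec_eq_iff forall_5)

lemma frame_mat_eq_vec5: "frame_mat F N1 N2 x = vec5 (F x) (pu F x) (pv F x) (N1 x) (N2 x)"
  by (simp add: frame_mat_def vec5_def)

lemma bounded_linear_axis_vec: "bounded_linear (\<lambda>a::'a::euclidean_space. (\<chi> j. if j = i then a else 0) :: 'a^'n)"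
  by (intro linear_conv_bounded_linear[THEN iffD1] linearI) (auto simp: vec_eq_iff)

text \<open>A sum of linear images of the entries, so the rules for sums and bounded linear maps
  cover derivatives and smoothness of assembled rows and matrices.\<close>

lemma vec5_eq_sum:
  "vec5 a b c d (e::'a::euclidean_space) = (\<chi> j. if j = 0 then a else 0) + (\<chi> j. if j = 1 then b else 0) + (\<chi> j. if j = 2 then c else 0)
    + (\<chi> j. if j = 3 then d else 0) + (\<chi> j. if j = 4 then e else 0)"
  by (simp add: vec5_eq_iff)

lemma has_partials_vec5:
  fixes a b c d e :: "real \<times> real \<Rightarrow> 'a::euclidean_space"
  assumes "has_partials a au av x" "has_partials b bu bv x" "has_partials c cu cv x"
    "has_partials d du dv x" "has_partials e eu ev x"
  shows "has_partials (\<lambda>x. vec5 (a x) (b x) (c x) (d x) (e x)) (vec5 au bu cu du eu) (vec5 av bv cv dv ev) x"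
  unfolding vec5_eq_sum
  by (intro has_partials_add has_partials_linear[OF bounded_linear_axis_vec] assms)

lemma smooth_on_vec5:
  fixes a b c d e :: "real \<times> real \<Rightarrow> 'a::euclidean_space"
  assumes "open U" "smooth_on U a" "smooth_on U b" "smooth_on U c" "smooth_on U d" "smooth_on U e"
  shows "smooth_on U (\<lambda>x. vec5 (a x) (b x) (c x) (d x) (e x))"
  unfolding vec5_eq_sum
  by (intro smooth_on_add smooth_on_linear[OF _ bounded_linear_axis_vec] assms)

lemma bounded_bilinear_matrix_mult: "bounded_bilinear ((**) :: real^'m^'n \<Rightarrow> real^'k^'m \<Rightarrow> real^'k^'n)"
  by (intro bilinear_conv_bounded_bilinear[THEN iffD1])
    (auto simp: bilinear_def intro!: linearI
        simp: matrix_matrix_mult_def vec_eq_iff sum_distrib_left sum_distrib_right sum.distrib algebra_simps)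

section \<open>The indefinite inner product and orthogonal frames\<close>

lemma lor_commute: "lor L0 x y = lor L0 y x"
  by (simp add: lor_def mult_ac)

lemma bounded_bilinear_lor: "bounded_bilinear (lor L0)"
  by (intro bilinear_conv_bounded_bilinear[THEN iffD1])
    (auto simp: bilinear_def lor_def intro!: linearI simp: sum_distrib_left sum.distrib algebra_simps)

interpretation lor: bounded_bilinear "lor L0" for L0
  by (rule bounded_bilinear_lor)

interpretation mmult: matrix_action "(**) :: real^5^5 \<Rightarrow> real^5^5 \<Rightarrow> real^5^5"
  unfolding matrix_action_def by (rule bounded_bilinear_matrix_mult)

text \<open>Definiteness is replaced by nonzero squared lengths: the transpose of \<Phi>, with
  columns divided by \<open>h\<close> and rows multiplied by the signs of the form, is a right
  inverse, and for square matrices also a left inverse. The expansion is the latter identity applied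
  to \<open>v\<close>.\<close>

lemma orthogonal_frame_expansion:
  fixes \<Phi> :: "real^5^5"
  assumes orth: "\<And>i j. lor L0 (\<Phi> $ i) (\<Phi> $ j) = (if i = j then h i else 0)" and h: "\<And>i. h i \<noteq> 0"
  shows "v = (\<Sum>j\<in>UNIV. (lor L0 v (\<Phi> $ j) / h j) *\<^sub>R \<Phi> $ j)"
    and "\<exists>\<Psi>. \<Phi> ** \<Psi> = mat 1 \<and> \<Psi> ** \<Phi> = mat 1"
proof -
  define \<Psi> :: "real^5^5" where "\<Psi> = (\<chi> k j. gsign L0 k * \<Phi> $ j $ k / h j)"
  have "(\<Phi> ** \<Psi>) $ i $ j = (mat 1 :: real^5^5) $ i $ j" for i j
  proof -
    have "(\<Phi> ** \<Psi>) $ i $ j = lor L0 (\<Phi> $ i) (\<Phi> $ j) / h j"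
      unfolding matrix_matrix_mult_def \<Psi>_def lor_def by (simp add: sum_divide_distrib mult_ac)
    then show ?thesis using h by (simp add: orth mat_def)
  qed
  then have 1: "\<Phi> ** \<Psi> = mat 1" by (simp add: vec_eq_iff)
  then have 2: "\<Psi> ** \<Phi> = mat 1" by (simp add: matrix_left_right_inverse)
  show "\<exists>\<Psi>. \<Phi> ** \<Psi> = mat 1 \<and> \<Psi> ** \<Phi> = mat 1" using 1 2 by blast
  have "v = v v* (\<Psi> ** \<Phi>)" unfolding 2 by simp
  also have "\<dots> = (v v* \<Psi>) v* \<Phi>" by (simp add: vector_matrix_mul_assoc)
  also have "v v* \<Psi> = (\<chi> j. lor L0 v (\<Phi> $ j) / h j)"
    unfolding vector_matrix_mult_def \<Psi>_def lor_def by (simp add: vec_eq_iff sum_divide_distrib mult_ac)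
  finally show "v = (\<Sum>j\<in>UNIV. (lor L0 v (\<Phi> $ j) / h j) *\<^sub>R \<Phi> $ j)"
    by (simp add: vec_eq_iff vector_matrix_mult_def mult_ac)
qed

text \<open>Coefficients of the Gauss--Weingarten equations for the frame \<open>F, T\<^sub>1, T\<^sub>2, N\<^sub>1, N\<^sub>2\<close>, with
  \<open>f = L\<^sub>0 e\<^sup>2\<^sup>\<lambda>\<close>. The parameter \<open>k\<close> is \<open>1\<close> for the matrices themselves and \<open>0\<close> for their derivatives.\<close>

definition conn_u :: "real \<Rightarrow> real \<Rightarrow> real \<Rightarrow> real \<Rightarrow> real \<Rightarrow> real \<Rightarrow> real \<Rightarrow> real \<Rightarrow> real \<Rightarrow> real^5^5" where
  "conn_u k f lu lv a1 a2 b1 b2 m1 = vec5 (vec5 0 k 0 0 0) (vec5 (- f) lu (- lv) a1 b1) (vec5 0 lv lu a2 b2)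
    (vec5 0 (- a1) (- a2) lu m1) (vec5 0 b1 b2 m1 lu)"

definition conn_v :: "real \<Rightarrow> real \<Rightarrow> real \<Rightarrow> real \<Rightarrow> real \<Rightarrow> real \<Rightarrow> real \<Rightarrow> real \<Rightarrow> real \<Rightarrow> real^5^5" where
  "conn_v k f lu lv a2 a3 b2 b3 m2 = vec5 (vec5 0 0 k 0 0) (vec5 0 lv lu a2 b2) (vec5 (- f) (- lu) lv a3 b3)
    (vec5 0 (- a2) (- a3) lv m2) (vec5 0 b2 b3 m2 lv)"

text \<open>Pure algebra: a trailing \<open>u\<close> or \<open>v\<close> marks a variable that will
  receive the corresponding derivative. On the right stand the derivative of \<open>f\<close>, the
  symmetry of the second derivatives of \<lambda>, the Gauss equation, the Ricci equation, and four
  Codazzi equations.\<close>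

lemma conn_flat_iff:
  "conn_u 0 fv luv lvv a1v a2v b1v b2v m1v + conn_u 1 f lu lv a1 a2 b1 b2 m1 ** conn_v 1 f lu lv a2 a3 b2 b3 m2
    = conn_v 0 fu luu lvu a2u a3u b2u b3u m2u + conn_v 1 f lu lv a2 a3 b2 b3 m2 ** conn_u 1 f lu lv a1 a2 b1 b2 m1
  \<longleftrightarrow> fu = 2 * f * lu \<and> fv = 2 * f * lv \<and> luv = lvu \<and>
    luu + lvv + f = a2 * a2 - a1 * a3 + b1 * b3 - b2 * b2 \<and>
    m1v - m2u = a1 * b2 + a2 * b3 - a2 * b1 - a3 * b2 \<and>
    a1v - a2u = lv * a3 + lu * a2 - b1 * m2 + b2 * m1 \<and>
    b1v - b2u = lv * b3 + lu * b2 - a1 * m2 + a2 * m1 \<and>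
    a3u - a2v = lu * a1 + lv * a2 - b3 * m1 + b2 * m2 \<and>
    b3u - b2v = lu * b1 + lv * b2 - a3 * m1 + a2 * m2"
  unfolding vec5_eq_iff conn_u_def conn_v_def
  by (simp add: matrix_matrix_mult_def sum_5) (auto simp: algebra_simps)

lemma has_partials_conn_u:
  assumes "has_partials f fu fv x" "has_partials lu luu luv x" "has_partials lv lvu lvv x"
    "has_partials a1 a1u a1v x" "has_partials a2 a2u a2v x" "has_partials b1 b1u b1v x"
    "has_partials b2 b2u b2v x" "has_partials m1 m1u m1v x"
  shows "has_partials (\<lambda>x. conn_u 1 (f x) (lu x) (lv x) (a1 x) (a2 x) (b1 x) (b2 x) (m1 x))
    (conn_u 0 fu luu lvu a1u a2u b1u b2u m1u) (conn_u 0 fv luv lvv a1v a2v b1v b2v m1v) x"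
  unfolding conn_u_def
  by (intro has_partials_vec5 has_partials_const assms
      has_partials_linear[OF bounded_linear_minus[OF bounded_linear_ident]])

lemma has_partials_conn_v:
  assumes "has_partials f fu fv x" "has_partials lu luu luv x" "has_partials lv lvu lvv x"
    "has_partials a2 a2u a2v x" "has_partials a3 a3u a3v x" "has_partials b2 b2u b2v x"
    "has_partials b3 b3u b3v x" "has_partials m2 m2u m2v x"
  shows "has_partials (\<lambda>x. conn_v 1 (f x) (lu x) (lv x) (a2 x) (a3 x) (b2 x) (b3 x) (m2 x))
    (conn_v 0 fu luu lvu a2u a3u b2u b3u m2u) (conn_v 0 fv luv lvv a2v a3v b2v b3v m2v) x"
  unfolding conn_v_def
  by (intro has_partials_vec5 has_partials_const assms
      has_partials_linear[OF bounded_linear_minus[OF bounded_linear_ident]])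

lemma smooth_on_conn:
  assumes "open U" "smooth_on U f" "smooth_on U lu" "smooth_on U lv" "smooth_on U a" "smooth_on U b"
    "smooth_on U c" "smooth_on U d" "smooth_on U e"
  shows "smooth_on U (\<lambda>x. conn_u k (f x) (lu x) (lv x) (a x) (b x) (c x) (d x) (e x))"
    and "smooth_on U (\<lambda>x. conn_v k (f x) (lu x) (lv x) (a x) (b x) (c x) (d x) (e x))"
  unfolding conn_u_def conn_v_def
  by (intro smooth_on_vec5 smooth_on_const smooth_on_minus assms)+

section \<open>The Gauss--Weingarten equations\<close>

lemma row_matrix_mult5:
  fixes A B :: "real^5^5"
  shows "(A ** B) $ i = A$i$0 *\<^sub>R B$0 + A$i$1 *\<^sub>R B$1 + A$i$2 *\<^sub>R B$2 + A$i$3 *\<^sub>R B$3 + A$i$4 *\<^sub>R B$4"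
  by (simp add: vec_eq_iff matrix_matrix_mult_def sum_5)

lemma has_partials_unique:
  assumes "has_partials f a b x" "has_partials f c d x"
  shows "a = c \<and> b = d"
  using assms[THEN has_partials_pu] assms[THEN has_partials_pv] by simp

text \<open>The product rule applied to a prescribed inner product. Differentiating the
  orthogonality and length conditions in this way yields most inner products of the derivatives of
  the frame.\<close>

lemma lor_partials:
  assumes "open U" "smooth_on U G" "smooth_on U H" "x \<in> U" "\<And>y. y \<in> U \<Longrightarrow> lor L0 (G y) (H y) = k y"
    and "has_partials k ku kv x"
  shows "lor L0 (pu G x) (H x) + lor L0 (G x) (pu H x) = ku"
    and "lor L0 (pv G x) (H x) + lor L0 (G x) (pv H x) = kv"
proof -
  have "has_partials (\<lambda>y. lor L0 (G y) (H y)) (lor L0 (pu G x) (H x) + lor L0 (G x) (pu H x))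
      (lor L0 (pv G x) (H x) + lor L0 (G x) (pv H x)) x"
    by (intro has_partials_bilinear[OF bounded_bilinear_lor] smooth_on_partials[OF assms(1)] assms)
  from has_partials_cong[OF this assms(1,4,5)] have "has_partials k (lor L0 (pu G x) (H x) + lor L0 (G x) (pu H x))
      (lor L0 (pv G x) (H x) + lor L0 (G x) (pv H x)) x" .
  from has_partials_unique[OF this assms(6)]
  show "lor L0 (pu G x) (H x) + lor L0 (G x) (pu H x) = ku"
    "lor L0 (pv G x) (H x) + lor L0 (G x) (pv H x) = kv" by simp_all
qed

locale framed_surface =
  fixes L0 :: real and U :: "(real \<times> real) set" and F N1 N2 :: "real \<times> real \<Rightarrow> real^5" and ori :: real
  assumes L0: "L0 \<noteq> 0" and U: "open U" and conf: "conf_imm L0 U F" and adapted: "adapted_frame L0 U F N1 N2 ori"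
begin

abbreviation "m \<equiv> metric L0 F"
abbreviation "l \<equiv> lam L0 F"
abbreviation "lu \<equiv> pu (lam L0 F)"
abbreviation "lv \<equiv> pv (lam L0 F)"
abbreviation "T1 \<equiv> pu F"
abbreviation "T2 \<equiv> pv F"
abbreviation "a1 \<equiv> alpha1 L0 F N1"
abbreviation "a2 \<equiv> alpha2 L0 F N1"
abbreviation "a3 \<equiv> alpha3 L0 F N1"
abbreviation "b1 \<equiv> beta1 L0 F N2"
abbreviation "b2 \<equiv> beta2 L0 F N2"
abbreviation "b3 \<equiv> beta3 L0 F N2"
abbreviation "m1 \<equiv> mu1 L0 F N1 N2"
abbreviation "m2 \<equiv> mu2 L0 F N1 N2"
abbreviation "frame \<equiv> frame_mat F N1 N2"
abbreviation "con_u \<equiv> (\<lambda>x. conn_u 1 (L0 * m x) (lu x) (lv x) (a1 x) (a2 x) (b1 x) (b2 x) (m1 x))"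
abbreviation "con_v \<equiv> (\<lambda>x. conn_v 1 (L0 * m x) (lu x) (lv x) (a2 x) (a3 x) (b2 x) (b3 x) (m2 x))"

lemma smooth_F: "smooth_on U F" and smooth_N1: "smooth_on U N1" and smooth_N2: "smooth_on U N2"
  using conf adapted by (simp_all add: conf_imm_def adapted_frame_def)

lemma smooth_T: "smooth_on U T1" "smooth_on U T2"
  by (intro smooth_on_pu smooth_on_pv U smooth_F)+

lemma smooth_metric: "smooth_on U m"
proof -
  have "m = (\<lambda>x. lor L0 (T1 x) (T1 x))" by (simp add: fun_eq_iff metric_def)
  then show ?thesis using smooth_on_bilinear[OF U bounded_bilinear_lor smooth_T(1) smooth_T(1)] by simp
qed

lemma metric_pos: "x \<in> U \<Longrightarrow> m x > 0"
  using conf by (simp add: conf_imm_def)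

lemma lam_eq: "lam L0 F = (\<lambda>x. (1 / 2) * ln (m x))"
  by (simp add: fun_eq_iff lam_def)

lemma smooth_lam: "smooth_on U l"
  unfolding lam_eq by (intro smooth_on_mult smooth_on_const smooth_on_ln U smooth_metric metric_pos)

lemma exp_lam: "x \<in> U \<Longrightarrow> exp (2 * l x) = m x"
  using metric_pos by (simp add: lam_def)

lemma metric_partials:
  assumes "x \<in> U"
  shows "has_partials m (2 * m x * lu x) (2 * m x * lv x) x"
proof -
  have "has_partials (\<lambda>y. exp (2 * l y)) (2 * exp (2 * l x) * lu x) (2 * exp (2 * l x) * lv x) x"
    by (rule has_partials_field[OF smooth_on_partials[OF U smooth_lam assms]])
      (auto intro!: derivative_eq_intros)
  from has_partials_cong[OF this U assms exp_lam] show ?thesis by (simp add: exp_lam[OF assms])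
qed

lemma normal:
  assumes "x \<in> U"
  shows "lor L0 (F x) (F x) = 1 / L0" "lor L0 (T1 x) (T1 x) = m x" "lor L0 (T2 x) (T2 x) = m x"
    "lor L0 (T1 x) (T2 x) = 0" "lor L0 (F x) (N1 x) = 0" "lor L0 (F x) (N2 x) = 0"
    "lor L0 (T1 x) (N1 x) = 0" "lor L0 (T2 x) (N1 x) = 0" "lor L0 (T1 x) (N2 x) = 0" "lor L0 (T2 x) (N2 x) = 0"
    "lor L0 (N1 x) (N1 x) = m x" "lor L0 (N2 x) (N2 x) = - m x" "lor L0 (N1 x) (N2 x) = 0"
  using conf adapted assms
  by (simp_all add: conf_imm_def adapted_frame_def lor_commute) (simp_all add: metric_def)

lemma tangent_F:
  assumes "x \<in> U" shows "lor L0 (F x) (T1 x) = 0" "lor L0 (F x) (T2 x) = 0"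
  using lor_partials[OF U smooth_F smooth_F assms normal(1) has_partials_const]
  by (simp_all add: lor_commute)

lemmas inner_frame = normal tangent_F

lemma inner_frame':
  assumes "x \<in> U"
  shows "lor L0 (T2 x) (T1 x) = 0" "lor L0 (N1 x) (F x) = 0" "lor L0 (N2 x) (F x) = 0"
    "lor L0 (N1 x) (T1 x) = 0" "lor L0 (N1 x) (T2 x) = 0" "lor L0 (N2 x) (T1 x) = 0" "lor L0 (N2 x) (T2 x) = 0"
    "lor L0 (N2 x) (N1 x) = 0" "lor L0 (T1 x) (F x) = 0" "lor L0 (T2 x) (F x) = 0"
  using inner_frame[OF assms] by (simp_all add: lor_commute)

text \<open>The squared lengths of the frame rows; the last one is negative because
  \<open>N2\<close> is timelike.\<close>

definition norms :: "real \<times> real \<Rightarrow> 5 \<Rightarrow> real" where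
  "norms x i = vec5 (1 / L0) (m x) (m x) (m x) (- m x) $ i"

lemma norms_simps [simp]: "norms x 0 = 1 / L0" "norms x 1 = m x" "norms x 2 = m x" "norms x 3 = m x" "norms x 4 = - m x"
  by (simp_all add: norms_def)

lemma norms_nonzero: "x \<in> U \<Longrightarrow> norms x i \<noteq> 0"
  using exhaust_5[of i] metric_pos[of x] L0 by auto

lemma gram_frame:
  assumes "x \<in> U"
  shows "lor L0 (frame x $ i) (frame x $ j) = (if i = j then norms x i else 0)"
proof -
  have "\<forall>i j. lor L0 (frame x $ i) (frame x $ j) = (if i = j then norms x i else 0)"
    unfolding forall_5 frame_mat_eq_vec5 by (simp add: inner_frame[OF assms] inner_frame'[OF assms])
  then show ?thesis by blast
qed

lemma frame_inverse:
  assumes "x \<in> U"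
  shows "\<exists>G. frame x ** G = mat 1 \<and> G ** frame x = mat 1"
  by (rule orthogonal_frame_expansion(2)[OF gram_frame[OF assms] norms_nonzero[OF assms]])

lemma frame_expand:
  assumes "x \<in> U"
  shows "v = (L0 * lor L0 v (F x)) *\<^sub>R F x + (lor L0 v (T1 x) / m x) *\<^sub>R T1 x + (lor L0 v (T2 x) / m x) *\<^sub>R T2 x
    + (lor L0 v (N1 x) / m x) *\<^sub>R N1 x + (- lor L0 v (N2 x) / m x) *\<^sub>R N2 x"
  using orthogonal_frame_expansion(1)[OF gram_frame[OF assms] norms_nonzero[OF assms], of v]
  by (simp add: sum_5 frame_mat_eq_vec5 mult.commute)

lemma mixed_T: "x \<in> U \<Longrightarrow> pv T1 x = pu T2 x"
  by (rule mixed_partials_eq[OF U smooth_F])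

text \<open>The components along \<open>F\<close>, \<open>T1\<close>, \<open>T2\<close> follow from
  the derivatives of the constraints, as for Christoffel symbols of a conformal metric with
  \<open>m = exp (2 * l)\<close>. The normal components unfold the definitions, the minus sign
  belonging to the timelike \<open>N2\<close>.\<close>

lemma inner_second:
  assumes x: "x \<in> U"
  shows "lor L0 (pu T1 x) (F x) = - m x" "lor L0 (pv T1 x) (F x) = 0" "lor L0 (pv T2 x) (F x) = - m x"
    "lor L0 (pu T1 x) (T1 x) = m x * lu x" "lor L0 (pv T1 x) (T1 x) = m x * lv x" "lor L0 (pv T2 x) (T1 x) = - m x * lu x"
    "lor L0 (pu T1 x) (T2 x) = - m x * lv x" "lor L0 (pv T1 x) (T2 x) = m x * lu x" "lor L0 (pv T2 x) (T2 x) = m x * lv x"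
    "lor L0 (pu T1 x) (N1 x) = m x * a1 x" "lor L0 (pv T1 x) (N1 x) = m x * a2 x" "lor L0 (pv T2 x) (N1 x) = m x * a3 x"
    "lor L0 (pu T1 x) (N2 x) = - m x * b1 x" "lor L0 (pv T1 x) (N2 x) = - m x * b2 x" "lor L0 (pv T2 x) (N2 x) = - m x * b3 x"
proof -
  note zero = has_partials_const[of 0]
  show "lor L0 (pu T1 x) (F x) = - m x" "lor L0 (pv T1 x) (F x) = 0"
    using lor_partials[OF U smooth_T(1) smooth_F x inner_frame'(9) zero] inner_frame[OF x] by simp_all
  show "lor L0 (pv T2 x) (F x) = - m x"
    using lor_partials(2)[OF U smooth_T(2) smooth_F x inner_frame'(10) zero] inner_frame[OF x] by simp
  show uu: "lor L0 (pu T1 x) (T1 x) = m x * lu x" and vu: "lor L0 (pv T1 x) (T1 x) = m x * lv x"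
    using lor_partials[OF U smooth_T(1) smooth_T(1) x normal(2) metric_partials[OF x]]
    by (simp_all add: lor_commute)
  show vv: "lor L0 (pv T2 x) (T2 x) = m x * lv x" and uv: "lor L0 (pv T1 x) (T2 x) = m x * lu x"
    using lor_partials[OF U smooth_T(2) smooth_T(2) x normal(3) metric_partials[OF x]]
    by (simp_all add: lor_commute mixed_T[OF x])
  show "lor L0 (pu T1 x) (T2 x) = - m x * lv x" "lor L0 (pv T2 x) (T1 x) = - m x * lu x"
    using lor_partials[OF U smooth_T(1) smooth_T(2) x normal(4) zero] vu uv
    by (simp_all add: lor_commute mixed_T[OF x])
qed (use metric_pos[OF x] in \<open>simp_all add: alpha1_def alpha2_def alpha3_def beta1_def beta2_def beta3_def sff_N1_def sff_N2_def\<close>)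

text \<open>Orthogonality moves the derivative from the normal fields to the tangent fields with a
  change of sign. As \<open>N2\<close> has negative square, the coefficients \<alpha> appear with a
  minus sign and the coefficients \<beta> with a plus sign.\<close>

lemma inner_normal_derivs:
  assumes x: "x \<in> U"
  shows "lor L0 (pu N1 x) (F x) = 0" "lor L0 (pv N1 x) (F x) = 0" "lor L0 (pu N2 x) (F x) = 0" "lor L0 (pv N2 x) (F x) = 0"
    "lor L0 (pu N1 x) (T1 x) = - m x * a1 x" "lor L0 (pv N1 x) (T1 x) = - m x * a2 x"
    "lor L0 (pu N1 x) (T2 x) = - m x * a2 x" "lor L0 (pv N1 x) (T2 x) = - m x * a3 x"
    "lor L0 (pu N2 x) (T1 x) = m x * b1 x" "lor L0 (pv N2 x) (T1 x) = m x * b2 x"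
    "lor L0 (pu N2 x) (T2 x) = m x * b2 x" "lor L0 (pv N2 x) (T2 x) = m x * b3 x"
    "lor L0 (pu N1 x) (N1 x) = m x * lu x" "lor L0 (pv N1 x) (N1 x) = m x * lv x"
    "lor L0 (pu N2 x) (N2 x) = - m x * lu x" "lor L0 (pv N2 x) (N2 x) = - m x * lv x"
    "lor L0 (pu N1 x) (N2 x) = - m x * m1 x" "lor L0 (pv N1 x) (N2 x) = - m x * m2 x"
    "lor L0 (pu N2 x) (N1 x) = m x * m1 x" "lor L0 (pv N2 x) (N1 x) = m x * m2 x"
proof -
  note zero = has_partials_const[of 0]
  show "lor L0 (pu N1 x) (F x) = 0" "lor L0 (pv N1 x) (F x) = 0"
    using lor_partials[OF U smooth_N1 smooth_F x inner_frame'(2) zero] inner_frame'[OF x] by simp_all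
  show "lor L0 (pu N2 x) (F x) = 0" "lor L0 (pv N2 x) (F x) = 0"
    using lor_partials[OF U smooth_N2 smooth_F x inner_frame'(3) zero] inner_frame'[OF x] by simp_all
  show "lor L0 (pu N1 x) (T1 x) = - m x * a1 x" "lor L0 (pv N1 x) (T1 x) = - m x * a2 x"
    using lor_partials[OF U smooth_N1 smooth_T(1) x inner_frame'(4) zero] inner_second[OF x]
    by (simp_all add: lor_commute)
  show "lor L0 (pu N1 x) (T2 x) = - m x * a2 x" "lor L0 (pv N1 x) (T2 x) = - m x * a3 x"
    using lor_partials[OF U smooth_N1 smooth_T(2) x inner_frame'(5) zero] inner_second[OF x]
    by (simp_all add: lor_commute mixed_T[OF x, symmetric])
  show "lor L0 (pu N2 x) (T1 x) = m x * b1 x" "lor L0 (pv N2 x) (T1 x) = m x * b2 x"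
    using lor_partials[OF U smooth_N2 smooth_T(1) x inner_frame'(6) zero] inner_second[OF x]
    by (simp_all add: lor_commute)
  show "lor L0 (pu N2 x) (T2 x) = m x * b2 x" "lor L0 (pv N2 x) (T2 x) = m x * b3 x"
    using lor_partials[OF U smooth_N2 smooth_T(2) x inner_frame'(7) zero] inner_second[OF x]
    by (simp_all add: lor_commute mixed_T[OF x, symmetric])
  show "lor L0 (pu N1 x) (N1 x) = m x * lu x" "lor L0 (pv N1 x) (N1 x) = m x * lv x"
    using lor_partials[OF U smooth_N1 smooth_N1 x normal(11) metric_partials[OF x]]
    by (simp_all add: lor_commute)
  show "lor L0 (pu N2 x) (N2 x) = - m x * lu x" "lor L0 (pv N2 x) (N2 x) = - m x * lv x"
    using lor_partials[OF U smooth_N2 smooth_N2 x normal(12) has_partials_linear[OF bounded_linear_minus[OF bounded_linear_ident] metric_partials[OF x]]]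
    by (simp_all add: lor_commute)
  show mu: "lor L0 (pu N1 x) (N2 x) = - m x * m1 x" "lor L0 (pv N1 x) (N2 x) = - m x * m2 x"
    using metric_pos[OF x] by (simp_all add: mu1_def mu2_def sff_N2_def)
  show "lor L0 (pu N2 x) (N1 x) = m x * m1 x" "lor L0 (pv N2 x) (N1 x) = m x * m2 x"
    using lor_partials[OF U smooth_N1 smooth_N2 x normal(13) zero] mu
    by (simp_all add: lor_commute)
qed

lemma gauss_weingarten:
  assumes x: "x \<in> U"
  shows "pu T1 x = (- (L0 * m x)) *\<^sub>R F x + lu x *\<^sub>R T1 x + (- lv x) *\<^sub>R T2 x + a1 x *\<^sub>R N1 x + b1 x *\<^sub>R N2 x"
    "pv T1 x = lv x *\<^sub>R T1 x + lu x *\<^sub>R T2 x + a2 x *\<^sub>R N1 x + b2 x *\<^sub>R N2 x"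
    "pu T2 x = lv x *\<^sub>R T1 x + lu x *\<^sub>R T2 x + a2 x *\<^sub>R N1 x + b2 x *\<^sub>R N2 x"
    "pv T2 x = (- (L0 * m x)) *\<^sub>R F x + (- lu x) *\<^sub>R T1 x + lv x *\<^sub>R T2 x + a3 x *\<^sub>R N1 x + b3 x *\<^sub>R N2 x"
    "pu N1 x = (- a1 x) *\<^sub>R T1 x + (- a2 x) *\<^sub>R T2 x + lu x *\<^sub>R N1 x + m1 x *\<^sub>R N2 x"
    "pv N1 x = (- a2 x) *\<^sub>R T1 x + (- a3 x) *\<^sub>R T2 x + lv x *\<^sub>R N1 x + m2 x *\<^sub>R N2 x"
    "pu N2 x = b1 x *\<^sub>R T1 x + b2 x *\<^sub>R T2 x + m1 x *\<^sub>R N1 x + lu x *\<^sub>R N2 x"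
    "pv N2 x = b2 x *\<^sub>R T1 x + b3 x *\<^sub>R T2 x + m2 x *\<^sub>R N1 x + lv x *\<^sub>R N2 x"
proof -
  have "m x \<noteq> 0" using metric_pos[OF x] by simp
  note e = inner_second[OF x] inner_normal_derivs[OF x] \<open>m x \<noteq> 0\<close>
  show "pu T1 x = (- (L0 * m x)) *\<^sub>R F x + lu x *\<^sub>R T1 x + (- lv x) *\<^sub>R T2 x + a1 x *\<^sub>R N1 x + b1 x *\<^sub>R N2 x"
    by (rule trans[OF frame_expand[OF x]]) (simp add: e)
  show T12: "pv T1 x = lv x *\<^sub>R T1 x + lu x *\<^sub>R T2 x + a2 x *\<^sub>R N1 x + b2 x *\<^sub>R N2 x"
    by (rule trans[OF frame_expand[OF x]]) (simp add: e)
  show "pu T2 x = lv x *\<^sub>R T1 x + lu x *\<^sub>R T2 x + a2 x *\<^sub>R N1 x + b2 x *\<^sub>R N2 x"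
    using T12 by (simp add: mixed_T[OF x])
  show "pv T2 x = (- (L0 * m x)) *\<^sub>R F x + (- lu x) *\<^sub>R T1 x + lv x *\<^sub>R T2 x + a3 x *\<^sub>R N1 x + b3 x *\<^sub>R N2 x"
    by (rule trans[OF frame_expand[OF x]]) (simp add: e)
  show "pu N1 x = (- a1 x) *\<^sub>R T1 x + (- a2 x) *\<^sub>R T2 x + lu x *\<^sub>R N1 x + m1 x *\<^sub>R N2 x"
    by (rule trans[OF frame_expand[OF x]]) (simp add: e)
  show "pv N1 x = (- a2 x) *\<^sub>R T1 x + (- a3 x) *\<^sub>R T2 x + lv x *\<^sub>R N1 x + m2 x *\<^sub>R N2 x"
    by (rule trans[OF frame_expand[OF x]]) (simp add: e)
  show "pu N2 x = b1 x *\<^sub>R T1 x + b2 x *\<^sub>R T2 x + m1 x *\<^sub>R N1 x + lu x *\<^sub>R N2 x"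
    by (rule trans[OF frame_expand[OF x]]) (simp add: e)
  show "pv N2 x = b2 x *\<^sub>R T1 x + b3 x *\<^sub>R T2 x + m2 x *\<^sub>R N1 x + lv x *\<^sub>R N2 x"
    by (rule trans[OF frame_expand[OF x]]) (simp add: e)
qed

lemma frame_partials:
  assumes x: "x \<in> U"
  shows "has_partials frame (con_u x ** frame x) (con_v x ** frame x) x"
proof -
  have "frame = (\<lambda>x. vec5 (F x) (T1 x) (T2 x) (N1 x) (N2 x))" by (simp add: fun_eq_iff frame_mat_eq_vec5)
  moreover have "has_partials (\<lambda>x. vec5 (F x) (T1 x) (T2 x) (N1 x) (N2 x))
      (vec5 (T1 x) (pu T1 x) (pu T2 x) (pu N1 x) (pu N2 x)) (vec5 (T2 x) (pv T1 x) (pv T2 x) (pv N1 x) (pv N2 x)) x"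
    by (intro has_partials_vec5 smooth_on_partials[OF U _ x] smooth_F smooth_T smooth_N1 smooth_N2)
  moreover have "vec5 (T1 x) (pu T1 x) (pu T2 x) (pu N1 x) (pu N2 x) = con_u x ** frame x"
    by (simp add: vec5_eq_iff[of "vec5 _ _ _ _ _"] row_matrix_mult5 conn_u_def frame_mat_eq_vec5 gauss_weingarten[OF x])
  moreover have "vec5 (T2 x) (pv T1 x) (pv T2 x) (pv N1 x) (pv N2 x) = con_v x ** frame x"
    by (simp add: vec5_eq_iff[of "vec5 _ _ _ _ _"] row_matrix_mult5 conn_v_def frame_mat_eq_vec5 gauss_weingarten[OF x])
  ultimately show ?thesis by simp
qed

lemma smooth_frame: "smooth_on U frame"
proof -
  have "frame = (\<lambda>x. vec5 (F x) (T1 x) (T2 x) (N1 x) (N2 x))" by (simp add: fun_eq_iff frame_mat_eq_vec5)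
  then show ?thesis using smooth_on_vec5[OF U smooth_F smooth_T smooth_N1 smooth_N2] by simp
qed

lemma smooth_sff:
  assumes "smooth_on U G"
  shows "smooth_on U (sff_N1 L0 F N1 G)" "smooth_on U (sff_N2 L0 F N2 G)"
proof -
  have nz: "m x \<noteq> 0" if "x \<in> U" for x using metric_pos[OF that] by simp
  have "sff_N1 L0 F N1 G = (\<lambda>x. lor L0 (G x) (N1 x) / m x)" "sff_N2 L0 F N2 G = (\<lambda>x. - lor L0 (G x) (N2 x) / m x)"
    by (simp_all add: fun_eq_iff sff_N1_def sff_N2_def)
  then show "smooth_on U (sff_N1 L0 F N1 G)" "smooth_on U (sff_N2 L0 F N2 G)"
    by (auto intro!: smooth_on_divide[OF U] smooth_on_minus[OF U] smooth_on_bilinear[OF U bounded_bilinear_lor]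
        assms smooth_N1 smooth_N2 smooth_metric nz)
qed

lemma smooth_coefficients:
  "smooth_on U a1" "smooth_on U a2" "smooth_on U a3" "smooth_on U b1" "smooth_on U b2" "smooth_on U b3"
  "smooth_on U m1" "smooth_on U m2" "smooth_on U lu" "smooth_on U lv"
  unfolding alpha1_def alpha2_def alpha3_def beta1_def beta2_def beta3_def mu1_def mu2_def
  by (intro smooth_sff smooth_on_pu[OF U] smooth_on_pv[OF U] smooth_F smooth_N1 smooth_lam)+

text \<open>Both mixed second derivatives of the frame are computed from its first-order system.
  They agree, and cancelling the invertible frame leaves the matrix flatness identity, whose entries
  include the Codazzi equations.\<close>

lemma codazzi:
  assumes x: "x \<in> U"
  shows "pv a1 x - pu a2 x = lv x * a3 x + lu x * a2 x - b1 x * m2 x + b2 x * m1 x"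
    "pv b1 x - pu b2 x = lv x * b3 x + lu x * b2 x - a1 x * m2 x + a2 x * m1 x"
    "pu a3 x - pv a2 x = lu x * a1 x + lv x * a2 x - b3 x * m1 x + b2 x * m2 x"
    "pu b3 x - pv b2 x = lu x * b1 x + lv x * b2 x - a3 x * m1 x + a2 x * m2 x"
proof -
  have f: "has_partials (\<lambda>x. L0 * m x) (L0 * (2 * m x * lu x)) (L0 * (2 * m x * lv x)) x"
    by (rule has_partials_linear[OF bounded_linear_mult_right metric_partials[OF x]])
  note sp = smooth_coefficients[THEN smooth_on_partials[OF U _ x]]
  note pC = has_partials_conn_u[OF f sp(9,10,1,2,4,5,7)] and qC = has_partials_conn_v[OF f sp(9,10,2,3,5,6,8)]
  let ?C = "conn_u 0 (L0 * (2 * m x * lv x)) (pv lu x) (pv lv x) (pv a1 x) (pv a2 x) (pv b1 x) (pv b2 x) (pv m1 x)"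
  let ?D = "conn_v 0 (L0 * (2 * m x * lu x)) (pu lu x) (pu lv x) (pu a2 x) (pu a3 x) (pu b2 x) (pu b3 x) (pu m2 x)"
  note fp = frame_partials[OF x]
  have "pv (pu frame) x = pv (\<lambda>y. con_u y ** frame y) x"
    by (rule pv_cong_open[OF U x]) (rule has_partials_pu[OF frame_partials])
  also have "\<dots> = ?C ** frame x + con_u x ** (con_v x ** frame x)"
    by (rule has_partials_pv[OF has_partials_bilinear[OF bounded_bilinear_matrix_mult pC fp]])
  finally have 1: "pv (pu frame) x = (?C + con_u x ** con_v x) ** frame x"
    by (simp add: mmult.add_left matrix_mul_assoc)
  have "pu (pv frame) x = pu (\<lambda>y. con_v y ** frame y) x"
    by (rule pu_cong_open[OF U x]) (rule has_partials_pv[OF frame_partials])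
  also have "\<dots> = ?D ** frame x + con_v x ** (con_u x ** frame x)"
    by (rule has_partials_pu[OF has_partials_bilinear[OF bounded_bilinear_matrix_mult qC fp]])
  finally have 2: "pu (pv frame) x = (?D + con_v x ** con_u x) ** frame x"
    by (simp add: mmult.add_left matrix_mul_assoc)
  obtain G where G: "frame x ** G = mat 1" using frame_inverse[OF x] by blast
  have "(?C + con_u x ** con_v x) ** frame x ** G = (?D + con_v x ** con_u x) ** frame x ** G"
    using 1 2 mixed_partials_eq[OF U smooth_frame x] by simp
  then have "?C + con_u x ** con_v x = ?D + con_v x ** con_u x"
    by (simp only: matrix_mul_assoc[symmetric] G matrix_mul_rid)
  then show "pv a1 x - pu a2 x = lv x * a3 x + lu x * a2 x - b1 x * m2 x + b2 x * m1 x"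
    "pv b1 x - pu b2 x = lv x * b3 x + lu x * b2 x - a1 x * m2 x + a2 x * m1 x"
    "pu a3 x - pv a2 x = lu x * a1 x + lv x * a2 x - b3 x * m1 x + b2 x * m2 x"
    "pu b3 x - pv b2 x = lu x * b1 x + lv x * b2 x - a3 x * m1 x + a2 x * m2 x"
    unfolding conn_flat_iff by simp_all
qed

end

section \<open>The Codazzi equations as a complex linear system\<close>

text \<open>Cramer's rule for the unknowns \<phi> and \<psi>; the determinant of the system is
  \<open>\<i> * (W * X - Y * Z)\<close>, which accounts for the factor \<i> in the first formula and
  its absence in the second.\<close>

lemma codazzi_system_solution:
  fixes W X Y Z \<phi> \<psi> S R :: complex
  assumes S: "S = - \<i> * W * \<phi> - Z * \<psi>" and R: "R = - \<i> * Y * \<phi> - X * \<psi>" and \<Delta>: "W * X - Y * Z \<noteq> 0"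
  shows "\<i> / (W * X - Y * Z) * (X * S - Z * R) = \<phi>" "1 / (W * X - Y * Z) * (Y * S - W * R) = \<psi>"
proof -
  have "X * S - Z * R = - \<i> * (W * X - Y * Z) * \<phi>" "Y * S - W * R = (W * X - Y * Z) * \<psi>"
    unfolding S R by (simp_all add: algebra_simps)
  then show "\<i> / (W * X - Y * Z) * (X * S - Z * R) = \<phi>" "1 / (W * X - Y * Z) * (Y * S - W * R) = \<psi>"
    using \<Delta> by (simp_all add: divide_simps)
qed

text \<open>The direction needed for reconstruction: quantities defined by the Cramer formulas do
  satisfy the Codazzi system. Multiplying by the determinant avoids nested quotients.\<close>

lemma codazzi_system_of_solution:
  fixes W X Y Z S R :: complex
  assumes \<Delta>: "W * X - Y * Z \<noteq> 0"
  defines "\<phi> \<equiv> \<i> / (W * X - Y * Z) * (X * S - Z * R)" and "\<psi> \<equiv> 1 / (W * X - Y * Z) * (Y * S - W * R)"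
  shows "S = - \<i> * W * \<phi> - Z * \<psi>" "R = - \<i> * Y * \<phi> - X * \<psi>"
proof -
  let ?d = "W * X - Y * Z"
  have "\<phi> = (\<i> * (X * S - Z * R)) / ?d" "\<psi> = (Y * S - W * R) / ?d" by (simp_all add: \<phi>_def \<psi>_def)
  then have eq: "?d * \<phi> = \<i> * (X * S - Z * R)" "?d * \<psi> = Y * S - W * R" using \<Delta> by simp_all
  have "?d * (- \<i> * W * \<phi> - Z * \<psi>) = - \<i> * W * (?d * \<phi>) - Z * (?d * \<psi>)"
    "?d * (- \<i> * Y * \<phi> - X * \<psi>) = - \<i> * Y * (?d * \<phi>) - X * (?d * \<psi>)" by (simp_all add: algebra_simps)
  then have "?d * (- \<i> * W * \<phi> - Z * \<psi>) = ?d * S" "?d * (- \<i> * Y * \<phi> - X * \<psi>) = ?d * R"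
    unfolding eq by (simp_all add: algebra_simps)
  then show "S = - \<i> * W * \<phi> - Z * \<psi>" "R = - \<i> * Y * \<phi> - X * \<psi>" using \<Delta> by simp_all
qed

lemma has_partials_complex:
  assumes "has_partials a au av x" "has_partials b bu bv x"
  shows "has_partials (\<lambda>x. complex_of_real (a x) + c * complex_of_real (b x))
    (complex_of_real au + c * complex_of_real bu) (complex_of_real av + c * complex_of_real bv) x"
  by (intro has_partials_add has_partials_linear[OF bounded_linear_of_real]
      has_partials_linear[OF bounded_linear_mult_right] assms)

section \<open>Twistor lifts\<close>

lemma bounded_bilinear_wedge: "bounded_bilinear wedge"
  by (intro bilinear_conv_bounded_bilinear[THEN iffD1])
    (auto simp: bilinear_def wedge_def intro!: linearI simp: vec_eq_iff complex_eq_iff algebra_simps)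

text \<open>With the factor \<i> kept inside, both summands of the twistor lift are real-bilinear in
  the frame vectors, so one product rule differentiates them.\<close>

definition iwedge :: "real^5 \<Rightarrow> real^5 \<Rightarrow> complex^5^5" where
  "iwedge a b = (\<chi> i j. \<i> * wedge a b $ i $ j)"

lemma bounded_bilinear_iwedge: "bounded_bilinear iwedge"
  by (intro bilinear_conv_bounded_bilinear[THEN iffD1])
    (auto simp: bilinear_def wedge_def iwedge_def intro!: linearI simp: vec_eq_iff complex_eq_iff algebra_simps)

text \<open>The projection behind \<open>cproj\<close>, acting on real vectors.\<close>

definition tproj :: "real \<Rightarrow> real^5 \<Rightarrow> real^5 \<Rightarrow> real^5" where
  "tproj L0 p v = v - (L0 * lor L0 v p) *\<^sub>R p"

lemma linear_conj: "linear (\<lambda>M::complex^5^5. A ** M ** transpose A)"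
  by (intro linearI) (simp_all add: vec_eq_iff matrix_matrix_mult_def transpose_def sum.distrib
      sum_distrib_left sum_distrib_right scaleR_sum_right algebra_simps)

lemma tproj_nth: "tproj L0 p a $ i = (\<Sum>k\<in>UNIV. ((if i = k then 1 else 0) - L0 * p$i * gsign L0 k * p$k) * a$k)"
proof -
  have "(\<Sum>k\<in>UNIV. ((if i = k then 1 else 0) - L0 * p$i * gsign L0 k * p$k) * a$k)
    = (\<Sum>k\<in>UNIV. (if i = k then a$k else 0)) - (\<Sum>k\<in>UNIV. L0 * p$i * (gsign L0 k * a$k * p$k))"
    unfolding sum_subtractf[symmetric] by (intro sum.cong) (auto simp: algebra_simps)
  also have "\<dots> = a$i - L0 * p$i * lor L0 a p"
    by (simp add: lor_def sum_distrib_left)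
  finally show ?thesis by (simp add: tproj_def algebra_simps)
qed

text \<open>Conjugating \<open>a b^T - b a^T\<close> by a projection applies the projection to each
  factor. The covariant derivative of a bivector can thus be computed on the frame vectors.\<close>

lemma cproj_wedge: "cproj L0 p ** wedge a b ** transpose (cproj L0 p) = wedge (tproj L0 p a) (tproj L0 p b)"
proof -
  define r where "r = (\<lambda>i k. (if i = k then 1 else 0) - L0 * p$i * gsign L0 k * p$k)"
  have "(cproj L0 p ** wedge a b ** transpose (cproj L0 p)) $ i $ j = wedge (tproj L0 p a) (tproj L0 p b) $ i $ j" for i j
  proof -
    have "(cproj L0 p ** wedge a b ** transpose (cproj L0 p)) $ i $ j
      = complex_of_real (\<Sum>l\<in>UNIV. (\<Sum>k\<in>UNIV. r i k * (a$k * b$l - a$l * b$k)) * r j l)"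
      by (simp add: matrix_matrix_mult_def transpose_def cproj_def wedge_def r_def)
    also have "(\<Sum>l\<in>UNIV. (\<Sum>k\<in>UNIV. r i k * (a$k * b$l - a$l * b$k)) * r j l)
      = (\<Sum>k\<in>UNIV. r i k * a$k) * (\<Sum>l\<in>UNIV. r j l * b$l) - (\<Sum>k\<in>UNIV. r i k * b$k) * (\<Sum>l\<in>UNIV. r j l * a$l)"
      by (simp add: sum_5 algebra_simps)
    finally show ?thesis by (simp add: wedge_def tproj_nth r_def)
  qed
  then show ?thesis by (simp add: vec_eq_iff)
qed

lemma cproj_iwedge: "cproj L0 p ** iwedge a b ** transpose (cproj L0 p) = iwedge (tproj L0 p a) (tproj L0 p b)"
proof -
  have "cproj L0 p ** iwedge a b ** transpose (cproj L0 p)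
    = (\<chi> i j. \<i> * (cproj L0 p ** wedge a b ** transpose (cproj L0 p)) $ i $ j)"
    by (simp add: vec_eq_iff iwedge_def matrix_matrix_mult_def sum_distrib_left sum_distrib_right mult_ac)
  then show ?thesis by (simp add: cproj_wedge iwedge_def)
qed

text \<open>Pairing with \<open>p\<close> and \<open>q\<close> through the indefinite form gives the
  inner product of bivectors, a 2 by 2 determinant. It is used to extract single coefficients from a
  combination of wedges of frame vectors.\<close>

lemma contract_wedge:
  "(\<Sum>i\<in>UNIV. \<Sum>j\<in>UNIV. complex_of_real (gsign L0 i * p$i * gsign L0 j * q$j) * wedge a b $ i $ j)
    = complex_of_real (lor L0 a p * lor L0 b q - lor L0 a q * lor L0 b p)"
proof -
  have "(\<Sum>i\<in>UNIV. \<Sum>j\<in>UNIV. complex_of_real (gsign L0 i * p$i * gsign L0 j * q$j) * wedge a b $ i $ j)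
    = complex_of_real (\<Sum>i\<in>UNIV. \<Sum>j\<in>UNIV. (gsign L0 i * a$i * p$i) * (gsign L0 j * b$j * q$j)
        - (gsign L0 j * a$j * q$j) * (gsign L0 i * b$i * p$i))"
    unfolding of_real_sum by (intro sum.cong refl) (simp add: wedge_def algebra_simps)
  also have "(\<Sum>i\<in>UNIV. \<Sum>j\<in>UNIV. (gsign L0 i * a$i * p$i) * (gsign L0 j * b$j * q$j)
        - (gsign L0 j * a$j * q$j) * (gsign L0 i * b$i * p$i))
     = lor L0 a p * lor L0 b q - lor L0 a q * lor L0 b p"
    unfolding lor_def sum_product sum_subtractf[symmetric]
    by (simp add: sum_5 algebra_simps)
  finally show ?thesis .
qed

context framed_surface
begin

abbreviation "W \<equiv> assocW L0 F N1 N2"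
abbreviation "X \<equiv> assocX L0 F N1 N2"
abbreviation "Y \<equiv> assocY L0 F N1 N2"
abbreviation "Z \<equiv> assocZ L0 F N1 N2"

lemma assoc_partials:
  assumes x: "x \<in> U"
  shows "pv Y x = complex_of_real (pv b2 x) - \<i> * complex_of_real (pv a1 x)"
    "pu X x = complex_of_real (pu a2 x) + \<i> * complex_of_real (pu b3 x)"
    "pv W x = complex_of_real (pv a2 x) - \<i> * complex_of_real (pv b1 x)"
    "pu Z x = complex_of_real (pu b2 x) + \<i> * complex_of_real (pu a3 x)"
proof -
  note sp = smooth_coefficients[THEN smooth_on_partials[OF U _ x]]
  have "Y = (\<lambda>x. complex_of_real (b2 x) + (- \<i>) * complex_of_real (a1 x))"
    "X = (\<lambda>x. complex_of_real (a2 x) + \<i> * complex_of_real (b3 x))"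
    "W = (\<lambda>x. complex_of_real (a2 x) + (- \<i>) * complex_of_real (b1 x))"
    "Z = (\<lambda>x. complex_of_real (b2 x) + \<i> * complex_of_real (a3 x))"
    by (simp_all add: fun_eq_iff assocY_def assocX_def assocW_def assocZ_def)
  then show "pv Y x = complex_of_real (pv b2 x) - \<i> * complex_of_real (pv a1 x)"
    "pu X x = complex_of_real (pu a2 x) + \<i> * complex_of_real (pu b3 x)"
    "pv W x = complex_of_real (pv a2 x) - \<i> * complex_of_real (pv b1 x)"
    "pu Z x = complex_of_real (pu b2 x) + \<i> * complex_of_real (pu a3 x)"
    using has_partials_pv[OF has_partials_complex[OF sp(5,1), of "- \<i>"]] has_partials_pu[OF has_partials_complex[OF sp(2,6), of \<i>]]
      has_partials_pv[OF has_partials_complex[OF sp(2,4), of "- \<i>"]] has_partials_pu[OF has_partials_complex[OF sp(5,3), of \<i>]]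
    by simp_all
qed

lemma A_B_eq:
  assumes x: "x \<in> U" and \<Delta>: "DeltaF W X Y Z x \<noteq> 0"
  shows "AF W X Y Z x = assocPhi L0 F N1 N2 x" "BF W X Y Z x = assocPsi L0 F N1 N2 x"
proof -
  note c = codazzi[OF x]
  \<comment> \<open>Up to sign, the real part is the fourth and the imaginary part the first Codazzi
    equation; in the next relation they are the third and the second.\<close>
  have S: "pv Y x + \<i> * pu X x = - \<i> * W x * assocPhi L0 F N1 N2 x - Z x * assocPsi L0 F N1 N2 x"
    unfolding assoc_partials[OF x] assocPhi_def assocPsi_def assocW_def assocZ_def
    using c(1,4) by (simp add: complex_eq_iff algebra_simps)
  have R: "pv W x + \<i> * pu Z x = - \<i> * Y x * assocPhi L0 F N1 N2 x - X x * assocPsi L0 F N1 N2 x"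
    unfolding assoc_partials[OF x] assocPhi_def assocPsi_def assocX_def assocY_def
    using c(2,3) by (simp add: complex_eq_iff algebra_simps)
  show "AF W X Y Z x = assocPhi L0 F N1 N2 x" "BF W X Y Z x = assocPsi L0 F N1 N2 x"
    using codazzi_system_solution[OF S R] \<Delta> by (simp_all add: AF_def BF_def DeltaF_def)
qed

definition \<kappa> :: "real \<times> real \<Rightarrow> real" where
  "\<kappa> x = (1 / sqrt 2) * exp (- 2 * l x)"

lemma \<kappa>_pos: "\<kappa> x > 0" by (simp add: \<kappa>_def)

lemma \<kappa>_partials:
  assumes x: "x \<in> U"
  shows "has_partials \<kappa> (- 2 * \<kappa> x * lu x) (- 2 * \<kappa> x * lv x) x"
proof -
  have "has_partials (\<lambda>x. exp (- 2 * l x)) ((- 2 * exp (- 2 * l x)) * lu x) ((- 2 * exp (- 2 * l x)) * lv x) x"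
    by (rule has_partials_field[OF smooth_on_partials[OF U smooth_lam x]])
      (auto intro!: derivative_eq_intros)
  from has_partials_linear[OF bounded_linear_mult_right this, of "1 / sqrt 2"]
  have "has_partials (\<lambda>x. (1 / sqrt 2) * exp (- 2 * l x)) (- 2 * \<kappa> x * lu x) (- 2 * \<kappa> x * lv x) x"
    by (simp add: \<kappa>_def)
  moreover have "\<kappa> = (\<lambda>x. (1 / sqrt 2) * exp (- 2 * l x))" by (simp add: fun_eq_iff \<kappa>_def)
  ultimately show ?thesis by (simp only:)
qed

lemma twistor1_eq: "twistor1 L0 F N1 N2 = (\<lambda>x. \<kappa> x *\<^sub>R (wedge (T1 x) (T2 x) + iwedge (N1 x) (N2 x)))"
proof -
  have e: "exp (- l x) * exp (- l x) = exp (- 2 * l x)" for x by (simp flip: exp_add)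
  have "twistor1 L0 F N1 N2 x $ i $ j = (\<kappa> x *\<^sub>R (wedge (T1 x) (T2 x) + iwedge (N1 x) (N2 x))) $ i $ j" for x i j
    unfolding twistor1_def \<kappa>_def e[symmetric]
    by (simp add: Let_def wedge_def iwedge_def complex_eq_iff algebra_simps)
  then show ?thesis by (simp add: fun_eq_iff vec_eq_iff)
qed

lemma tproj_frame:
  assumes x: "x \<in> U"
  shows "tproj L0 (F x) (F x) = 0" "tproj L0 (F x) (T1 x) = T1 x" "tproj L0 (F x) (T2 x) = T2 x"
    "tproj L0 (F x) (N1 x) = N1 x" "tproj L0 (F x) (N2 x) = N2 x"
  using L0 by (simp_all add: tproj_def inner_frame[OF x] inner_frame'[OF x])

lemma tproj_add: "tproj L0 p (v + w) = tproj L0 p v + tproj L0 p w"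
  and tproj_scale: "tproj L0 p (c *\<^sub>R v) = c *\<^sub>R tproj L0 p v"
  by (simp_all add: tproj_def lor.add_left lor.scaleR_left algebra_simps)

text \<open>The derivative of the normalizing factor \<kappa> cancels the \<open>lu\<close> and
  \<open>lv\<close> terms of both planes. The rotation within the tangent plane and the normal
  connection disappear from the wedges, and the components along \<open>F\<close> are projected
  away, so only wedges of one tangent and one normal vector survive.\<close>

lemma cov_twistor:
  assumes x: "x \<in> U"
  shows "covT1 L0 F (twistor1 L0 F N1 N2) x $ i $ j = complex_of_real (\<kappa> x) *
      (\<i> * Y x * wedge (N1 x) (T2 x) $ i $ j + \<i> * W x * wedge (N2 x) (T2 x) $ i $ j
        + W x * wedge (T1 x) (N1 x) $ i $ j + Y x * wedge (T1 x) (N2 x) $ i $ j)"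
    and "covT2 L0 F (twistor1 L0 F N1 N2) x $ i $ j = complex_of_real (\<kappa> x) *
      (X x * wedge (N1 x) (T2 x) $ i $ j + Z x * wedge (N2 x) (T2 x) $ i $ j
        - \<i> * Z x * wedge (T1 x) (N1 x) $ i $ j - \<i> * X x * wedge (T1 x) (N2 x) $ i $ j)"
proof -
  note sp = smooth_on_partials[OF U _ x]
  note hp = has_partials_bilinear[OF bounded_bilinear_scaleR \<kappa>_partials[OF x] has_partials_add[OF
      has_partials_bilinear[OF bounded_bilinear_wedge sp[OF smooth_T(1)] sp[OF smooth_T(2)]]
      has_partials_bilinear[OF bounded_bilinear_iwedge sp[OF smooth_N1] sp[OF smooth_N2]]]]
  note lin = linear_add[OF linear_conj] linear_scale[OF linear_conj]
  note pr = tproj_add tproj_scale tproj_frame[OF x]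
  show "covT1 L0 F (twistor1 L0 F N1 N2) x $ i $ j = complex_of_real (\<kappa> x) *
      (\<i> * Y x * wedge (N1 x) (T2 x) $ i $ j + \<i> * W x * wedge (N2 x) (T2 x) $ i $ j
        + W x * wedge (T1 x) (N1 x) $ i $ j + Y x * wedge (T1 x) (N2 x) $ i $ j)"
    unfolding covT1_def twistor1_eq has_partials_pu[OF hp] lin cproj_wedge cproj_iwedge gauss_weingarten[OF x] pr
    by (simp add: wedge_def iwedge_def assocW_def assocY_def complex_eq_iff algebra_simps)
  show "covT2 L0 F (twistor1 L0 F N1 N2) x $ i $ j = complex_of_real (\<kappa> x) *
      (X x * wedge (N1 x) (T2 x) $ i $ j + Z x * wedge (N2 x) (T2 x) $ i $ j
        - \<i> * Z x * wedge (T1 x) (N1 x) $ i $ j - \<i> * X x * wedge (T1 x) (N2 x) $ i $ j)"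
    unfolding covT2_def twistor1_eq has_partials_pv[OF hp] lin cproj_wedge cproj_iwedge gauss_weingarten[OF x] pr
    by (simp add: wedge_def iwedge_def assocX_def assocZ_def complex_eq_iff algebra_simps)
qed

text \<open>In both derivatives the coefficients of \<open>T1 \<and> N1\<close> and
  \<open>T1 \<and> N2\<close> are \<open>- \<i>\<close> times those of \<open>N2 \<and> T2\<close>
  and \<open>N1 \<and> T2\<close>. Independence is therefore decided by the last two alone, whose 2
  by 2 determinant is a nonzero multiple of \<Delta>.\<close>

lemma twistor_lin_indep_iff:
  assumes x: "x \<in> U"
  shows "lin_indep2 (covT1 L0 F (twistor1 L0 F N1 N2) x) (covT2 L0 F (twistor1 L0 F N1 N2) x)
    \<longleftrightarrow> DeltaF W X Y Z x \<noteq> 0" (is "?li \<longleftrightarrow> _")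
proof -
  let ?M1 = "covT1 L0 F (twistor1 L0 F N1 N2) x" and ?M2 = "covT2 L0 F (twistor1 L0 F N1 N2) x"
  let ?k = "complex_of_real (\<kappa> x)"
  have comb: "a * ?M1 $ i $ j + b * ?M2 $ i $ j = ?k * ((\<i> * a * Y x + b * X x) * wedge (N1 x) (T2 x) $ i $ j
      + (\<i> * a * W x + b * Z x) * wedge (N2 x) (T2 x) $ i $ j
      + (a * W x - \<i> * b * Z x) * wedge (T1 x) (N1 x) $ i $ j + (a * Y x - \<i> * b * X x) * wedge (T1 x) (N2 x) $ i $ j)" for a b i j
    unfolding cov_twistor[OF x] by (simp add: algebra_simps)
  show ?thesis
  proof
    assume ?li
    show "DeltaF W X Y Z x \<noteq> 0"
    proof
      assume "DeltaF W X Y Z x = 0"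
      then have D: "W x * X x = Y x * Z x" by (simp add: DeltaF_def)
      \<comment> \<open>Both pairs lie in the kernel of the singular coefficient matrix.
        Independence makes each of them trivial, so all four functions vanish.\<close>
      have "\<forall>i j. X x * ?M1 $ i $ j + (- \<i> * Y x) * ?M2 $ i $ j = 0" "\<forall>i j. Z x * ?M1 $ i $ j + (- \<i> * W x) * ?M2 $ i $ j = 0"
        unfolding comb using D by (simp_all add: algebra_simps)
      then have "X x = 0 \<and> - \<i> * Y x = 0" "Z x = 0 \<and> - \<i> * W x = 0"
        using \<open>?li\<close> unfolding lin_indep2_def by blast+
      \<comment> \<open>Now the first covariant derivative is itself zero, which contradicts
        independence.\<close>
      then have "\<forall>i j. 1 * ?M1 $ i $ j + 0 * ?M2 $ i $ j = 0" unfolding comb by simp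
      then show False using \<open>?li\<close> unfolding lin_indep2_def by (metis zero_neq_one)
    qed
  next
    assume D: "DeltaF W X Y Z x \<noteq> 0"
    show ?li
      unfolding lin_indep2_def
    proof (intro allI impI)
      fix a b assume 0: "\<forall>i j. a * ?M1 $ i $ j + b * ?M2 $ i $ j = 0"
      have z: "(\<i> * a * Y x + b * X x) * wedge (N1 x) (T2 x) $ i $ j
        + (\<i> * a * W x + b * Z x) * wedge (N2 x) (T2 x) $ i $ j
        + (a * W x - \<i> * b * Z x) * wedge (T1 x) (N1 x) $ i $ j + (a * Y x - \<i> * b * X x) * wedge (T1 x) (N2 x) $ i $ j = 0" for i j
        using 0 \<kappa>_pos[of x] unfolding comb by simp
      \<comment> \<open>Choosing \<open>p\<close> and \<open>q\<close> among the frame vectors later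
        isolates one coefficient, multiplied by plus or minus the square of
        \<open>m x\<close>.\<close>
      have con: "(\<i> * a * Y x + b * X x) * complex_of_real (lor L0 (N1 x) p * lor L0 (T2 x) q - lor L0 (N1 x) q * lor L0 (T2 x) p)
        + (\<i> * a * W x + b * Z x) * complex_of_real (lor L0 (N2 x) p * lor L0 (T2 x) q - lor L0 (N2 x) q * lor L0 (T2 x) p)
        + (a * W x - \<i> * b * Z x) * complex_of_real (lor L0 (T1 x) p * lor L0 (N1 x) q - lor L0 (T1 x) q * lor L0 (N1 x) p)
        + (a * Y x - \<i> * b * X x) * complex_of_real (lor L0 (T1 x) p * lor L0 (N2 x) q - lor L0 (T1 x) q * lor L0 (N2 x) p) = 0" for p q
      proof -
        have "(\<Sum>i\<in>UNIV. \<Sum>j\<in>UNIV. complex_of_real (gsign L0 i * p$i * gsign L0 j * q$j) *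
          ((\<i> * a * Y x + b * X x) * wedge (N1 x) (T2 x) $ i $ j
          + (\<i> * a * W x + b * Z x) * wedge (N2 x) (T2 x) $ i $ j
          + (a * W x - \<i> * b * Z x) * wedge (T1 x) (N1 x) $ i $ j + (a * Y x - \<i> * b * X x) * wedge (T1 x) (N2 x) $ i $ j)) = 0"
          unfolding z by simp
        then show ?thesis
          unfolding contract_wedge[symmetric] sum_distrib_left distrib_left sum.distrib
          by (simp only: mult.left_commute)
      qed
      have m: "m x \<noteq> 0" using metric_pos[OF x] by simp
      have 1: "\<i> * a * Y x + b * X x = 0" using con[of "N1 x" "T2 x"] m
        by (simp add: inner_frame[OF x] inner_frame'[OF x])
      have 2: "\<i> * a * W x + b * Z x = 0" using con[of "N2 x" "T2 x"] m
        by (simp add: inner_frame[OF x] inner_frame'[OF x])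
      have "b * DeltaF W X Y Z x = (\<i> * a * Y x + b * X x) * W x - (\<i> * a * W x + b * Z x) * Y x"
        by (simp add: DeltaF_def algebra_simps)
      then have b: "b = 0" using 1 2 D by simp
      have "a * DeltaF W X Y Z x = - \<i> * ((\<i> * a * W x + b * Z x) * X x - (\<i> * a * Y x + b * X x) * Z x)"
        by (simp add: DeltaF_def algebra_simps)
      then have "a = 0" using 1 2 D by simp
      with b show "a = 0 \<and> b = 0" by simp
    qed
  qed
qed

theorem twistor_nondeg_imp:
  assumes nd: "twistor_nondeg L0 U F N1 N2" and x: "x \<in> U"
  defines "f \<equiv> \<lambda>x. L0 * exp (2 * lam L0 F x)"
  shows "DeltaF W X Y Z x \<noteq> 0 \<and> AF W X Y Z x = assocPhi L0 F N1 N2 x \<and> BF W X Y Z x = assocPsi L0 F N1 N2 x \<and>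
    complex_of_real (pu f x) = complex_of_real (f x) * (AF W X Y Z x + cnj (AF W X Y Z x)) \<and>
    complex_of_real (pv f x) = complex_of_real (f x) * (BF W X Y Z x + cnj (BF W X Y Z x))"
proof -
  have D: "DeltaF W X Y Z x \<noteq> 0"
    using nd x twistor_lin_indep_iff[OF x] by (simp add: twistor_nondeg_def)
  have "has_partials f ((2 * f x) * lu x) ((2 * f x) * lv x) x"
    unfolding f_def
    by (rule has_partials_field[OF smooth_on_partials[OF U smooth_lam x]])
      (auto intro!: derivative_eq_intros)
  from has_partials_pu[OF this] has_partials_pv[OF this] D A_B_eq[OF x D] show ?thesis
    by (simp add: assocPhi_def assocPsi_def complex_eq_iff)
qed

end

section \<open>Reconstruction of the surface\<close>

lemma linear_system_unique:
  fixes K :: "real \<times> real \<Rightarrow> 'v::real_inner"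
  assumes D: "open D" "connected D" and C: "continuous_on D C"
    and K: "\<And>x. x \<in> D \<Longrightarrow> has_partials K (a x) (b x) x"
    and bound: "\<And>x. x \<in> D \<Longrightarrow> norm (a x) \<le> C x * norm (K x)" "\<And>x. x \<in> D \<Longrightarrow> norm (b x) \<le> C x * norm (K x)"
    and x0: "x0 \<in> D" "K x0 = 0" and x: "x \<in> D"
  shows "K x = 0"
proof (rule linear_total_ode_unique[where K = K and U = D and C = "\<lambda>y. 2 * C y"
      and K' = "\<lambda>y h. fst h *\<^sub>R a y + snd h *\<^sub>R b y", OF D _ _ _ x0 x])
  show "(K has_derivative (\<lambda>h. fst h *\<^sub>R a y + snd h *\<^sub>R b y)) (at y)" if "y \<in> D" for y
    using K[OF that] by (simp add: has_partials_def)
  show "continuous_on D (\<lambda>y. 2 * C y)" by (intro continuous_intros C)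
  fix y and h :: "real \<times> real" assume y: "y \<in> D"
  have "norm (fst h *\<^sub>R a y + snd h *\<^sub>R b y) \<le> \<bar>fst h\<bar> * norm (a y) + \<bar>snd h\<bar> * norm (b y)"
    by (rule norm_triangle_le) simp
  also have "\<dots> \<le> norm h * (C y * norm (K y)) + norm h * (C y * norm (K y))"
    using norm_fst_le[of "fst h" "snd h"] norm_snd_le[of "snd h" "fst h"]
    by (intro add_mono mult_mono bound y) auto
  finally show "norm (fst h *\<^sub>R a y + snd h *\<^sub>R b y) \<le> 2 * C y * norm h * norm (K y)" by simp
qed

text \<open>The two-sided form serves both uses: the difference of two frames satisfies it with zero
  right coefficients, the defect of a Gram matrix with transposed ones.\<close>

lemma matrix_system_unique:
  fixes K P Q P' Q' :: "real \<times> real \<Rightarrow> real^5^5"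
  assumes D: "open D" "connected D"
    and cont: "continuous_on D P" "continuous_on D Q" "continuous_on D P'" "continuous_on D Q'"
    and K: "\<And>x. x \<in> D \<Longrightarrow> has_partials K (P x ** K x + K x ** P' x) (Q x ** K x + K x ** Q' x) x"
    and x0: "x0 \<in> D" "K x0 = 0" and x: "x \<in> D"
  shows "K x = 0"
proof -
  obtain k where k: "k \<ge> 0" "\<And>(A :: real^5^5) (B :: real^5^5). norm (A ** B) \<le> norm A * norm B * k"
    using mmult.nonneg_bounded by blast
  \<comment> \<open>The additional norms enlarge the bound so that one continuous function dominates
    both partial derivatives.\<close>
  have le: "norm (A ** M + M ** B) \<le> k * (norm A + norm B + norm A' + norm B') * norm M" for A B A' B' M :: "real^5^5"
  proof -
    have "norm (A ** M + M ** B) \<le> norm A * norm M * k + norm M * norm B * k"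
      by (intro norm_triangle_mono k(2))
    also have "\<dots> = k * (norm A + norm B) * norm M" by (simp add: algebra_simps)
    also have "\<dots> \<le> k * (norm A + norm B + norm A' + norm B') * norm M"
      using k(1) by (intro mult_right_mono mult_left_mono) auto
    finally show ?thesis .
  qed
  show ?thesis
  proof (rule linear_system_unique[where C = "\<lambda>x. k * (norm (P x) + norm (P' x) + norm (Q x) + norm (Q' x))", OF D _ K _ _ x0 x])
    show "continuous_on D (\<lambda>x. k * (norm (P x) + norm (P' x) + norm (Q x) + norm (Q' x)))"
      by (intro continuous_intros cont)
    show "norm (P y ** K y + K y ** P' y) \<le> k * (norm (P y) + norm (P' y) + norm (Q y) + norm (Q' y)) * norm (K y)" for y
      by (rule le)
    show "norm (Q y ** K y + K y ** Q' y) \<le> k * (norm (P y) + norm (P' y) + norm (Q y) + norm (Q' y)) * norm (K y)" for y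
      using le[of "Q y" "K y" "Q' y" "P y" "P' y"] by (simp add: add_ac)
  qed
qed

definition gram :: "real \<Rightarrow> real^5^5 \<Rightarrow> real^5^5 \<Rightarrow> real^5^5" where
  "gram L0 A B = (\<chi> i j. lor L0 (A $ i) (B $ j))"

lemma bounded_bilinear_gram: "bounded_bilinear (gram L0)"
  by (intro bilinear_conv_bounded_bilinear[THEN iffD1])
    (auto simp: bilinear_def gram_def intro!: linearI
      simp: vec_eq_iff lor.add_left lor.add_right lor.scaleR_left lor.scaleR_right)

lemma gram_mult_left: "gram L0 (P ** A) B = P ** gram L0 A B"
  by (simp add: gram_def vec_eq_iff row_matrix_mult5 lor.add_left lor.scaleR_left)

lemma gram_mult_right: "gram L0 A (P ** B) = gram L0 A B ** transpose P"
  by (simp add: gram_def vec_eq_iff row_matrix_mult5 lor.add_right lor.scaleR_right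
      transpose_def mult.commute)

text \<open>The first entry is separate since the position vector has constant square:
  \<open>c\<close> is \<open>1 / L0\<close> for the Gram matrix and \<open>0\<close> for its
  derivatives.\<close>

definition frame_gram :: "real \<Rightarrow> real \<Rightarrow> real^5^5" where
  "frame_gram c m = vec5 (vec5 c 0 0 0 0) (vec5 0 m 0 0 0) (vec5 0 0 m 0 0) (vec5 0 0 0 m 0) (vec5 0 0 0 0 (- m))"

lemma frame_gram_nth: "frame_gram c m $ i $ j = (if i = j then vec5 c m m m (- m) $ i else 0)"
proof -
  have "\<forall>i j. frame_gram c m $ i $ j = (if i = j then vec5 c m m m (- m) $ i else 0)"
    unfolding forall_5 frame_gram_def by simp
  then show ?thesis by blast
qed

text \<open>Compatibility of the connection with the metric: the prescribed Gram matrix satisfies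
  the same linear equations as the Gram matrix of any solution of the frame system.\<close>

lemma conn_preserves_frame_gram:
  assumes "L0 \<noteq> 0"
  shows "conn_u 1 (L0 * m) lu lv a1 a2 b1 b2 m1 ** frame_gram (1 / L0) m
      + frame_gram (1 / L0) m ** transpose (conn_u 1 (L0 * m) lu lv a1 a2 b1 b2 m1) = frame_gram 0 (2 * m * lu)"
    and "conn_v 1 (L0 * m) lu lv a2 a3 b2 b3 m2 ** frame_gram (1 / L0) m
      + frame_gram (1 / L0) m ** transpose (conn_v 1 (L0 * m) lu lv a2 a3 b2 b3 m2) = frame_gram 0 (2 * m * lv)"
  using assms unfolding vec5_eq_iff frame_gram_def conn_u_def conn_v_def
  by (simp_all add: matrix_matrix_mult_def sum_5 transpose_def)

text \<open>An initial frame of scaled standard basis vectors. \<open>N2\<close> lies on axis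
  \<open>0\<close>, which is always timelike, and the position vector on axis \<open>1\<close>,
  whose sign is that of \<open>L0\<close>; the scale \<open>c\<close> then gives it square
  \<open>1 / L0\<close>.\<close>

lemma ex_frame_with_gram:
  assumes "L0 \<noteq> 0" "m > 0"
  shows "\<exists>\<Phi>. gram L0 \<Phi> \<Phi> = frame_gram (1 / L0) m"
proof -
  define c where "c = 1 / sqrt \<bar>L0\<bar>"
  have c: "c * c = 1 / \<bar>L0\<bar>" by (simp add: c_def)
  let ?s = "sqrt m"
  have s: "?s * ?s = m" using assms by simp
  show ?thesis
    by (rule exI[of _ "vec5 (vec5 0 c 0 0 0) (vec5 0 0 ?s 0 0) (vec5 0 0 0 ?s 0) (vec5 0 0 0 0 ?s) (vec5 ?s 0 0 0 0)"])
      (use assms c s in \<open>auto simp: vec5_eq_iff gram_def frame_gram_def lor_def sum_5 gsign_def\<close>)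
qed

text \<open>The two frames solve the same linear system, so they differ by a constant right factor \<open>C\<close>, and the
  isometry is \<open>v \<mapsto> v C\<close>.\<close>

lemma framed_surfaces_congruent:
  assumes S: "framed_surface L0 D F N1 N2 ori" and S': "framed_surface L0 D F' N1' N2' ori'"
    and D: "connected D"
    and lam: "\<And>x. x \<in> D \<Longrightarrow> lam L0 F' x = lam L0 F x"
    and WXYZ: "\<And>x. x \<in> D \<Longrightarrow> assocW L0 F' N1' N2' x = assocW L0 F N1 N2 x"
      "\<And>x. x \<in> D \<Longrightarrow> assocX L0 F' N1' N2' x = assocX L0 F N1 N2 x"
      "\<And>x. x \<in> D \<Longrightarrow> assocY L0 F' N1' N2' x = assocY L0 F N1 N2 x"
      "\<And>x. x \<in> D \<Longrightarrow> assocZ L0 F' N1' N2' x = assocZ L0 F N1 N2 x"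
    and nz: "\<And>x. x \<in> D \<Longrightarrow>
      DeltaF (assocW L0 F N1 N2) (assocX L0 F N1 N2) (assocY L0 F N1 N2) (assocZ L0 F N1 N2) x \<noteq> 0"
  shows "\<exists>L. linear L \<and> (\<forall>p q. lor L0 (L p) (L q) = lor L0 p q) \<and> (\<forall>x\<in>D. F' x = L (F x))"
proof (cases "D = {}")
  case True
  then show ?thesis by (intro exI[of _ "\<lambda>v. v"]) (simp add: linear_id[unfolded id_def])
next
  case False
  then obtain x0 where x0: "x0 \<in> D" by blast
  interpret s: framed_surface L0 D F N1 N2 ori by (rule S)
  interpret s': framed_surface L0 D F' N1' N2' ori' by (rule S')
  note U = s.U
  have metric: "s'.m x = s.m x" if "x \<in> D" for x
    using s.exp_lam[OF that] s'.exp_lam[OF that] lam[OF that] by simp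
  \<comment> \<open>The \<alpha> and \<beta> are real and imaginary parts of the associated
    functions. The normal connection is recovered through \<open>AF\<close> and \<open>BF\<close>,
    and this is where nonvanishing of \<Delta> is used.\<close>
  have coeff: "s'.lu x = s.lu x" "s'.lv x = s.lv x" "s'.a1 x = s.a1 x" "s'.a2 x = s.a2 x" "s'.a3 x = s.a3 x"
    "s'.b1 x = s.b1 x" "s'.b2 x = s.b2 x" "s'.b3 x = s.b3 x" "s'.m1 x = s.m1 x" "s'.m2 x = s.m2 x" if x: "x \<in> D" for x
  proof -
    show "s'.lu x = s.lu x" "s'.lv x = s.lv x"
      by (rule pu_cong_open[OF U x lam], assumption, rule pv_cong_open[OF U x lam], assumption)
    show "s'.a1 x = s.a1 x" "s'.a2 x = s.a2 x" "s'.a3 x = s.a3 x"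
      "s'.b1 x = s.b1 x" "s'.b2 x = s.b2 x" "s'.b3 x = s.b3 x"
      using WXYZ[OF x] by (simp_all add: assocW_def assocX_def assocY_def assocZ_def complex_eq_iff)
    have pd: "pv s'.Y x = pv s.Y x" "pv s'.W x = pv s.W x" "pu s'.X x = pu s.X x" "pu s'.Z x = pu s.Z x"
      by (rule pv_cong_open[OF U x] pu_cong_open[OF U x], erule WXYZ)+
    have "DeltaF s'.W s'.X s'.Y s'.Z x = DeltaF s.W s.X s.Y s.Z x"
      "AF s'.W s'.X s'.Y s'.Z x = AF s.W s.X s.Y s.Z x" "BF s'.W s'.X s'.Y s'.Z x = BF s.W s.X s.Y s.Z x"
      by (simp_all add: DeltaF_def AF_def BF_def pd WXYZ[OF x])
    then have "assocPhi L0 F' N1' N2' x = assocPhi L0 F N1 N2 x" "assocPsi L0 F' N1' N2' x = assocPsi L0 F N1 N2 x"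
      using s.A_B_eq[OF x nz[OF x]] s'.A_B_eq[OF x] nz[OF x] by simp_all
    then show "s'.m1 x = s.m1 x" "s'.m2 x = s.m2 x"
      by (simp_all add: assocPhi_def assocPsi_def complex_eq_iff)
  qed
  have con: "s'.con_u x = s.con_u x" "s'.con_v x = s.con_v x" if "x \<in> D" for x
    by (simp_all only: metric[OF that] coeff[OF that])
  obtain G where G: "s.frame x0 ** G = mat 1" using s.frame_inverse[OF x0] by blast
  \<comment> \<open>The inverse of the first frame times the second, both at \<open>x0\<close>; this
    makes the difference considered next vanish there.\<close>
  define C where "C = G ** s'.frame x0"
  have smf: "smooth_on D (\<lambda>x. L0 * s.m x)"
    by (intro smooth_on_mult[OF U] smooth_on_const[OF U] s.smooth_metric)
  have K: "s'.frame x - s.frame x ** C = 0" if "x \<in> D" for x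
  proof (rule matrix_system_unique[where K = "\<lambda>x. s'.frame x - s.frame x ** C" and P = s.con_u and Q = s.con_v
        and P' = "\<lambda>_. 0" and Q' = "\<lambda>_. 0", OF U D _ _ _ _ _ x0 _ that])
    note sc = s.smooth_coefficients
    show "continuous_on D s.con_u" "continuous_on D s.con_v"
      by (intro smooth_on_continuous_on[OF U] smooth_on_conn[OF U] smf sc)+
    fix y assume y: "y \<in> D"
    have "has_partials (\<lambda>x. s'.frame x + - (s.frame x ** C))
        (s.con_u y ** s'.frame y + - ((s.con_u y ** s.frame y) ** C))
        (s.con_v y ** s'.frame y + - ((s.con_v y ** s.frame y) ** C)) y"
      using s'.frame_partials[OF y]
      by (intro has_partials_add has_partials_linear[OF bounded_linear_minus[OF mmult.bounded_linear_left[of C]]]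
          s.frame_partials y) (simp add: con[OF y])
    then show "has_partials (\<lambda>x. s'.frame x - s.frame x ** C)
        (s.con_u y ** (s'.frame y - s.frame y ** C) + (s'.frame y - s.frame y ** C) ** 0)
        (s.con_v y ** (s'.frame y - s.frame y ** C) + (s'.frame y - s.frame y ** C) ** 0) y"
      by (simp add: mmult.diff_right mmult.zero_right matrix_mul_assoc)
  next
    show "s'.frame x0 - s.frame x0 ** C = 0" by (simp add: C_def matrix_mul_assoc G)
  qed (auto intro: continuous_on_const)
  define L where "L = (\<lambda>v. v v* C)"
  have "linear L" unfolding L_def
    by (intro linearI) (simp_all add: vec_eq_iff vector_matrix_mult_def sum_5 algebra_simps)
  have rows: "s'.frame x $ i = L (s.frame x $ i)" if "x \<in> D" for x i
  proof -
    have "s'.frame x = s.frame x ** C" using K[OF that] by simp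
    then show ?thesis
      by (simp add: L_def vec_eq_iff matrix_matrix_mult_def vector_matrix_mult_def mult.commute)
  qed
  have norms: "s'.norms x0 i = s.norms x0 i" for i
    by (simp add: s.norms_def s'.norms_def metric[OF x0])
  \<comment> \<open>\<open>L\<close> carries the first frame at \<open>x0\<close> to the second, and
    both have the same Gram matrix; expanding in the frame extends this to all vectors.\<close>
  have "lor L0 (L p) (L q) = lor L0 p q" for p q
  proof -
    define c where "c = (\<lambda>v j. lor L0 v (s.frame x0 $ j) / s.norms x0 j)"
    have exp: "v = (\<Sum>j\<in>UNIV. c v j *\<^sub>R s.frame x0 $ j)" for v
      unfolding c_def by (rule orthogonal_frame_expansion(1)[OF s.gram_frame[OF x0] s.norms_nonzero[OF x0]])
    have expL: "L v = (\<Sum>j\<in>UNIV. c v j *\<^sub>R s'.frame x0 $ j)" for v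
      by (subst exp[of v]) (simp add: linear_sum[OF \<open>linear L\<close>] linear_scale[OF \<open>linear L\<close>] rows[OF x0])
    have "lor L0 (L p) (L q) = (\<Sum>i\<in>UNIV. \<Sum>j\<in>UNIV. c p i * c q j * lor L0 (s'.frame x0 $ i) (s'.frame x0 $ j))"
      unfolding expL lor.sum_left lor.sum_right
      by (subst sum.swap) (simp add: lor.scaleR_left lor.scaleR_right mult_ac sum_distrib_left)
    also have "\<dots> = (\<Sum>i\<in>UNIV. \<Sum>j\<in>UNIV. c p i * c q j * lor L0 (s.frame x0 $ i) (s.frame x0 $ j))"
      unfolding s.gram_frame[OF x0] s'.gram_frame[OF x0] norms ..
    also have "\<dots> = lor L0 (\<Sum>j\<in>UNIV. c p j *\<^sub>R s.frame x0 $ j) (\<Sum>j\<in>UNIV. c q j *\<^sub>R s.frame x0 $ j)"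
      unfolding lor.sum_left lor.sum_right
      by (subst sum.swap) (simp add: lor.scaleR_left lor.scaleR_right mult_ac sum_distrib_left)
    also have "\<dots> = lor L0 p q" by (simp only: exp[symmetric])
    finally show ?thesis .
  qed
  moreover have "F' x = L (F x)" if "x \<in> D" for x
    using rows[OF that, of 0] by (simp add: frame_mat_eq_vec5)
  ultimately show ?thesis using \<open>linear L\<close> by blast
qed

section \<open>Existence of the surface\<close>

text \<open>Row \<open>0\<close> of the two coefficient matrices says that the partial derivatives
  of the position row are rows \<open>1\<close> and \<open>2\<close>. A solution of the frame system
  thus consists of an actual map and its coordinate fields, and the second fundamental form is read
  off from the remaining rows.\<close>

lemma reconstruct_surface:
  fixes f lu lv a1 a2 a3 b1 b2 b3 m1 m2 :: "real \<times> real \<Rightarrow> real"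
  assumes L0: "L0 \<noteq> 0" and D: "open D" "connected D" "simply_connected D" and x0: "x0 \<in> D"
    and sm: "smooth_on D f" "smooth_on D lu" "smooth_on D lv" "smooth_on D a1" "smooth_on D a2" "smooth_on D a3"
      "smooth_on D b1" "smooth_on D b2" "smooth_on D b3" "smooth_on D m1" "smooth_on D m2"
    and pos: "\<And>x. x \<in> D \<Longrightarrow> f x / L0 > 0"
    and f: "\<And>x. x \<in> D \<Longrightarrow> has_partials f (2 * f x * lu x) (2 * f x * lv x) x"
    and eqs: "\<And>x. x \<in> D \<Longrightarrow> pv lu x = pu lv x"
      "\<And>x. x \<in> D \<Longrightarrow> pu lu x + pv lv x + f x = a2 x * a2 x - a1 x * a3 x + b1 x * b3 x - b2 x * b2 x"
      "\<And>x. x \<in> D \<Longrightarrow> pv m1 x - pu m2 x = a1 x * b2 x + a2 x * b3 x - a2 x * b1 x - a3 x * b2 x"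
      "\<And>x. x \<in> D \<Longrightarrow> pv a1 x - pu a2 x = lv x * a3 x + lu x * a2 x - b1 x * m2 x + b2 x * m1 x"
      "\<And>x. x \<in> D \<Longrightarrow> pv b1 x - pu b2 x = lv x * b3 x + lu x * b2 x - a1 x * m2 x + a2 x * m1 x"
      "\<And>x. x \<in> D \<Longrightarrow> pu a3 x - pv a2 x = lu x * a1 x + lv x * a2 x - b3 x * m1 x + b2 x * m2 x"
      "\<And>x. x \<in> D \<Longrightarrow> pu b3 x - pv b2 x = lu x * b1 x + lv x * b2 x - a3 x * m1 x + a2 x * m2 x"
  shows "\<exists>F N1 N2 ori. framed_surface L0 D F N1 N2 ori \<and> (\<forall>x\<in>D. metric L0 F x = f x / L0 \<and>
    alpha1 L0 F N1 x = a1 x \<and> alpha2 L0 F N1 x = a2 x \<and> alpha3 L0 F N1 x = a3 x \<and>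
    beta1 L0 F N2 x = b1 x \<and> beta2 L0 F N2 x = b2 x \<and> beta3 L0 F N2 x = b3 x)"
proof -
  note U = D(1)
  define P where "P = (\<lambda>x. conn_u 1 (f x) (lu x) (lv x) (a1 x) (a2 x) (b1 x) (b2 x) (m1 x))"
  define Q where "Q = (\<lambda>x. conn_v 1 (f x) (lu x) (lv x) (a2 x) (a3 x) (b2 x) (b3 x) (m2 x))"
  have smPQ: "smooth_on D P" "smooth_on D Q"
    unfolding P_def Q_def by (intro smooth_on_conn U sm)+
  have flat: "pv P x + P x ** Q x = pu Q x + Q x ** P x" if x: "x \<in> D" for x
  proof -
    note sp = sm(2-11)[THEN smooth_on_partials[OF U _ x]]
    have "has_partials P (conn_u 0 (2 * f x * lu x) (pu lu x) (pu lv x) (pu a1 x) (pu a2 x) (pu b1 x) (pu b2 x) (pu m1 x))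
      (conn_u 0 (2 * f x * lv x) (pv lu x) (pv lv x) (pv a1 x) (pv a2 x) (pv b1 x) (pv b2 x) (pv m1 x)) x"
      unfolding P_def by (intro has_partials_conn_u f[OF x] sp)
    moreover have "has_partials Q (conn_v 0 (2 * f x * lu x) (pu lu x) (pu lv x) (pu a2 x) (pu a3 x) (pu b2 x) (pu b3 x) (pu m2 x))
      (conn_v 0 (2 * f x * lv x) (pv lu x) (pv lv x) (pv a2 x) (pv a3 x) (pv b2 x) (pv b3 x) (pv m2 x)) x"
      unfolding Q_def by (intro has_partials_conn_v f[OF x] sp)
    ultimately show ?thesis
      using conn_flat_iff[THEN iffD2] eqs[OF x] by (simp add: has_partials_pu has_partials_pv P_def Q_def)
  qed
  define m where "m = (\<lambda>x. f x / L0)"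
  have f_m: "f x = L0 * m x" for x using L0 by (simp add: m_def)
  have m_pos: "m x > 0" if "x \<in> D" for x using pos[OF that] by (simp add: m_def)
  have m_partials: "has_partials m (2 * m x * lu x) (2 * m x * lv x) x" if x: "x \<in> D" for x
  proof -
    have "m = (\<lambda>x. inverse L0 * f x)" by (simp add: fun_eq_iff m_def divide_inverse mult.commute)
    then show ?thesis
      using has_partials_linear[OF bounded_linear_mult_right f[OF x], of "inverse L0"]
      by (simp add: m_def divide_inverse mult_ac)
  qed
  obtain \<Phi>0 where \<Phi>0: "gram L0 \<Phi>0 \<Phi>0 = frame_gram (1 / L0) (m x0)"
    using ex_frame_with_gram[OF L0 m_pos[OF x0]] by blast
  have "\<exists>\<Phi>. \<Phi> x0 = \<Phi>0 \<and> (\<forall>x\<in>D. has_partials \<Phi> (P x ** \<Phi> x) (Q x ** \<Phi> x) x)"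
  proof (rule mmult.flat_system_solvable[OF U D(3) x0])
    show "has_partials P (pu P x) (pv P x) x" "has_partials Q (pu Q x) (pv Q x) x" if "x \<in> D" for x
      by (rule smooth_on_partials[OF U smPQ(1) that], rule smooth_on_partials[OF U smPQ(2) that])
    show "continuous_on D (pu P)" "continuous_on D (pv P)" "continuous_on D (pu Q)" "continuous_on D (pv Q)"
      by (intro smooth_on_continuous_on[OF U] smooth_on_pu[OF U] smooth_on_pv[OF U] smPQ)+
    fix x and V :: "real^5^5" assume "x \<in> D"
    then show "pv P x ** V + P x ** (Q x ** V) = pu Q x ** V + Q x ** (P x ** V)"
      using flat[of x] by (simp add: matrix_mul_assoc flip: mmult.add_left)
  qed
  then obtain \<Phi> where \<Phi>_x0: "\<Phi> x0 = \<Phi>0" and \<Phi>: "\<And>x. x \<in> D \<Longrightarrow> has_partials \<Phi> (P x ** \<Phi> x) (Q x ** \<Phi> x) x"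
    by blast
  have sm_upto: "smooth_upto n D P" "smooth_upto n D Q" for n
    using smPQ by (simp_all add: smooth_on_iff_smooth_upto)
  have sm\<Phi>: "smooth_on D \<Phi>"
    by (rule smooth_onI_bootstrap[OF U \<Phi>])
      (auto intro!: smooth_upto_bilinear[OF U bounded_bilinear_matrix_mult] sm_upto)
  have sm_row: "smooth_on D (\<lambda>x. \<Phi> x $ i)" for i
    by (rule smooth_on_linear[OF U bounded_linear_vec_nth sm\<Phi>])
  have row: "pu (\<lambda>x. \<Phi> x $ i) x = (P x ** \<Phi> x) $ i" "pv (\<lambda>x. \<Phi> x $ i) x = (Q x ** \<Phi> x) $ i" if "x \<in> D" for i x
    using has_partials_linear[OF bounded_linear_vec_nth \<Phi>[OF that], of i] by (auto dest: has_partials_pu has_partials_pv)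
  \<comment> \<open>The defect satisfies a homogeneous linear system and vanishes at
    \<open>x0\<close> by the choice of the initial frame.\<close>
  have gram: "gram L0 (\<Phi> x) (\<Phi> x) - frame_gram (1 / L0) (m x) = 0" if "x \<in> D" for x
  proof (rule matrix_system_unique[where K = "\<lambda>x. gram L0 (\<Phi> x) (\<Phi> x) - frame_gram (1 / L0) (m x)" and P = P and Q = Q
        and P' = "\<lambda>x. transpose (P x)" and Q' = "\<lambda>x. transpose (Q x)", OF U D(2) _ _ _ _ _ x0 _ that])
    have tr: "bounded_linear (transpose :: real^5^5 \<Rightarrow> real^5^5)"
      by (intro linear_conv_bounded_linear[THEN iffD1] linearI) (simp_all add: transpose_def vec_eq_iff)
    show "continuous_on D P" "continuous_on D Q" "continuous_on D (\<lambda>x. transpose (P x))" "continuous_on D (\<lambda>x. transpose (Q x))"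
      by (intro smooth_on_continuous_on[OF U] smooth_on_linear[OF U tr] smPQ)+
    show "gram L0 (\<Phi> x0) (\<Phi> x0) - frame_gram (1 / L0) (m x0) = 0" by (simp add: \<Phi>_x0 \<Phi>0)
    fix y assume y: "y \<in> D"
    let ?G = "gram L0 (\<Phi> y) (\<Phi> y)" and ?H = "frame_gram (1 / L0) (m y)"
    have H: "P y ** ?H + ?H ** transpose (P y) = frame_gram 0 (2 * m y * lu y)"
      "Q y ** ?H + ?H ** transpose (Q y) = frame_gram 0 (2 * m y * lv y)"
      unfolding P_def Q_def f_m by (rule conn_preserves_frame_gram[OF L0])+
    have "has_partials (\<lambda>x. frame_gram (1 / L0) (m x)) (frame_gram 0 (2 * m y * lu y)) (frame_gram 0 (2 * m y * lv y)) y"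
      unfolding frame_gram_def
      by (intro has_partials_vec5 has_partials_const m_partials[OF y]
          has_partials_linear[OF bounded_linear_minus[OF bounded_linear_ident]])
    from has_partials_add[OF has_partials_bilinear[OF bounded_bilinear_gram \<Phi>[OF y] \<Phi>[OF y]]
        has_partials_linear[OF bounded_linear_minus[OF bounded_linear_ident] this]]
    show "has_partials (\<lambda>x. gram L0 (\<Phi> x) (\<Phi> x) - frame_gram (1 / L0) (m x))
        (P y ** (?G - ?H) + (?G - ?H) ** transpose (P y)) (Q y ** (?G - ?H) + (?G - ?H) ** transpose (Q y)) y"
      unfolding H[symmetric] gram_mult_left gram_mult_right
      by (simp add: mmult.diff_left mmult.diff_right algebra_simps)
  qed
  have inner: "lor L0 (\<Phi> x $ i) (\<Phi> x $ j) = (if i = j then vec5 (1 / L0) (m x) (m x) (m x) (- m x) $ i else 0)"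
    if "x \<in> D" for x i j
  proof -
    have "gram L0 (\<Phi> x) (\<Phi> x) $ i $ j = frame_gram (1 / L0) (m x) $ i $ j" using gram[OF that] by simp
    then show ?thesis by (simp only: frame_gram_nth) (simp add: gram_def)
  qed
  have det_nz: "det (\<Phi> x) \<noteq> 0" if x: "x \<in> D" for x
  proof -
    have "vec5 (1 / L0) (m x) (m x) (m x) (- m x) $ i \<noteq> 0" for i
      using exhaust_5[of i] L0 m_pos[OF x] by auto
    then obtain G where "\<Phi> x ** G = mat 1" "G ** \<Phi> x = mat 1"
      using orthogonal_frame_expansion(2)[OF inner[OF x]] by blast
    then show ?thesis by (metis invertible_def invertible_det_nz)
  qed
  have "continuous_on D (\<lambda>x. det (\<Phi> x))"
    unfolding det_def
    by (intro continuous_intros smooth_on_continuous_on[OF U] smooth_on_linear[OF U bounded_linear_vec_nth] sm\<Phi>)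
  then have conn: "connected ((\<lambda>x. det (\<Phi> x)) ` D)" using D(2) by (rule connected_continuous_image)
  \<comment> \<open>The determinant never vanishes, so by the intermediate value theorem on the
    connected domain it keeps its sign at \<open>x0\<close>, which fixes the orientation.\<close>
  define ori where "ori = sgn (det (\<Phi> x0))"
  have ori: "ori * det (\<Phi> x) > 0" if x: "x \<in> D" for x
  proof (rule ccontr)
    assume "\<not> ori * det (\<Phi> x) > 0"
    then have "det (\<Phi> x0) \<le> 0 \<and> 0 \<le> det (\<Phi> x) \<or> det (\<Phi> x) \<le> 0 \<and> 0 \<le> det (\<Phi> x0)"
      unfolding ori_def using det_nz[OF x0] by (auto simp: sgn_real_def split: if_splits)
    then have "\<exists>z\<in>(\<lambda>x. det (\<Phi> x)) ` D. 1 \<bullet> z = 0"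
      using connected_ivt_hyperplane[OF conn, of "det (\<Phi> x0)" "det (\<Phi> x)" 1 0]
        connected_ivt_hyperplane[OF conn, of "det (\<Phi> x)" "det (\<Phi> x0)" 1 0] x x0 by auto
    then show False using det_nz by auto
  qed
  define F where "F = (\<lambda>x. \<Phi> x $ 0)"
  define N1 where "N1 = (\<lambda>x. \<Phi> x $ 3)"
  define N2 where "N2 = (\<lambda>x. \<Phi> x $ 4)"
  have T: "pu F x = \<Phi> x $ 1" "pv F x = \<Phi> x $ 2" if "x \<in> D" for x
    unfolding F_def row[OF that] by (simp_all add: row_matrix_mult5 P_def Q_def conn_u_def conn_v_def)
  have frame: "frame_mat F N1 N2 x = \<Phi> x" if "x \<in> D" for x
    by (simp add: frame_mat_eq_vec5 vec5_eq_iff T[OF that]) (simp add: F_def N1_def N2_def)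
  have met: "metric L0 F x = m x" if "x \<in> D" for x
    by (simp add: metric_def T[OF that] inner[OF that])
  have sff: "pu (pu F) x = (P x ** \<Phi> x) $ 1" "pv (pu F) x = (Q x ** \<Phi> x) $ 1" "pv (pv F) x = (Q x ** \<Phi> x) $ 2"
    if x: "x \<in> D" for x
    unfolding row[OF x, symmetric]
    by (rule pu_cong_open[OF U x] pv_cong_open[OF U x], erule T)+
  have rows: "F x = \<Phi> x $ 0" "N1 x = \<Phi> x $ 3" "N2 x = \<Phi> x $ 4" for x
    by (simp_all add: F_def N1_def N2_def)
  have sm_frame: "smooth_on D F" "smooth_on D N1" "smooth_on D N2"
    unfolding F_def N1_def N2_def by (rule sm_row)+
  have "framed_surface L0 D F N1 N2 ori"
  proof
    show "conf_imm L0 D F"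
      unfolding conf_imm_def
      by (simp add: sm_frame met m_pos T rows inner)
    have "ori = 1 \<or> ori = - 1" using det_nz[OF x0] by (auto simp: ori_def sgn_real_def)
    then show "adapted_frame L0 D F N1 N2 ori"
      unfolding adapted_frame_def
      by (simp add: sm_frame frame T met ori rows inner)
  qed (use L0 U in auto)
  moreover have "metric L0 F x = f x / L0 \<and>
    alpha1 L0 F N1 x = a1 x \<and> alpha2 L0 F N1 x = a2 x \<and> alpha3 L0 F N1 x = a3 x \<and>
    beta1 L0 F N2 x = b1 x \<and> beta2 L0 F N2 x = b2 x \<and> beta3 L0 F N2 x = b3 x" if x: "x \<in> D" for x
  proof -
    have nz: "f x \<noteq> 0" using pos[OF x] by auto
    show ?thesis
      unfolding alpha1_def alpha2_def alpha3_def beta1_def beta2_def beta3_def sff_N1_def sff_N2_def sff[OF x] met[OF x]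
      by (simp add: row_matrix_mult5 P_def Q_def conn_u_def conn_v_def N1_def N2_def inner[OF x]
          lor.add_left lor.diff_left lor.scaleR_left lor.minus_left nz m_def L0)
  qed
  ultimately show ?thesis by blast
qed

text \<open>Translation into real coefficients. The equations for \<open>f\<close> are
  complex-valued; their real parts suffice because \<open>A + cnj A\<close> and
  \<open>B + cnj B\<close> are real.\<close>

lemma reconstruct_from_complex_data:
  fixes W X Y Z :: "real \<times> real \<Rightarrow> complex"
  defines "f \<equiv> \<lambda>y. DeltaF W X Y Z y - pu (AF W X Y Z) y - pv (BF W X Y Z) y"
  assumes L0: "L0 \<noteq> 0" and D: "open D" "connected D" "simply_connected D"
    and sm: "smooth_on D W" "smooth_on D X" "smooth_on D Y" "smooth_on D Z"
    and hyp: "\<And>x. x \<in> D \<Longrightarrow> W x + cnj (W x) = X x + cnj (X x)" "\<And>x. x \<in> D \<Longrightarrow> Y x + cnj (Y x) = Z x + cnj (Z x)"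
      "\<And>x. x \<in> D \<Longrightarrow> DeltaF W X Y Z x \<noteq> 0"
      "\<And>x. x \<in> D \<Longrightarrow> DeltaF W X Y Z x - cnj (DeltaF W X Y Z x) =
            pu (\<lambda>y. AF W X Y Z y - cnj (AF W X Y Z y)) x + pv (\<lambda>y. BF W X Y Z y - cnj (BF W X Y Z y)) x"
    and pos: "\<And>x. x \<in> D \<Longrightarrow> Re (f x) / L0 > 0"
    and fuv: "\<And>x. x \<in> D \<Longrightarrow> pu f x = f x * (AF W X Y Z x + cnj (AF W X Y Z x))"
      "\<And>x. x \<in> D \<Longrightarrow> pv f x = f x * (BF W X Y Z x + cnj (BF W X Y Z x))"
  shows "\<exists>F N1 N2 ori. framed_surface L0 D F N1 N2 ori \<and>
    (\<forall>x\<in>D. lam L0 F x = ln (Re (f x) / L0) / 2 \<and>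
      assocW L0 F N1 N2 x = W x \<and> assocX L0 F N1 N2 x = X x \<and>
      assocY L0 F N1 N2 x = Y x \<and> assocZ L0 F N1 N2 x = Z x)"
proof (cases "D = {}")
  case True
  \<comment> \<open>Over the empty domain every pointwise condition is vacuous, so constant maps
    serve; the other case has a base point.\<close>
  then have "smooth_on D (\<lambda>_. 0 :: real^5)" by (simp add: smooth_on_def differentiable_on_def)
  then have "framed_surface L0 D (\<lambda>_. 0) (\<lambda>_. 0) (\<lambda>_. 0) 1"
    using L0 D(1) True by unfold_locales (auto simp: conf_imm_def adapted_frame_def)
  then show ?thesis using True by blast
next
  case False
  then obtain x0 where x0: "x0 \<in> D" by blast
  note U = D(1)
  let ?\<Delta> = "DeltaF W X Y Z" and ?A = "AF W X Y Z" and ?B = "BF W X Y Z"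
  have sm\<Delta>: "smooth_on D ?\<Delta>"
  proof -
    have "?\<Delta> = (\<lambda>x. W x * X x - Y x * Z x)" by (simp add: fun_eq_iff DeltaF_def)
    then show ?thesis using smooth_on_diff[OF U smooth_on_mult[OF U sm(1,2)] smooth_on_mult[OF U sm(3,4)]] by simp
  qed
  have smAB: "smooth_on D ?A" "smooth_on D ?B"
  proof -
    have e: "?A = (\<lambda>x. \<i> / ?\<Delta> x * (X x * (pv Y x + \<i> * pu X x) - Z x * (pv W x + \<i> * pu Z x)))"
      "?B = (\<lambda>x. 1 / ?\<Delta> x * (Y x * (pv Y x + \<i> * pu X x) - W x * (pv W x + \<i> * pu Z x)))"
      by (simp_all add: fun_eq_iff AF_def BF_def)
    show "smooth_on D ?A" "smooth_on D ?B"
      unfolding e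
      by (intro smooth_on_mult smooth_on_divide smooth_on_diff smooth_on_add smooth_on_const smooth_on_pu smooth_on_pv U sm sm\<Delta> hyp(3),
          assumption)+
  qed
  have smf: "smooth_on D f"
    unfolding f_def by (intro smooth_on_diff smooth_on_pu smooth_on_pv U sm\<Delta> smAB)
  note smRe = smooth_on_linear[OF U bounded_linear_Re] and smIm = smooth_on_linear[OF U bounded_linear_Im]
  \<comment> \<open>The real data come from inverting the definitions of the associated functions
    with \<open>A\<close> and \<open>B\<close> in the roles of \<phi> and \<psi>. Since
    \<open>W\<close> and \<open>X\<close>, and likewise \<open>Y\<close> and \<open>Z\<close>, share
    their real part, \<open>a2\<close> and \<open>b2\<close> are unambiguous.\<close>
  define fr where "fr = (\<lambda>x. Re (f x))"
  define lu where "lu = (\<lambda>x. Re (?A x))"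
  define lv where "lv = (\<lambda>x. Re (?B x))"
  define a1 where "a1 = (\<lambda>x. - Im (Y x))"
  define a2 where "a2 = (\<lambda>x. Re (W x))"
  define a3 where "a3 = (\<lambda>x. Im (Z x))"
  define b1 where "b1 = (\<lambda>x. - Im (W x))"
  define b2 where "b2 = (\<lambda>x. Re (Y x))"
  define b3 where "b3 = (\<lambda>x. Im (X x))"
  define m1 where "m1 = (\<lambda>x. Im (?B x))"
  define m2 where "m2 = (\<lambda>x. - Im (?A x))"
  note defs = fr_def lu_def lv_def a1_def a2_def a3_def b1_def b2_def b3_def m1_def m2_def
  have sms: "smooth_on D fr" "smooth_on D lu" "smooth_on D lv" "smooth_on D a1" "smooth_on D a2" "smooth_on D a3"
      "smooth_on D b1" "smooth_on D b2" "smooth_on D b3" "smooth_on D m1" "smooth_on D m2"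
    unfolding defs by (intro smRe smIm smooth_on_minus U smf smAB sm)+
  have re: "Re (X x) = a2 x" "Re (Z x) = b2 x" if "x \<in> D" for x
    using hyp(1,2)[OF that] by (simp_all add: complex_eq_iff a2_def b2_def)
  have parts: "has_partials (\<lambda>x. Re (g x)) (Re (pu g x)) (Re (pv g x)) x" "has_partials (\<lambda>x. Im (g x)) (Im (pu g x)) (Im (pv g x)) x"
      "has_partials (\<lambda>x. - Im (g x)) (- Im (pu g x)) (- Im (pv g x)) x"
    if "smooth_on D g" "x \<in> D" for g :: "real \<times> real \<Rightarrow> complex" and x
    by (intro has_partials_linear[OF bounded_linear_Re] has_partials_linear[OF bounded_linear_Im]
        has_partials_linear[OF bounded_linear_minus[OF bounded_linear_Im]] smooth_on_partials[OF U] that)+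
  note pRe = has_partials_pu[OF parts(1)] has_partials_pv[OF parts(1)]
    and pIm = has_partials_pu[OF parts(2)] has_partials_pv[OF parts(2)]
    and pmIm = has_partials_pu[OF parts(3)] has_partials_pv[OF parts(3)]
  have reX: "Re (pu X x) = pu a2 x" "Re (pv Z x) = pv b2 x" "Re (pu Z x) = pu b2 x" if x: "x \<in> D" for x
  proof -
    have "pu (\<lambda>x. Re (X x)) x = pu a2 x" "pv (\<lambda>x. Re (Z x)) x = pv b2 x" "pu (\<lambda>x. Re (Z x)) x = pu b2 x"
      by (rule pu_cong_open[OF U x] pv_cong_open[OF U x], erule re)+
    then show "Re (pu X x) = pu a2 x" "Re (pv Z x) = pv b2 x" "Re (pu Z x) = pu b2 x"
      by (simp_all add: pRe[OF sm(2) x] pRe[OF sm(4) x])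
  qed
  have "\<exists>F N1 N2 ori. framed_surface L0 D F N1 N2 ori \<and> (\<forall>x\<in>D. metric L0 F x = fr x / L0 \<and>
    alpha1 L0 F N1 x = a1 x \<and> alpha2 L0 F N1 x = a2 x \<and> alpha3 L0 F N1 x = a3 x \<and>
    beta1 L0 F N2 x = b1 x \<and> beta2 L0 F N2 x = b2 x \<and> beta3 L0 F N2 x = b3 x)"
  proof (rule reconstruct_surface[OF L0 D x0 sms])
    fix x assume x: "x \<in> D"
    show "fr x / L0 > 0" using pos[OF x] by (simp add: fr_def)
    show fp: "has_partials fr (2 * fr x * lu x) (2 * fr x * lv x) x"
      using parts(1)[OF smf x] unfolding fuv[OF x] by (simp add: fr_def lu_def lv_def algebra_simps)
    note pAB = pRe[OF smAB(1) x] pRe[OF smAB(2) x] pIm[OF smAB(1) x] pIm[OF smAB(2) x] pmIm[OF smAB(1) x] pmIm[OF smAB(2) x]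
    \<comment> \<open>The real and imaginary parts of \<Delta> are the right-hand sides of the Gauss
      and Ricci equations.\<close>
    have D1: "Re (?\<Delta> x) = a2 x * a2 x - a1 x * a3 x + b1 x * b3 x - b2 x * b2 x"
      "Im (?\<Delta> x) = a1 x * b2 x + a2 x * b3 x - a2 x * b1 x - a3 x * b2 x"
      using re[OF x] by (simp_all add: DeltaF_def defs)
    have "fr x = Re (?\<Delta> x) - Re (pu ?A x) - Re (pv ?B x)" by (simp add: fr_def f_def)
    then show "pu lu x + pv lv x + fr x = a2 x * a2 x - a1 x * a3 x + b1 x * b3 x - b2 x * b2 x"
      unfolding D1(1)[symmetric] by (simp add: lu_def lv_def pAB)
    have cnj: "has_partials (\<lambda>y. g y - cnj (g y)) (pu g x - cnj (pu g x)) (pv g x - cnj (pv g x)) x"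
      if "smooth_on D g" for g :: "real \<times> real \<Rightarrow> complex"
      by (intro has_partials_linear[OF bounded_linear_sub[OF bounded_linear_ident bounded_linear_cnj]]
          smooth_on_partials[OF U that x])
    have "Im (?\<Delta> x) = Im (pu ?A x) + Im (pv ?B x)"
      using hyp(4)[OF x] unfolding has_partials_pu[OF cnj[OF smAB(1)]] has_partials_pv[OF cnj[OF smAB(2)]]
      by (simp add: complex_eq_iff)
    then show "pv m1 x - pu m2 x = a1 x * b2 x + a2 x * b3 x - a2 x * b1 x - a3 x * b2 x"
      unfolding D1(2)[symmetric] by (simp add: m1_def m2_def pAB)
    \<comment> \<open>The functions \<open>2 * lu\<close> and \<open>2 * lv\<close> are the partial
      derivatives of \<open>ln (fr x / L0)\<close>, so the claim is symmetry of its second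
      derivatives.\<close>
    show "pv lu x = pu lv x"
    proof -
      define l where "l = (\<lambda>x. ln (fr x / L0))"
      have frL: "fr x / L0 > 0" if "x \<in> D" for x using pos[OF that] by (simp add: fr_def)
      have smq: "smooth_on D (\<lambda>x. fr x / L0)"
        by (intro smooth_on_divide smooth_on_const U sms(1) L0)
      have sml: "smooth_on D l" unfolding l_def by (rule smooth_on_ln[OF U smq frL])
      have pl: "has_partials l (2 * lu y) (2 * lv y) y" if y: "y \<in> D" for y
      proof -
        have fy: "has_partials fr (2 * fr y * lu y) (2 * fr y * lv y) y"
          using parts(1)[OF smf y] unfolding fuv[OF y] by (simp add: fr_def lu_def lv_def algebra_simps)
        have "has_partials (\<lambda>x. ln (inverse L0 * fr x)) (inverse (inverse L0 * fr y) * (inverse L0 * (2 * fr y * lu y)))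
          (inverse (inverse L0 * fr y) * (inverse L0 * (2 * fr y * lv y))) y"
          using frL[OF y]
          by (intro has_partials_field[OF has_partials_linear[OF bounded_linear_mult_right fy]])
            (auto intro!: derivative_eq_intros simp: divide_inverse mult.commute)
        moreover have "inverse (inverse L0 * fr y) * (inverse L0 * (2 * fr y * q)) = 2 * q" for q
          using frL[OF y] L0 by (auto simp: field_simps)
        moreover have "l = (\<lambda>x. ln (inverse L0 * fr x))" by (simp add: l_def fun_eq_iff divide_inverse mult.commute)
        ultimately show ?thesis by (simp only:)
      qed
      have "pv (pu l) x = pv (\<lambda>y. 2 * lu y) x" by (rule pv_cong_open[OF U x]) (rule has_partials_pu[OF pl])
      also have "\<dots> = 2 * pv lu x" by (rule pv_linear[OF U sms(2) x bounded_linear_mult_right])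
      finally have 1: "pv (pu l) x = 2 * pv lu x" .
      have "pu (pv l) x = pu (\<lambda>y. 2 * lv y) x" by (rule pu_cong_open[OF U x]) (rule has_partials_pv[OF pl])
      also have "\<dots> = 2 * pu lv x" by (rule pu_linear[OF U sms(3) x bounded_linear_mult_right])
      finally show ?thesis using 1 mixed_partials_eq_real[OF U sml x] by simp
    qed
    have nz: "W x * X x - Y x * Z x \<noteq> 0" using hyp(3)[OF x] by (simp add: DeltaF_def)
    have S: "pv Y x + \<i> * pu X x = - \<i> * W x * ?A x - Z x * ?B x"
      and R: "pv W x + \<i> * pu Z x = - \<i> * Y x * ?A x - X x * ?B x"
      unfolding AF_def BF_def DeltaF_def by (rule codazzi_system_of_solution[OF nz])+
    note pd = pRe[OF sm(1) x] pRe[OF sm(3) x] pIm[OF sm(2) x] pIm[OF sm(4) x] pmIm[OF sm(1) x] pmIm[OF sm(3) x]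
    have ex: "pv a1 x = - Im (pv Y x)" "pu a2 x = Re (pu X x)" "pv b1 x = - Im (pv W x)" "pu b2 x = Re (pu Z x)"
      "pu a3 x = Im (pu Z x)" "pv a2 x = Re (pv W x)" "pu b3 x = Im (pu X x)" "pv b2 x = Re (pv Y x)"
      using reX[OF x] by (simp_all add: a1_def b1_def a3_def b3_def pd) (simp_all add: a2_def b2_def pd)
    have val: "Re (W x) = a2 x" "Im (W x) = - b1 x" "Re (X x) = a2 x" "Im (X x) = b3 x" "Re (Y x) = b2 x" "Im (Y x) = - a1 x"
      "Re (Z x) = b2 x" "Im (Z x) = a3 x" "Re (?A x) = lu x" "Im (?A x) = - m2 x" "Re (?B x) = lv x" "Im (?B x) = m1 x"
      using re[OF x] by (simp_all add: defs)
    show "pv a1 x - pu a2 x = lv x * a3 x + lu x * a2 x - b1 x * m2 x + b2 x * m1 x"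
      "pu b3 x - pv b2 x = lu x * b1 x + lv x * b2 x - a3 x * m1 x + a2 x * m2 x"
      using S unfolding ex by (simp_all add: complex_eq_iff val algebra_simps)
    show "pv b1 x - pu b2 x = lv x * b3 x + lu x * b2 x - a1 x * m2 x + a2 x * m1 x"
      "pu a3 x - pv a2 x = lu x * a1 x + lv x * a2 x - b3 x * m1 x + b2 x * m2 x"
      using R unfolding ex by (simp_all add: complex_eq_iff val algebra_simps)
  qed
  then obtain F N1 N2 ori where S: "framed_surface L0 D F N1 N2 ori" and dat: "\<And>x. x \<in> D \<Longrightarrow> metric L0 F x = fr x / L0 \<and>
    alpha1 L0 F N1 x = a1 x \<and> alpha2 L0 F N1 x = a2 x \<and> alpha3 L0 F N1 x = a3 x \<and>
    beta1 L0 F N2 x = b1 x \<and> beta2 L0 F N2 x = b2 x \<and> beta3 L0 F N2 x = b3 x" by blast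
  have "lam L0 F x = ln (Re (f x) / L0) / 2 \<and>
      assocW L0 F N1 N2 x = W x \<and> assocX L0 F N1 N2 x = X x \<and>
      assocY L0 F N1 N2 x = Y x \<and> assocZ L0 F N1 N2 x = Z x" if x: "x \<in> D" for x
    using dat[OF x] re[OF x]
    by (simp add: lam_def assocW_def assocX_def assocY_def assocZ_def complex_eq_iff defs)
  with S show ?thesis by blast
qed

theorem theorem6p3:
  fixes L0 :: real
  assumes L0: "L0 \<noteq> 0"
  shows
   "(\<forall>U F N1 N2 ori.
       open U \<and> conf_imm L0 U F \<and> adapted_frame L0 U F N1 N2 ori \<and> twistor_nondeg L0 U F N1 N2 \<longrightarrow>
       (let W = assocW L0 F N1 N2; X = assocX L0 F N1 N2; Y = assocY L0 F N1 N2; Z = assocZ L0 F N1 N2;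
            f = (\<lambda>x. L0 * exp (2 * lam L0 F x))
        in \<forall>x\<in>U. DeltaF W X Y Z x \<noteq> 0 \<and>
             AF W X Y Z x = assocPhi L0 F N1 N2 x \<and> BF W X Y Z x = assocPsi L0 F N1 N2 x \<and>
             complex_of_real (pu f x) = complex_of_real (f x) * (AF W X Y Z x + cnj (AF W X Y Z x)) \<and>
             complex_of_real (pv f x) = complex_of_real (f x) * (BF W X Y Z x + cnj (BF W X Y Z x))))
    \<and>
    (\<forall>D W X Y Z.
       open D \<and> connected D \<and> simply_connected D \<and>
       smooth_on D W \<and> smooth_on D X \<and> smooth_on D Y \<and> smooth_on D Z \<and>
       (\<forall>x\<in>D. W x + cnj (W x) = X x + cnj (X x) \<and> Y x + cnj (Y x) = Z x + cnj (Z x) \<and>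
          DeltaF W X Y Z x \<noteq> 0 \<and>
          DeltaF W X Y Z x - cnj (DeltaF W X Y Z x) =
            pu (\<lambda>y. AF W X Y Z y - cnj (AF W X Y Z y)) x + pv (\<lambda>y. BF W X Y Z y - cnj (BF W X Y Z y)) x) \<and>
       (let f = (\<lambda>y. DeltaF W X Y Z y - pu (AF W X Y Z) y - pv (BF W X Y Z) y)
        in \<forall>x\<in>D. f x \<noteq> 0 \<and> Re (f x) / L0 > 0 \<and>
             pu f x = f x * (AF W X Y Z x + cnj (AF W X Y Z x)) \<and>
             pv f x = f x * (BF W X Y Z x + cnj (BF W X Y Z x)))
     \<longrightarrow>
       (let f = (\<lambda>y. DeltaF W X Y Z y - pu (AF W X Y Z) y - pv (BF W X Y Z) y);
            good = (\<lambda>F N1 N2 ori. conf_imm L0 D F \<and> adapted_frame L0 D F N1 N2 ori \<and>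
                      (\<forall>x\<in>D. lam L0 F x = ln (Re (f x) / L0) / 2 \<and>
                         assocW L0 F N1 N2 x = W x \<and> assocX L0 F N1 N2 x = X x \<and>
                         assocY L0 F N1 N2 x = Y x \<and> assocZ L0 F N1 N2 x = Z x))
        in \<exists>F N1 N2 ori. good F N1 N2 ori \<and> twistor_nondeg L0 D F N1 N2 \<and>
             (\<forall>F' N1' N2' ori'. good F' N1' N2' ori' \<longrightarrow>
                (\<exists>L. linear L \<and> (\<forall>p q. lor L0 (L p) (L q) = lor L0 p q) \<and> (\<forall>x\<in>D. F' x = L (F x))))))"
  (is "?part1 \<and> ?part2")
proof
  show ?part1
    unfolding Let_def
  proof (intro allI impI ballI, elim conjE)
    fix U F N1 N2 ori x
    assume "open U" "conf_imm L0 U F" "adapted_frame L0 U F N1 N2 ori"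
      and nd: "twistor_nondeg L0 U F N1 N2" and x: "x \<in> U"
    then interpret framed_surface L0 U F N1 N2 ori using L0 by unfold_locales
    show "DeltaF W X Y Z x \<noteq> 0 \<and> AF W X Y Z x = assocPhi L0 F N1 N2 x \<and> BF W X Y Z x = assocPsi L0 F N1 N2 x \<and>
      complex_of_real (pu (\<lambda>x. L0 * exp (2 * lam L0 F x)) x) =
        complex_of_real (L0 * exp (2 * lam L0 F x)) * (AF W X Y Z x + cnj (AF W X Y Z x)) \<and>
      complex_of_real (pv (\<lambda>x. L0 * exp (2 * lam L0 F x)) x) =
        complex_of_real (L0 * exp (2 * lam L0 F x)) * (BF W X Y Z x + cnj (BF W X Y Z x))"
      by (rule twistor_nondeg_imp[OF nd x])
  qed
  show ?part2
    unfolding Let_def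
  proof (intro allI impI, elim conjE)
    fix D and W X Y Z :: "real \<times> real \<Rightarrow> complex"
    let ?f = "\<lambda>y. DeltaF W X Y Z y - pu (AF W X Y Z) y - pv (BF W X Y Z) y"
    let ?good = "\<lambda>F N1 N2 ori. conf_imm L0 D F \<and> adapted_frame L0 D F N1 N2 ori \<and>
      (\<forall>x\<in>D. lam L0 F x = ln (Re (?f x) / L0) / 2 \<and>
         assocW L0 F N1 N2 x = W x \<and> assocX L0 F N1 N2 x = X x \<and>
         assocY L0 F N1 N2 x = Y x \<and> assocZ L0 F N1 N2 x = Z x)"
    assume D: "open D" "connected D" "simply_connected D"
      and sm: "smooth_on D W" "smooth_on D X" "smooth_on D Y" "smooth_on D Z"
      and h1: "\<forall>x\<in>D. W x + cnj (W x) = X x + cnj (X x) \<and> Y x + cnj (Y x) = Z x + cnj (Z x) \<and>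
          DeltaF W X Y Z x \<noteq> 0 \<and>
          DeltaF W X Y Z x - cnj (DeltaF W X Y Z x) =
            pu (\<lambda>y. AF W X Y Z y - cnj (AF W X Y Z y)) x + pv (\<lambda>y. BF W X Y Z y - cnj (BF W X Y Z y)) x"
      and h2: "\<forall>x\<in>D. ?f x \<noteq> 0 \<and> Re (?f x) / L0 > 0 \<and>
             pu ?f x = ?f x * (AF W X Y Z x + cnj (AF W X Y Z x)) \<and>
             pv ?f x = ?f x * (BF W X Y Z x + cnj (BF W X Y Z x))"
    have "\<exists>F N1 N2 ori. framed_surface L0 D F N1 N2 ori \<and>
      (\<forall>x\<in>D. lam L0 F x = ln (Re (?f x) / L0) / 2 \<and>
        assocW L0 F N1 N2 x = W x \<and> assocX L0 F N1 N2 x = X x \<and>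
        assocY L0 F N1 N2 x = Y x \<and> assocZ L0 F N1 N2 x = Z x)"
      by (rule reconstruct_from_complex_data[OF L0 D sm]) (use h1 h2 in \<open>blast+\<close>)
    then obtain F N1 N2 ori where S: "framed_surface L0 D F N1 N2 ori"
      and dat: "\<forall>x\<in>D. lam L0 F x = ln (Re (?f x) / L0) / 2 \<and>
        assocW L0 F N1 N2 x = W x \<and> assocX L0 F N1 N2 x = X x \<and>
        assocY L0 F N1 N2 x = Y x \<and> assocZ L0 F N1 N2 x = Z x" by blast
    interpret s: framed_surface L0 D F N1 N2 ori by (rule S)
    \<comment> \<open>\<Delta> depends only on pointwise values, so the hypothesis passes to the
      constructed surface, where it gives both nondegeneracy and the input for uniqueness.\<close>
    have nz: "DeltaF s.W s.X s.Y s.Z x \<noteq> 0" if "x \<in> D" for x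
      using dat h1 that by (simp add: DeltaF_def)
    have "?good F N1 N2 ori" using s.conf s.adapted dat by blast
    moreover have "twistor_nondeg L0 D F N1 N2"
      using s.twistor_lin_indep_iff nz by (simp add: twistor_nondeg_def)
    moreover have "\<exists>L. linear L \<and> (\<forall>p q. lor L0 (L p) (L q) = lor L0 p q) \<and> (\<forall>x\<in>D. F' x = L (F x))"
      if good: "?good F' N1' N2' ori'" for F' N1' N2' ori'
    proof (rule framed_surfaces_congruent[OF S _ D(2) _ _ _ _ _ nz])
      show "framed_surface L0 D F' N1' N2' ori'" using good L0 D(1) by unfold_locales auto
      fix x assume x: "x \<in> D"
      note g = good[THEN conjunct2, THEN conjunct2, rule_format, OF x] and d = dat[rule_format, OF x]
      show "lam L0 F' x = lam L0 F x" "assocW L0 F' N1' N2' x = assocW L0 F N1 N2 x"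
        "assocX L0 F' N1' N2' x = assocX L0 F N1 N2 x" "assocY L0 F' N1' N2' x = assocY L0 F N1 N2 x"
        "assocZ L0 F' N1' N2' x = assocZ L0 F N1 N2 x"
        using g d by (simp_all only:)
    qed
    ultimately show "\<exists>F N1 N2 ori. ?good F N1 N2 ori \<and> twistor_nondeg L0 D F N1 N2 \<and>
       (\<forall>F' N1' N2' ori'. ?good F' N1' N2' ori' \<longrightarrow>
          (\<exists>L. linear L \<and> (\<forall>p q. lor L0 (L p) (L q) = lor L0 p q) \<and> (\<forall>x\<in>D. F' x = L (F x))))"
      by blast
  qed
qed

end
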